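(* Let $\boldsymbol d=(d_1,\ldots,d_n)$ be a graphical degree sequence (depending on $n$) such that each $d_i$ is positive and even and at least one of the following holds: (R1) $d_{\mathrm{max}}^2=o(n)$; (R2) $\log^8 n=o(d_{\mathrm{max}})$ and $d_{\mathrm{min}}\ge\gamma d_{\mathrm{max}}$ for some fixed $\gamma>0$. If $G\sim\mathcal G(n,\boldsymbol d)$, then for any fixed $\varepsilon>0$, \[ \Pr\bigl(\rho(G)>\widehat\rho(G)+\varepsilon\bigr)\le e^{-\Omega(d_{\mathrm{max}}^2+n)}. \]
   Context: $\mathcal G(n,\boldsymbol d)$ is the uniform probability space of simple graphs on vertex set $\{1,\ldots,n\}$ with degree sequence $\boldsymbol d$. $d_{\mathrm{min}},d_{\mathrm{max}}$ are the minimum and maximum of $\boldsymbol d$. For a graph $G$ with even degrees, $\operatorname{EO}(G)$ is the number of orientations of the edges such that every vertex has in-degree equal to out-degree; $\rho(G):=\frac1n\log\operatorname{EO}(G)$ and $\widehat\rho(G):=\frac1n\sum_{i=1}^n\bigl(\log\binom{d_i}{d_i/2}-\frac{d_i}{2}\log 2\bigr)$. Asymptotics are as $n\to\infty$. *)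

theory Defs
  imports "HOL-Probability.Probability" "HOL-Library.Landau_Symbols" "HOL-Library.Ramsey"
begin

text \<open>A simple graph with vertex set \<open>{1..n}\<close> is given by its edge set \<open>E\<close>, a set of
  two-element subsets of \<open>{1..n}\<close>. A degree sequence of length \<open>n\<close> is a function
  \<open>d\<close>, of which only the values on \<open>{1..n}\<close> are relevant.\<close>

definition deg :: "nat set set \<Rightarrow> nat \<Rightarrow> nat" where
  "deg E v = card {e \<in> E. v \<in> e}"

definition graphs_with_degrees :: "nat \<Rightarrow> (nat \<Rightarrow> nat) \<Rightarrow> nat set set set" where
  "graphs_with_degrees n d = {E. E \<subseteq> nsets {1..n} 2 \<and> (\<forall>i\<in>{1..n}. deg E i = d i)}"

definition graphical :: "nat \<Rightarrow> (nat \<Rightarrow> nat) \<Rightarrow> bool" where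
  "graphical n d \<longleftrightarrow> graphs_with_degrees n d \<noteq> {}"

text \<open>This is the uniform distribution only for graphical \<open>d\<close>:
  \<open>pmf_of_set\<close> is unspecified on the empty set.\<close>

definition random_graph :: "nat \<Rightarrow> (nat \<Rightarrow> nat) \<Rightarrow> nat set set pmf" where
  "random_graph n d = pmf_of_set (graphs_with_degrees n d)"

definition d_max :: "nat \<Rightarrow> (nat \<Rightarrow> nat) \<Rightarrow> nat" where
  "d_max n d = Max (d ` {1..n})"

definition d_min :: "nat \<Rightarrow> (nat \<Rightarrow> nat) \<Rightarrow> nat" where
  "d_min n d = Min (d ` {1..n})"

text \<open>An orientation is a set of arcs \<open>(u, v)\<close>, read as directed from \<open>u\<close> to \<open>v\<close>, such that
  forgetting directions is a bijection onto the edges; so each edge receives exactly one of its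
  two directions.\<close>

definition orientations :: "nat set set \<Rightarrow> (nat \<times> nat) set set" where
  "orientations E = {A. bij_betw (\<lambda>(u, v). {u, v}) A E}"

definition eulerian_orientations :: "nat \<Rightarrow> nat set set \<Rightarrow> (nat \<times> nat) set set" where
  "eulerian_orientations n E =
     {A \<in> orientations E. \<forall>v\<in>{1..n}. card {u. (u, v) \<in> A} = card {w. (v, w) \<in> A}}"

definition EO :: "nat \<Rightarrow> nat set set \<Rightarrow> nat" where
  "EO n E = card (eulerian_orientations n E)"

definition rho :: "nat \<Rightarrow> nat set set \<Rightarrow> real" where
  "rho n E = 1 / real n * ln (real (EO n E))"

definition rho_hat :: "nat \<Rightarrow> nat set set \<Rightarrow> real" where
  "rho_hat n E = 1 / real n *
     (\<Sum>i=1..n. ln (real (deg E i choose (deg E i div 2))) - real (deg E i) / 2 * ln 2)"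

end

theory Submission
  imports Defs "HOL-Combinatorics.Multiset_Permutations" "HOL-Real_Asymp.Real_Asymp"
begin

text \<open>Write \<open>D\<close> for the maximum degree and \<open>m\<close> for the number of edges, and fix a small \<open>\<delta> > 0\<close>.

  If \<open>D\<^sup>2 \<le> \<delta> n\<close>, the sum of \<open>EO\<close> over all graphs is at most the number
  \<open>m! / (\<Prod>i. (d\<^sub>i / 2)!)\<^sup>2\<close> of configurations of balanced digraphs, while switchings in the
  configuration model show that at least a fraction \<open>exp (- (D + D\<^sup>2))\<close> of all pairings is simple.
  Hence the expectation of \<open>EO\<close> is at most \<open>exp (n \<rho> + O(\<delta>) n)\<close>, where \<open>\<rho>\<close> is the estimate
  \<open>rho_hat\<close>, and Markov's inequality applies.

  If \<open>D\<^sup>2 > \<delta> n\<close> (so that the degrees are large and of the same order), every graph satisfies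
  \<open>rho \<le> rho_hat + o(1)\<close>. Reveal an Eulerian orientation edge by edge, guessing the direction of
  \<open>e = {v, w}\<close> from the proportions of signs remaining at \<open>v\<close> and at \<open>w\<close>. In every order the
  factors telescope, and the logarithm of the probability of guessing everything correctly is
  \<open>- n rho_hat - (\<Sum>e. ln (1 - B\<^sub>v(e) B\<^sub>w(e)))\<close>, where \<open>B\<^sub>v(e)\<close> is the mean of the \<open>R\<^sub>v(e)\<close> signs
  remaining at \<open>v\<close>. In a random order the signs at \<open>v\<close> and at \<open>w\<close> are almost independent, so
  \<open>- B\<^sub>v(e) B\<^sub>w(e)\<close> has expectation at most about \<open>1 / (R\<^sub>v(e) R\<^sub>w(e))\<close>. Its sum over the edges is
  \<open>o(n)\<close> if \<open>R\<^sub>v(e)\<close> and \<open>R\<^sub>w(e)\<close> are rarely small simultaneously; this is achieved by postponing a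
  sparse random set of edges and, among these, the edges inside a small random set of vertices.\<close>

section \<open>Sequential guessing of orientations\<close>

text \<open>For \<open>D^2 \<le> \<delta> n\<close> the exponent \<open>D^2 + n\<close> has order
  \<open>n\<close>, so Markov's inequality suffices once the loss \<open>exp (D + D^2)\<close> of
  the pairing model is absorbed. For larger \<open>D\<close> that loss can exceed any gain; there
  the bad event is shown to be empty for large \<open>n\<close>, so every exponent is available.

  The obstacle in the second case: in any order each vertex sees every value 1, 2, ..., d of its
  remaining count once, so its sum of \<open>1 / R^2\<close> is at least 1. If small counts at the
  two ends of an edge coincide, as they do in a uniformly random order, the bound on the total loss
  has order \<open>n\<close>. The late set \<open>H\<close> and the vertex set \<open>U\<close>
  separate them: a vertex outside \<open>U\<close> usually finishes with edges into
  \<open>U\<close>, whose other ends still have many edges inside \<open>U\<close> to come; only the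
  rare vertices of \<open>U\<close> finish together.

  The price is that an edge's place in the order now depends on its far endpoint, so the edges at a
  vertex are no longer freely exchangeable. An exchange fails only if three given edges are all
  late, which has probability at most \<open>\<theta>^3\<close>; this forces \<open>H\<close> to be
  sparse, while \<open>H\<close> must still contain many edges at every vertex.\<close>

definition later :: "('a \<Rightarrow> nat) \<Rightarrow> 'a set \<Rightarrow> 'a \<Rightarrow> 'a set" where
  "later \<kappa> I e = {f \<in> I. \<kappa> e \<le> \<kappa> f}"

definition bias :: "('a \<Rightarrow> real) \<Rightarrow> ('a \<Rightarrow> nat) \<Rightarrow> 'a set \<Rightarrow> 'a \<Rightarrow> real" where
  "bias s \<kappa> I e = (\<Sum>f\<in>later \<kappa> I e. s f) / real (card (later \<kappa> I e))"

definition edges_at :: "nat set set \<Rightarrow> nat \<Rightarrow> nat set set" where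
  "edges_at E v = {e \<in> E. v \<in> e}"

text \<open>The sign of \<open>e\<close> as seen from its endpoint \<open>v\<close>: 1 if the edge
  leaves \<open>v\<close>, -1 if it enters \<open>v\<close>. Balance at \<open>v\<close> thus means
  that these signs sum to zero.\<close>

definition esgn :: "(nat set \<Rightarrow> real) \<Rightarrow> nat \<Rightarrow> nat set \<Rightarrow> real" where
  "esgn x v e = (if v = Min e then x e else - x e)"

lemma finite_later [simp]: "finite I \<Longrightarrow> finite (later \<kappa> I e)"
  by (simp add: later_def)

lemma finite_edges_at [simp]: "finite E \<Longrightarrow> finite (edges_at E v)"
  by (simp add: edges_at_def)

lemma bias_abs_le:
  assumes "\<And>f. f \<in> I \<Longrightarrow> \<bar>s f\<bar> \<le> 1"
  shows "\<bar>bias s \<kappa> I e\<bar> \<le> 1"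
proof -
  have "\<bar>\<Sum>f\<in>later \<kappa> I e. s f\<bar> \<le> (\<Sum>f\<in>later \<kappa> I e. \<bar>s f\<bar>)" by (rule sum_abs)
  also have "\<dots> \<le> (\<Sum>f\<in>later \<kappa> I e. 1)"
    by (rule sum_mono) (auto simp: later_def assms)
  finally have "\<bar>\<Sum>f\<in>later \<kappa> I e. s f\<bar> \<le> real (card (later \<kappa> I e))" by simp
  thus ?thesis unfolding bias_def
    by (metis abs_divide abs_of_nat abs_not_less_zero divide_le_eq_1 linorder_not_less not_less_iff_gr_or_eq zero_less_abs_iff)
qed

lemma ex_first:
  fixes \<kappa> :: "'a \<Rightarrow> nat"
  assumes "finite F" "F \<noteq> {}" "inj_on \<kappa> F"
  obtains e where "e \<in> F" "\<And>f. f \<in> F \<Longrightarrow> f \<noteq> e \<Longrightarrow> \<kappa> e < \<kappa> f"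
proof -
  obtain e where e: "e \<in> F" "\<And>f. f \<in> F \<Longrightarrow> \<kappa> e \<le> \<kappa> f"
    using assms(1,2) by (metis (mono_tags, lifting) arg_min_if_finite(1,2) linorder_not_less)
  have "\<kappa> e < \<kappa> f" if "f \<in> F" "f \<noteq> e" for f
    using e that assms(3) by (metis inj_onD le_neq_implies_less)
  thus ?thesis using that e by blast
qed

text \<open>Whatever the order, predicting the next sign with the proportion of that sign among the
  remaining ones gives every sign sequence with \<open>a\<close> pluses and \<open>b\<close> minuses the same probability.\<close>

lemma prod_bias:
  fixes \<kappa> :: "'a \<Rightarrow> nat"
  assumes "finite I" "inj_on \<kappa> I" "\<And>e. e \<in> I \<Longrightarrow> s e = 1 \<or> s e = -1"
  shows "(\<Prod>e\<in>I. (1 + s e * bias s \<kappa> I e) / 2) =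
    fact (card {e\<in>I. s e = 1}) * fact (card {e\<in>I. s e = -1}) / fact (card I)"
  using assms
proof (induction "card I" arbitrary: I)
  case 0
  hence "I = {}" by simp
  thus ?case by simp
next
  case (Suc n)
  have "I \<noteq> {}" using Suc.hyps(2) by auto
  then obtain e where e: "e \<in> I" "\<And>f. f \<in> I \<Longrightarrow> f \<noteq> e \<Longrightarrow> \<kappa> e < \<kappa> f"
    using ex_first Suc.prems by metis
  define J where "J = I - {e}"
  have I: "I = insert e J" "e \<notin> J" "finite J" using e Suc.prems by (auto simp: J_def)
  have cJ: "card J = n" using Suc.hyps(2) I by simp
  have IH: "(\<Prod>e\<in>J. (1 + s e * bias s \<kappa> J e) / 2) =
    fact (card {e\<in>J. s e = 1}) * fact (card {e\<in>J. s e = -1}) / fact (card J)"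
    using Suc I cJ by (intro Suc.hyps(1)) (auto simp: inj_on_def)
  have lat: "later \<kappa> I f = later \<kappa> J f" if "f \<in> J" for f
  proof -
    have "\<kappa> e < \<kappa> f" using e(2)[of f] that I by auto
    thus ?thesis using I by (auto simp: later_def)
  qed
  have late: "later \<kappa> I e = I"
    using e(2) by (auto simp: later_def) (metis less_le_not_le linorder_le_cases)
  define a where "a = card {e\<in>J. s e = 1}"
  define b where "b = card {e\<in>J. s e = -1}"
  have ab: "a + b = n"
  proof -
    have "J = {e\<in>J. s e = 1} \<union> {e\<in>J. s e = -1}" using Suc.prems(3) I by auto
    moreover have "card ({e\<in>J. s e = 1} \<union> {e\<in>J. s e = -1}) = card {e\<in>J. s e = 1} + card {e\<in>J. s e = -1}"
      by (rule card_Un_disjoint) (use I(3) in auto)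
    ultimately have "card J = card {e\<in>J. s e = 1} + card {e\<in>J. s e = -1}" by simp
    thus ?thesis by (simp add: a_def b_def cJ)
  qed
  have sJ: "(\<Sum>f\<in>J. s f) = real a - real b"
  proof -
    have "(\<Sum>f\<in>J. s f) = (\<Sum>f\<in>J. of_bool (s f = 1) - of_bool (s f = -1))"
      using Suc.prems(3) I by (intro sum.cong) auto
    also have "\<dots> = real a - real b"
      using I(3) by (simp add: sum_subtractf a_def b_def of_bool_def sum.If_cases Int_def)
    finally show ?thesis .
  qed
  \<comment> \<open>The first element sees all of \<open>I\<close>, so its factor is the proportion
    \<open>(a + 1) / (n + 1)\<close> or \<open>(b + 1) / (n + 1)\<close> of its own sign; the other
    factors do not see it.\<close>
  have "(\<Prod>e\<in>I. (1 + s e * bias s \<kappa> I e) / 2)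
     = (1 + s e * ((s e + (real a - real b)) / real (Suc n))) / 2 * (fact a * fact b / fact n)"
    using I late sJ cJ IH lat by (simp add: bias_def a_def b_def)
  also have "\<dots> = fact (card {e\<in>I. s e = 1}) * fact (card {e\<in>I. s e = -1}) / fact (card I)"
  proof (cases "s e = 1")
    case True
    have "{e\<in>I. s e = 1} = insert e {e\<in>J. s e = 1}" "{e\<in>I. s e = -1} = {e\<in>J. s e = -1}"
      using True I by auto
    hence "card {e\<in>I. s e = 1} = Suc a" "card {e\<in>I. s e = -1} = b" using I by (auto simp: a_def b_def)
    moreover have "(1 + s e * ((s e + (real a - real b)) / real (Suc n))) / 2 = real (Suc a) / real (Suc n)"
      using True ab[symmetric] by (simp add: field_simps)
    ultimately show ?thesis using Suc.hyps(2)[symmetric] by (simp add: fact_Suc del: of_nat_Suc)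
  next
    case False
    hence sm: "s e = -1" using Suc.prems(3) e by auto
    hence "{e\<in>I. s e = -1} = insert e {e\<in>J. s e = -1}" "{e\<in>I. s e = 1} = {e\<in>J. s e = 1}"
      using I by auto
    hence "card {e\<in>I. s e = -1} = Suc b" "card {e\<in>I. s e = 1} = a" using I by (auto simp: a_def b_def)
    moreover have "(1 + s e * ((s e + (real a - real b)) / real (Suc n))) / 2 = real (Suc b) / real (Suc n)"
      using sm ab[symmetric] by (simp add: field_simps)
    ultimately show ?thesis using Suc.hyps(2)[symmetric] by (simp add: fact_Suc del: of_nat_Suc)
  qed
  finally show ?case .
qed

text \<open>At each endpoint of \<open>e\<close> the proportion of remaining edges with a given sign gives a prediction for
  the sign of \<open>e\<close>; \<open>guess\<close> is the normalised product of the two predictions, evaluated at \<open>x e\<close>.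
  The sign \<open>x e = 1\<close> stands for the orientation from \<open>Min e\<close> to \<open>Max e\<close>.\<close>

definition guess :: "(nat set \<Rightarrow> nat) \<Rightarrow> nat set set \<Rightarrow> (nat set \<Rightarrow> real) \<Rightarrow> nat set \<Rightarrow> real" where
  "guess \<kappa> F x e = (let
      B = bias (esgn x (Min e)) \<kappa> (edges_at F (Min e)) e;
      C = bias (esgn x (Max e)) \<kappa> (edges_at F (Max e)) e
    in (1 + x e * B) * (1 - x e * C) / (2 * (1 - B * C)))"

text \<open>For balanced \<open>x\<close> the remaining sums are minus the revealed sums, so each guess depends on the past
  only and the products of guesses form a subprobability distribution.\<close>

lemma sum_prod_guess_le_1:
  assumes "finite F" "\<And>e. e \<in> F \<Longrightarrow> card e = 2" "inj_on \<kappa> F" "finite X"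
    and "\<And>x e. x \<in> X \<Longrightarrow> e \<in> F \<Longrightarrow> x e = 1 \<or> x e = -1"
    and "\<And>x y v. x \<in> X \<Longrightarrow> y \<in> X \<Longrightarrow> (\<Sum>f\<in>edges_at F v. esgn x v f) = (\<Sum>f\<in>edges_at F v. esgn y v f)"
    and "\<And>x y. x \<in> X \<Longrightarrow> y \<in> X \<Longrightarrow> (\<forall>e\<in>F. x e = y e) \<Longrightarrow> x = y"
  shows "(\<Sum>x\<in>X. \<Prod>e\<in>F. guess \<kappa> F x e) \<le> 1"
  using assms
proof (induction "card F" arbitrary: F X)
  case 0
  hence F: "F = {}" by simp
  have "card X \<le> 1" using 0(8) F by (metis (no_types, lifting) 0(5) One_nat_def card_le_Suc0_iff_eq empty_iff)
  thus ?case using F by simp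
next
  case (Suc n)
  have "F \<noteq> {}" using Suc.hyps(2) by auto
  then obtain e where e: "e \<in> F" "\<And>f. f \<in> F \<Longrightarrow> f \<noteq> e \<Longrightarrow> \<kappa> e < \<kappa> f"
    using ex_first Suc.prems(1,3) by metis
  define J where "J = F - {e}"
  have J: "F = insert e J" "e \<notin> J" "finite J" using e Suc.prems by (auto simp: J_def)
  have cJ: "n = card J" using Suc.hyps(2) J by simp
  have lat: "later \<kappa> (edges_at F v) f = later \<kappa> (edges_at J v) f" if "f \<in> J" for f v
  proof -
    have "\<kappa> e < \<kappa> f" using e(2)[of f] that J by auto
    thus ?thesis using J by (auto simp: later_def edges_at_def)
  qed
  have late: "later \<kappa> (edges_at F v) e = edges_at F v" for v
    using e(2) by (auto simp: later_def edges_at_def) (metis less_le_not_le linorder_le_cases)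
  have guessJ: "guess \<kappa> F x f = guess \<kappa> J x f" if "f \<in> J" for x f
    by (simp add: guess_def bias_def lat[OF that])
  have ab: "\<bar>bias (esgn x v) \<kappa> (edges_at F v) f\<bar> \<le> 1" if "x \<in> X" for x v f
    using Suc.prems(5)[OF that] by (intro bias_abs_le) (fastforce simp: edges_at_def esgn_def)
  have sumF: "(\<Sum>f\<in>edges_at F v. esgn x v f) = (if v \<in> e then esgn x v e else 0) + (\<Sum>f\<in>edges_at J v. esgn x v f)" for x v
  proof (cases "v \<in> e")
    case True
    hence "edges_at F v = insert e (edges_at J v)" "e \<notin> edges_at J v" using J by (auto simp: edges_at_def)
    thus ?thesis using True J by simp
  next
    case False
    hence "edges_at F v = edges_at J v" using J by (auto simp: edges_at_def)
    thus ?thesis using False by simp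
  qed
  \<comment> \<open>Splitting by the sign of the first edge keeps the induction hypothesis usable:
    within one class the contribution of \<open>e\<close> is common to all members, so the vertex
    sums over \<open>J\<close> agree again.\<close>
  define Y where "Y = (\<lambda>t::real. {x\<in>X. x e = t})"
  have IH: "(\<Sum>x\<in>Y t. \<Prod>f\<in>J. guess \<kappa> J x f) \<le> 1" for t
  proof (rule Suc.hyps(1)[OF cJ])
    show "finite J" by fact
    show "card f = 2" if "f \<in> J" for f using Suc.prems(2) that J by auto
    show "inj_on \<kappa> J" using Suc.prems(3) J by (auto simp: inj_on_def)
    show "finite (Y t)" using Suc.prems(4) by (simp add: Y_def)
    show "x f = 1 \<or> x f = -1" if "x \<in> Y t" "f \<in> J" for x f using Suc.prems(5) that J by (auto simp: Y_def)
    show "(\<Sum>f\<in>edges_at J v. esgn x v f) = (\<Sum>f\<in>edges_at J v. esgn y v f)" if "x \<in> Y t" "y \<in> Y t" for x y v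
      using Suc.prems(6)[of x y v] that sumF[where v = v] by (auto simp: Y_def esgn_def split: if_splits)
    show "x = y" if "x \<in> Y t" "y \<in> Y t" "\<forall>f\<in>J. x f = y f" for x y
      using Suc.prems(7)[of x y] that J by (auto simp: Y_def)
  qed
  show ?case
  proof (cases "X = {}")
    case False
    then obtain z where z: "z \<in> X" by auto
    define B where "B = bias (esgn z (Min e)) \<kappa> (edges_at F (Min e)) e"
    define C where "C = bias (esgn z (Max e)) \<kappa> (edges_at F (Max e)) e"
    \<comment> \<open>Nothing has been revealed before the first edge, so both biases are vertex
      sums over degrees, the same for all members of \<open>X\<close>; a representative
      \<open>z\<close> supplies them.\<close>
    have p: "guess \<kappa> F x e = (1 + x e * B) * (1 - x e * C) / (2 * (1 - B * C))" if "x \<in> X" for x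
      using Suc.prems(6)[OF that z] by (simp add: guess_def B_def C_def bias_def late Let_def)
    have B: "\<bar>B\<bar> \<le> 1" "\<bar>C\<bar> \<le> 1" using ab[OF z] by (auto simp: B_def C_def)
    have BC: "B * C \<le> 1"
      using B by (metis abs_ge_self abs_mult abs_ge_zero mult_le_one order_trans)
    have "(\<Sum>x\<in>X. \<Prod>f\<in>F. guess \<kappa> F x f) = (\<Sum>x\<in>X. guess \<kappa> F x e * (\<Prod>f\<in>J. guess \<kappa> J x f))"
      using J guessJ by (simp add: J(1))
    also have "\<dots> = (\<Sum>x\<in>Y 1 \<union> Y (-1). guess \<kappa> F x e * (\<Prod>f\<in>J. guess \<kappa> J x f))"
      using Suc.prems(5) e(1) by (intro sum.cong) (auto simp: Y_def)
    also have "\<dots> = (\<Sum>x\<in>Y 1. guess \<kappa> F x e * (\<Prod>f\<in>J. guess \<kappa> J x f))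
        + (\<Sum>x\<in>Y (-1). guess \<kappa> F x e * (\<Prod>f\<in>J. guess \<kappa> J x f))"
      using Suc.prems(4) by (intro sum.union_disjoint) (auto simp: Y_def)
    also have "\<dots> = (1 + B) * (1 - C) / (2 * (1 - B * C)) * (\<Sum>x\<in>Y 1. \<Prod>f\<in>J. guess \<kappa> J x f)
        + (1 - B) * (1 + C) / (2 * (1 - B * C)) * (\<Sum>x\<in>Y (-1). \<Prod>f\<in>J. guess \<kappa> J x f)"
      unfolding sum_distrib_left by (intro arg_cong2[where f = "(+)"] sum.cong) (auto simp: Y_def p)
    also have "\<dots> \<le> (1 + B) * (1 - C) / (2 * (1 - B * C)) * 1 + (1 - B) * (1 + C) / (2 * (1 - B * C)) * 1"
      using B BC by (intro add_mono mult_left_mono IH divide_nonneg_nonneg mult_nonneg_nonneg) auto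
    also have "\<dots> = ((1 + B) * (1 - C) + (1 - B) * (1 + C)) / (2 * (1 - B * C))"
      by (simp add: add_divide_distrib)
    also have "(1 + B) * (1 - C) + (1 - B) * (1 + C) = 2 * (1 - B * C)" by (simp add: algebra_simps)
    \<comment> \<open>If \<open>B * C = 1\<close>, the quotient is \<open>0 / 0 = 0\<close>; this is
      why only an inequality holds here.\<close>
    also have "2 * (1 - B * C) / (2 * (1 - B * C)) \<le> 1" by simp
    finally show ?thesis .
  qed simp
qed

section \<open>Likelihood of a balanced orientation and averaging over orders\<close>

definition corr :: "(nat set \<Rightarrow> nat) \<Rightarrow> nat set set \<Rightarrow> (nat set \<Rightarrow> real) \<Rightarrow> nat set \<Rightarrow> real" where
  "corr \<kappa> E x e = bias (esgn x (Min e)) \<kappa> (edges_at E (Min e)) e * bias (esgn x (Max e)) \<kappa> (edges_at E (Max e)) e"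

lemma nsets_2_cases:
  fixes e :: "nat set"
  assumes "e \<in> nsets V 2"
  obtains a b where "a < b" "e = {a, b}" "a \<in> V" "b \<in> V" "Min e = a" "Max e = b"
proof -
  from assms obtain a b where ab: "e = {a, b}" "a \<noteq> b" "e \<subseteq> V"
    by (auto simp: nsets_def card_2_iff)
  show ?thesis
  proof (cases "a < b")
    case True thus ?thesis using ab that[of a b] by auto
  next
    case False thus ?thesis using ab that[of b a] by auto
  qed
qed

lemma card_signs_eq_half:
  assumes "finite I" "\<And>e. e \<in> I \<Longrightarrow> s e = 1 \<or> s e = (-1::real)" "(\<Sum>e\<in>I. s e) = 0"
  shows "card {e\<in>I. s e = 1} = card I div 2" "card {e\<in>I. s e = -1} = card I div 2" "even (card I)"
proof -
  have "I = {e\<in>I. s e = 1} \<union> {e\<in>I. s e = -1}" using assms(2) by auto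
  moreover have "card ({e\<in>I. s e = 1} \<union> {e\<in>I. s e = -1}) = card {e\<in>I. s e = 1} + card {e\<in>I. s e = -1}"
    by (rule card_Un_disjoint) (use assms(1) in auto)
  ultimately have c: "card I = card {e\<in>I. s e = 1} + card {e\<in>I. s e = -1}" by simp
  have "(\<Sum>e\<in>I. s e) = (\<Sum>e\<in>I. of_bool (s e = 1) - of_bool (s e = -1))"
    using assms(2) by (intro sum.cong) auto
  also have "\<dots> = real (card {e\<in>I. s e = 1}) - real (card {e\<in>I. s e = -1})"
    using assms(1) by (simp add: sum_subtractf of_bool_def sum.If_cases Int_def)
  finally have "card {e\<in>I. s e = 1} = card {e\<in>I. s e = -1}" using assms(3) by simp
  thus "card {e\<in>I. s e = 1} = card I div 2" "card {e\<in>I. s e = -1} = card I div 2" "even (card I)"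
    using c by auto
qed

text \<open>With \<open>p\<close>, \<open>q\<close> the probabilities predicted at the two endpoints
  for the true sign, the guess is \<open>2 * p * q / (1 - B * C)\<close>. The product of all
  \<open>p\<close> is regrouped by vertices, where \<open>prod_bias\<close> turns it into inverse
  central binomial coefficients. The remaining factor is bounded below by
  \<open>exp (B * C)\<close>, so that its logarithm is linear in the correlation and can be
  averaged.\<close>

lemma prod_guess_ge:
  assumes "finite V" "E \<subseteq> nsets V 2" "inj_on \<kappa> E"
    and x: "\<And>e. e \<in> E \<Longrightarrow> x e = 1 \<or> x e = -1"
    and bal: "\<And>v. v \<in> V \<Longrightarrow> (\<Sum>e\<in>edges_at E v. esgn x v e) = 0"
  shows "exp (real (card E) * ln 2 - (\<Sum>v\<in>V. ln (real (card (edges_at E v) choose (card (edges_at E v) div 2))))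
      + (\<Sum>e\<in>E. corr \<kappa> E x e)) \<le> (\<Prod>e\<in>E. guess \<kappa> E x e)"
proof -
  have finE: "finite E" using assms(1,2) finite_imp_finite_nsets finite_subset by blast
  have xv: "esgn x v e = 1 \<or> esgn x v e = -1" if "e \<in> E" for v e using x[OF that] by (auto simp: esgn_def)
  define p where "p = (\<lambda>v e. (1 + esgn x v e * bias (esgn x v) \<kappa> (edges_at E v) e) / 2)"
  have prod_p: "(\<Prod>e\<in>edges_at E v. p v e) = 1 / real (card (edges_at E v) choose (card (edges_at E v) div 2))"
    if "v \<in> V" for v
  proof -
    let ?I = "edges_at E v"
    have fI: "finite ?I" using finE by simp
    have s: "\<And>e. e \<in> ?I \<Longrightarrow> esgn x v e = 1 \<or> esgn x v e = -1" using xv by (auto simp: edges_at_def)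
    have inj: "inj_on \<kappa> ?I" using assms(3) by (auto simp: inj_on_def edges_at_def)
    note h = card_signs_eq_half[OF fI s bal[OF that]]
    have "(\<Prod>e\<in>?I. p v e) = fact (card ?I div 2) * fact (card ?I div 2) / fact (card ?I)"
      using prod_bias[OF fI inj s] h(1,2) by (simp add: p_def)
    also have "\<dots> = 1 / real (card ?I choose (card ?I div 2))"
    proof -
      have "card ?I - card ?I div 2 = card ?I div 2" using h(3) by presburger
      thus ?thesis using binomial_fact[of "card ?I div 2" "card ?I", where 'a = real] by simp
    qed
    finally show ?thesis .
  qed
  have ppos: "p v e > 0" "p v e \<le> 1" if "e \<in> edges_at E v" for v e
  proof -
    let ?L = "later \<kappa> (edges_at E v) e"
    have L: "finite ?L" "e \<in> ?L" using finE that by (auto simp: later_def)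
    have e: "e \<in> E" using that by (simp add: edges_at_def)
    have b: "\<bar>bias (esgn x v) \<kappa> (edges_at E v) e\<bar> \<le> 1"
    proof (rule bias_abs_le)
      fix f assume "f \<in> edges_at E v"
      thus "\<bar>esgn x v f\<bar> \<le> 1" using xv[of f v] by (auto simp: edges_at_def)
    qed
    have xe: "\<bar>esgn x v e\<bar> = 1" using xv[OF e] by (metis abs_1 abs_minus)
    have "\<bar>esgn x v e * bias (esgn x v) \<kappa> (edges_at E v) e\<bar> \<le> 1" using b xe by (simp add: abs_mult)
    thus "p v e \<le> 1" by (simp add: p_def abs_le_iff)
    \<comment> \<open>Among the nonnegative terms the one of \<open>e\<close> itself equals 2, so
      the true sign always has positive predicted probability.\<close>
    have "(\<Sum>f\<in>?L. 1 + esgn x v e * esgn x v f) \<ge> 1 + esgn x v e * esgn x v e"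
    proof (rule member_le_sum[OF L(2) _ L(1)])
      fix f assume "f \<in> ?L - {e}"
      hence "f \<in> E" by (auto simp: later_def edges_at_def)
      thus "0 \<le> 1 + esgn x v e * esgn x v f" using xv[OF e, of v] xv[of f v] by auto
    qed
    also have "esgn x v e * esgn x v e = 1" using xv[OF e, of v] by auto
    finally have "0 < (\<Sum>f\<in>?L. 1 + esgn x v e * esgn x v f)" by simp
    also have "\<dots> = card ?L + esgn x v e * (\<Sum>f\<in>?L. esgn x v f)" by (simp add: sum.distrib sum_distrib_left)
    finally have pos: "0 < card ?L + esgn x v e * (\<Sum>f\<in>?L. esgn x v f)" .
    have L0: "real (card ?L) > 0" using L by (auto simp: card_gt_0_iff)
    have "0 < (card ?L + esgn x v e * (\<Sum>f\<in>?L. esgn x v f)) / card ?L"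
      using pos L0 by (rule divide_pos_pos)
    also have "\<dots> = 1 + esgn x v e * bias (esgn x v) \<kappa> (edges_at E v) e"
      unfolding bias_def add_divide_distrib using L0 by simp
    finally show "p v e > 0" by (simp add: p_def)
  qed
  have g: "guess \<kappa> E x e \<ge> 2 * (\<Prod>v\<in>e. p v e) * exp (corr \<kappa> E x e)"
     "2 * (\<Prod>v\<in>e. p v e) * exp (corr \<kappa> E x e) > 0" if "e \<in> E" for e
  proof -
    have "e \<in> nsets V 2" using that assms(2) by auto
    then obtain a b where ab: "a < b" "e = {a, b}" "a \<in> V" "b \<in> V" "Min e = a" "Max e = b"
      by (rule nsets_2_cases)
    define B where "B = bias (esgn x a) \<kappa> (edges_at E a) e"
    define C where "C = bias (esgn x b) \<kappa> (edges_at E b) e"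
    have in_ab: "e \<in> edges_at E a" "e \<in> edges_at E b" using that ab by (auto simp: edges_at_def)
    have pab: "p a e = (1 + x e * B) / 2" "p b e = (1 - x e * C) / 2"
      using ab by (auto simp: p_def esgn_def B_def C_def)
    have xx: "x e * x e = 1" using x[OF that] by auto
    have c: "corr \<kappa> E x e = B * C" using ab by (simp add: corr_def B_def C_def)
    have "1 - B * C = 2 * (p a e * p b e + (1 - p a e) * (1 - p b e))"
    proof -
      have "2 * (p a e * p b e + (1 - p a e) * (1 - p b e)) = 1 - (x e * x e) * (B * C)"
        unfolding pab by (simp add: field_simps)
      thus ?thesis by (simp add: xx)
    qed
    also have "\<dots> > 0"
      using ppos[OF in_ab(1)] ppos[OF in_ab(2)] by (simp add: add_pos_nonneg)
    finally have pos: "1 - B * C > 0" .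
    have "1 - B * C \<le> exp (- (B * C))" using exp_ge_add_one_self[of "- (B * C)"] by simp
    hence "exp (B * C) * (1 - B * C) \<le> exp (B * C) * exp (- (B * C))" by (intro mult_left_mono) auto
    hence ex: "exp (B * C) \<le> 1 / (1 - B * C)" using pos by (simp add: field_simps exp_minus)
    have pab2: "2 * p a e = 1 + x e * B" "2 * p b e = 1 - x e * C" by (simp_all add: pab)
    have "guess \<kappa> E x e = (2 * p a e) * (2 * p b e) / (2 * (1 - B * C))"
      unfolding guess_def ab(5,6) B_def[symmetric] C_def[symmetric] Let_def pab2 by simp
    also have "\<dots> = 2 * (p a e * p b e) * (1 / (1 - B * C))"
    proof -
      have "(2 * P) * (2 * Q) / (2 * Z) = 2 * (P * Q) * (1 / Z)" for P Q Z :: real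
        by (cases "Z = 0") (simp_all add: field_simps)
      thus ?thesis .
    qed
    also have "\<dots> \<ge> 2 * (p a e * p b e) * exp (B * C)"
      using ppos(1)[OF in_ab(1)] ppos(1)[OF in_ab(2)] ex by (intro mult_left_mono) auto
    finally show "guess \<kappa> E x e \<ge> 2 * (\<Prod>v\<in>e. p v e) * exp (corr \<kappa> E x e)" using ab c by simp
    show "2 * (\<Prod>v\<in>e. p v e) * exp (corr \<kappa> E x e) > 0"
      using ppos(1)[OF in_ab(1)] ppos(1)[OF in_ab(2)] ab by simp
  qed
  have "(\<Prod>e\<in>E. \<Prod>v\<in>e. p v e) = (\<Prod>e\<in>E. \<Prod>v | v \<in> V \<and> v \<in> e. p v e)"
    using assms(2) by (intro prod.cong refl) (auto simp: nsets_def)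
  also have "\<dots> = (\<Prod>v\<in>V. \<Prod>e\<in>edges_at E v. p v e)"
    unfolding edges_at_def using finE assms(1) by (rule prod.swap_restrict)
  also have "\<dots> = (\<Prod>v\<in>V. exp (- ln (real (card (edges_at E v) choose (card (edges_at E v) div 2)))))"
    by (intro prod.cong refl) (simp add: prod_p exp_minus field_simps)
  also have "\<dots> = exp (- (\<Sum>v\<in>V. ln (real (card (edges_at E v) choose (card (edges_at E v) div 2)))))"
    using assms(1) by (simp add: exp_sum sum_negf[symmetric] del: sum_negf)
  finally have P: "(\<Prod>e\<in>E. \<Prod>v\<in>e. p v e) = \<dots>" .
  have "exp (real (card E) * ln 2 - (\<Sum>v\<in>V. ln (real (card (edges_at E v) choose (card (edges_at E v) div 2))))
      + (\<Sum>e\<in>E. corr \<kappa> E x e)) = 2 ^ card E * (\<Prod>e\<in>E. \<Prod>v\<in>e. p v e) * (\<Prod>e\<in>E. exp (corr \<kappa> E x e))"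
    unfolding P using finE by (simp add: exp_add exp_diff exp_minus field_simps exp_of_nat_mult exp_sum)
  also have "\<dots> = (\<Prod>e\<in>E. 2 * (\<Prod>v\<in>e. p v e) * exp (corr \<kappa> E x e))"
    by (simp add: prod.distrib)
  also have "\<dots> \<le> (\<Prod>e\<in>E. guess \<kappa> E x e)"
    by (rule prod_mono) (use g in \<open>auto intro: less_imp_le\<close>)
  finally show ?thesis .
qed

text \<open>Averaging the subprobability distribution over random orders and applying Jensen's inequality
  reduces an upper bound on the number of Eulerian orientations to the expected correlations.\<close>

lemma card_balanced_le:
  assumes "finite V" "E \<subseteq> nsets V 2" "finite X" "finite \<Omega>"
    and x: "\<And>x e. x \<in> X \<Longrightarrow> e \<in> E \<Longrightarrow> x e = 1 \<or> x e = -1"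
    and bal: "\<And>x v. x \<in> X \<Longrightarrow> v \<in> V \<Longrightarrow> (\<Sum>e\<in>edges_at E v. esgn x v e) = 0"
    and ext: "\<And>x y. x \<in> X \<Longrightarrow> y \<in> X \<Longrightarrow> (\<forall>e\<in>E. x e = y e) \<Longrightarrow> x = y"
    and w: "\<And>\<omega>. \<omega> \<in> \<Omega> \<Longrightarrow> w \<omega> \<ge> 0" "(\<Sum>\<omega>\<in>\<Omega>. w \<omega>) = 1"
    and inj: "\<And>\<omega>. \<omega> \<in> \<Omega> \<Longrightarrow> inj_on (\<kappa> \<omega>) E"
    and loss: "\<And>x. x \<in> X \<Longrightarrow> (\<Sum>\<omega>\<in>\<Omega>. w \<omega> * (\<Sum>e\<in>E. - corr (\<kappa> \<omega>) E x e)) \<le> \<Lambda>"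
  shows "real (card X) \<le> exp ((\<Sum>v\<in>V. ln (real (card (edges_at E v) choose (card (edges_at E v) div 2))))
      - real (card E) * ln 2 + \<Lambda>)"
proof -
  have finE: "finite E" using assms(1,2) finite_imp_finite_nsets finite_subset by blast
  define M where "M = (\<Sum>v\<in>V. ln (real (card (edges_at E v) choose (card (edges_at E v) div 2)))) - real (card E) * ln 2"
  have 1: "exp (- (M + \<Lambda>)) \<le> (\<Sum>\<omega>\<in>\<Omega>. w \<omega> * (\<Prod>e\<in>E. guess (\<kappa> \<omega>) E x e))" if "x \<in> X" for x
  proof -
    define y where "y = (\<lambda>\<omega>. \<Sum>e\<in>E. - corr (\<kappa> \<omega>) E x e)"
    \<comment> \<open>Jensen through the tangent of \<open>exp\<close>: the bound
      \<open>exp (\<Lambda> - y) \<ge> 1 + \<Lambda> - y\<close> is averaged, and by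
      \<open>loss\<close> the mean of the right side is at least 1.\<close>
    have "exp (- (M + \<Lambda>)) * 1 \<le> exp (- (M + \<Lambda>)) * (1 + \<Lambda> - (\<Sum>\<omega>\<in>\<Omega>. w \<omega> * y \<omega>))"
      using loss[OF that] by (intro mult_left_mono) (auto simp: y_def)
    also have "\<dots> = (\<Sum>\<omega>\<in>\<Omega>. w \<omega> * (exp (- (M + \<Lambda>)) * (1 + \<Lambda> - y \<omega>)))"
    proof -
      have "(\<Sum>\<omega>\<in>\<Omega>. w \<omega> * (exp (- (M + \<Lambda>)) * (1 + \<Lambda> - y \<omega>)))
        = exp (- (M + \<Lambda>)) * ((1 + \<Lambda>) * (\<Sum>\<omega>\<in>\<Omega>. w \<omega>) - (\<Sum>\<omega>\<in>\<Omega>. w \<omega> * y \<omega>))"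
        unfolding right_diff_distrib sum_distrib_left sum_subtractf[symmetric]
        by (intro sum.cong refl) (simp add: algebra_simps)
      thus ?thesis by (simp add: w(2))
    qed
    also have "\<dots> \<le> (\<Sum>\<omega>\<in>\<Omega>. w \<omega> * (\<Prod>e\<in>E. guess (\<kappa> \<omega>) E x e))"
    proof (intro sum_mono mult_left_mono w(1))
      fix \<omega> assume o: "\<omega> \<in> \<Omega>"
      have "exp (- (M + \<Lambda>)) * (1 + (\<Lambda> - y \<omega>)) \<le> exp (- (M + \<Lambda>)) * exp (\<Lambda> - y \<omega>)"
        by (intro mult_left_mono exp_ge_add_one_self) auto
      also have "\<dots> = exp (- M - y \<omega>)" by (simp add: exp_add[symmetric])
      also have "\<dots> \<le> (\<Prod>e\<in>E. guess (\<kappa> \<omega>) E x e)"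
        using prod_guess_ge[OF assms(1,2) inj[OF o] x[OF that] bal[OF that]]
        by (simp add: M_def y_def sum_negf algebra_simps)
      finally show "exp (- (M + \<Lambda>)) * (1 + \<Lambda> - y \<omega>) \<le> (\<Prod>e\<in>E. guess (\<kappa> \<omega>) E x e)"
        by (simp add: add_diff_eq)
    qed
    finally show ?thesis by simp
  qed
  have bal': "(\<Sum>e\<in>edges_at E v. esgn x v e) = 0" if "x \<in> X" for x v
  proof (cases "v \<in> V")
    case False
    hence "edges_at E v = {}" using assms(2) by (auto simp: edges_at_def nsets_def)
    thus ?thesis by simp
  qed (use bal that in auto)
  have "real (card X) * exp (- (M + \<Lambda>)) \<le> (\<Sum>x\<in>X. \<Sum>\<omega>\<in>\<Omega>. w \<omega> * (\<Prod>e\<in>E. guess (\<kappa> \<omega>) E x e))"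
    using sum_mono[OF 1] by simp
  also have "\<dots> = (\<Sum>\<omega>\<in>\<Omega>. w \<omega> * (\<Sum>x\<in>X. \<Prod>e\<in>E. guess (\<kappa> \<omega>) E x e))"
    unfolding sum_distrib_left by (rule sum.swap)
  also have "\<dots> \<le> (\<Sum>\<omega>\<in>\<Omega>. w \<omega> * 1)"
  proof (intro sum_mono mult_left_mono w(1))
    fix \<omega> assume o: "\<omega> \<in> \<Omega>"
    show "(\<Sum>x\<in>X. \<Prod>e\<in>E. guess (\<kappa> \<omega>) E x e) \<le> 1"
      by (rule sum_prod_guess_le_1) (use finE assms(2) inj[OF o] assms(3) x ext bal' in \<open>auto simp: nsets_def\<close>)
  qed
  also have "\<dots> = 1" by (simp add: w(2))
  finally have "real (card X) * exp (- (M + \<Lambda>)) * exp (M + \<Lambda>) \<le> 1 * exp (M + \<Lambda>)"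
    by (rule mult_right_mono) simp
  thus ?thesis unfolding M_def[symmetric] by (simp add: mult.assoc exp_add[symmetric])
qed

section \<open>Eulerian orientations as balanced sign functions\<close>

definition balanced_signs :: "nat \<Rightarrow> nat set set \<Rightarrow> (nat set \<Rightarrow> real) set" where
  "balanced_signs n E = {x \<in> E \<rightarrow>\<^sub>E {1, -1}. \<forall>v\<in>{1..n}. (\<Sum>e\<in>edges_at E v. esgn x v e) = 0}"

text \<open>An edge gets the sign 1 if it is directed from its smaller to its larger end. This map
  is injective on orientations, which is enough for an upper bound. Restricting the signs to
  \<open>E\<close> makes them determined by their values on the edges.\<close>

lemma EO_le_card_balanced_signs:
  assumes E: "E \<subseteq> nsets {1..n} 2"
  shows "EO n E \<le> card (balanced_signs n E)"
proof -
  have finE: "finite E" using E finite_imp_finite_nsets finite_subset by blast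
  define f where "f = (\<lambda>A. restrict (\<lambda>e. if (Min e, Max e) \<in> A then 1 else -1 :: real) E)"
  have orient: "{u, v} \<in> E" "u \<noteq> v" "f A {u, v} = (if u < v then 1 else -1)"
    if A: "A \<in> orientations E" and uv: "(u, v) \<in> A" for A u v
  proof -
    have bij: "bij_betw (\<lambda>(u, v). {u, v}) A E" using A by (simp add: orientations_def)
    show e: "{u, v} \<in> E" using bij uv unfolding bij_betw_def by force
    show ne: "u \<noteq> v" using e E by (auto simp: nsets_def)
    show "f A {u, v} = (if u < v then 1 else -1)"
    proof (cases "u < v")
      case True
      hence "Min {u, v} = u" "Max {u, v} = v" by auto
      thus ?thesis using True uv e by (simp add: f_def)
    next
      case False
      hence m: "Min {u, v} = v" "Max {u, v} = u" by auto
      have "(v, u) \<notin> A"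
      proof
        assume "(v, u) \<in> A"
        hence "(v, u) = (u, v)"
          using bij uv unfolding bij_betw_def by (elim conjE, elim inj_onD) auto
        thus False using ne by simp
      qed
      thus ?thesis using m e False by (simp add: f_def)
    qed
  qed
  have ex: "\<exists>u v. (u, v) \<in> A \<and> e = {u, v}" if "A \<in> orientations E" "e \<in> E" for A e
    using that unfolding orientations_def bij_betw_def by force
  have inj: "inj_on f (orientations E)"
  proof -
    have sub: "A \<subseteq> B" if A: "A \<in> orientations E" and B: "B \<in> orientations E" and eq: "f A = f B" for A B
    proof
      fix z assume z: "z \<in> A"
      obtain u v where uv: "z = (u, v)" by (cases z)
      note o = orient[OF A z[unfolded uv]]
      obtain a b where ab: "(a, b) \<in> B" "{u, v} = {a, b}" using ex[OF B o(1)] by auto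
      note o' = orient[OF B ab(1)]
      have "f B {u, v} = (if a < b then 1 else -1)" using o'(3) ab(2) by simp
      hence "(u < v) = (a < b)" using o(3) eq by (auto split: if_splits)
      hence "(u, v) = (a, b)" using ab(2) o(2) by (auto simp: doubleton_eq_iff)
      thus "z \<in> B" using ab uv by simp
    qed
    show ?thesis by (intro inj_onI equalityI sub) auto
  qed
  have "f A \<in> balanced_signs n E" if A: "A \<in> eulerian_orientations n E" for A
  proof -
    have AO: "A \<in> orientations E" using A by (simp add: eulerian_orientations_def)
    note orient = orient[OF AO]
    have bij: "bij_betw (\<lambda>(u, v). {u, v}) A E" using AO by (simp add: orientations_def)
    have finA: "finite A" using bij finE bij_betw_finite by blast
    have "(\<Sum>e\<in>edges_at E v. esgn (f A) v e) = 0" if v: "v \<in> {1..n}" for v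
    proof -
      define Out where "Out = {w. (v, w) \<in> A}"
      define In where "In = {u. (u, v) \<in> A}"
      have fin: "finite Out" "finite In"
        using finite_subset[of Out "snd ` A"] finite_subset[of In "fst ` A"] finA
        by (force simp: Out_def In_def)+
      have eq: "edges_at E v = (\<lambda>w. {v, w}) ` Out \<union> (\<lambda>u. {u, v}) ` In"
      proof
        show "edges_at E v \<subseteq> (\<lambda>w. {v, w}) ` Out \<union> (\<lambda>u. {u, v}) ` In"
          using ex[OF AO] by (fastforce simp: edges_at_def Out_def In_def)
        show "(\<lambda>w. {v, w}) ` Out \<union> (\<lambda>u. {u, v}) ` In \<subseteq> edges_at E v"
          using orient(1) by (auto simp: edges_at_def Out_def In_def)
      qed
      have o1: "esgn (f A) v {v, w} = 1" if "w \<in> Out" for w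
        using orient(2,3)[of v w] that by (auto simp: Out_def esgn_def)
      have o2: "esgn (f A) v {u, v} = -1" if "u \<in> In" for u
        using orient(2,3)[of u v] that by (auto simp: In_def esgn_def)
      have disj: "(\<lambda>w. {v, w}) ` Out \<inter> (\<lambda>u. {u, v}) ` In = {}"
        using o1 o2 by (smt (verit) disjoint_iff imageE)
      have "(\<Sum>e\<in>edges_at E v. esgn (f A) v e) =
          (\<Sum>e\<in>(\<lambda>w. {v, w}) ` Out. esgn (f A) v e) + (\<Sum>e\<in>(\<lambda>u. {u, v}) ` In. esgn (f A) v e)"
        unfolding eq by (rule sum.union_disjoint) (use fin disj in auto)
      also have "(\<Sum>e\<in>(\<lambda>w. {v, w}) ` Out. esgn (f A) v e) = (\<Sum>w\<in>Out. 1)"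
        by (subst sum.reindex) (auto simp: inj_on_def doubleton_eq_iff o1)
      also have "(\<Sum>e\<in>(\<lambda>u. {u, v}) ` In. esgn (f A) v e) = (\<Sum>u\<in>In. -1)"
        by (subst sum.reindex) (auto simp: inj_on_def doubleton_eq_iff o2)
      finally show ?thesis using A v by (simp add: eulerian_orientations_def Out_def In_def)
    qed
    thus ?thesis by (auto simp: balanced_signs_def f_def)
  qed
  hence "f ` eulerian_orientations n E \<subseteq> balanced_signs n E" by blast
  moreover have "finite (balanced_signs n E)"
    using finE by (auto simp: balanced_signs_def intro: finite_subset[OF _ finite_PiE[of E "\<lambda>_. {1, -1}"]])
  moreover have "inj_on f (eulerian_orientations n E)"
    using inj by (rule inj_on_subset) (auto simp: eulerian_orientations_def)
  ultimately have "card (eulerian_orientations n E) \<le> card (balanced_signs n E)"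
    by (intro card_inj_on_le[of f])
  thus ?thesis by (simp add: EO_def)
qed

section \<open>Random orders with a late phase\<close>

text \<open>The probability of \<open>X\<close> when each element of \<open>S\<close> is selected
  independently with probability \<open>p\<close>.\<close>

definition bern :: "real \<Rightarrow> 'a set \<Rightarrow> 'a set \<Rightarrow> real" where
  "bern p S X = p ^ card X * (1 - p) ^ card (S - X)"

lemma sum_bern_insert:
  assumes "finite T" "i \<notin> T"
  shows "(\<Sum>X\<in>Pow (insert i T). bern p (insert i T) X * g X) =
    (1 - p) * (\<Sum>X\<in>Pow T. bern p T X * g X) + p * (\<Sum>X\<in>Pow T. bern p T X * g (insert i X))"
proof -
  have "(\<Sum>X\<in>Pow (insert i T). bern p (insert i T) X * g X)
     = (\<Sum>X\<in>Pow T. bern p (insert i T) X * g X) + (\<Sum>X\<in>insert i ` Pow T. bern p (insert i T) X * g X)"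
    unfolding Pow_insert by (rule sum.union_disjoint) (use assms in auto)
  also have "(\<Sum>X\<in>insert i ` Pow T. bern p (insert i T) X * g X)
      = (\<Sum>X\<in>Pow T. bern p (insert i T) (insert i X) * g (insert i X))"
    using assms(2) by (subst sum.reindex) (auto simp: inj_on_def)
  also have "\<dots> = (\<Sum>X\<in>Pow T. p * (bern p T X * g (insert i X)))"
  proof (intro sum.cong refl)
    fix X assume X: "X \<in> Pow T"
    hence "finite X" "i \<notin> X" "insert i T - insert i X = T - X"
      using assms finite_subset by auto
    thus "bern p (insert i T) (insert i X) * g (insert i X) = p * (bern p T X * g (insert i X))"
      by (simp add: bern_def)
  qed
  also have "(\<Sum>X\<in>Pow T. bern p (insert i T) X * g X) = (\<Sum>X\<in>Pow T. (1 - p) * (bern p T X * g X))"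
  proof (intro sum.cong refl)
    fix X assume X: "X \<in> Pow T"
    hence "finite (T - X)" "i \<notin> T - X" "insert i T - X = insert i (T - X)"
      using assms by auto
    thus "bern p (insert i T) X * g X = (1 - p) * (bern p T X * g X)"
      by (simp add: bern_def)
  qed
  finally show ?thesis by (simp add: sum_distrib_left)
qed

lemma sum_bern [simp]: "finite S \<Longrightarrow> (\<Sum>X\<in>Pow S. bern p S X) = 1"
proof (induction S rule: finite_induct)
  case empty
  show ?case by (simp add: bern_def)
next
  case (insert i T)
  thus ?case using sum_bern_insert[of T i p "\<lambda>_. 1"] by simp
qed

text \<open>Independence: the hypothesis says that \<open>g\<close> ignores the membership of
  \<open>i\<close>, so the event that \<open>i\<close> is selected factors out.\<close>

lemma sum_bern_of_bool:
  assumes "finite S" "i \<in> S" "\<And>X. g (insert i X) = g X"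
  shows "(\<Sum>X\<in>Pow S. bern p S X * (of_bool (i \<in> X) * g X)) = p * (\<Sum>X\<in>Pow S. bern p S X * g X)"
proof -
  define T where "T = S - {i}"
  have S: "S = insert i T" "i \<notin> T" "finite T" using assms by (auto simp: T_def)
  have "(\<Sum>X\<in>Pow T. bern p T X * (of_bool (i \<in> X) * g X)) = 0"
    using S(2) by (intro sum.neutral) auto
  thus ?thesis
    unfolding S(1) sum_bern_insert[OF S(3,2)] by (simp add: assms(3)) (simp add: algebra_simps)
qed

abbreviation flip :: "'a \<Rightarrow> 'a \<Rightarrow> 'a \<Rightarrow> 'a" where
  "flip \<equiv> Transposition.transpose"

lemma card_flip [simp]: "card (flip a b ` X) = card X"
  by (intro card_image inj_on_subset[OF inj_transpose]) auto

lemma flip_flip_image [simp]: "flip a b ` flip a b ` X = X"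
  by (simp add: image_comp)

text \<open>The rate \<open>\<theta>\<close> governs the random set \<open>H\<close> of late edges,
  \<open>\<eta>\<close> the random vertex set \<open>U\<close>. The numbering \<open>ix\<close> is
  arbitrary; composed with a random permutation of the edges it gives random ranks.\<close>

locale late_order =
  fixes V :: "nat set" and E :: "nat set set" and \<theta> \<eta> :: real and ix :: "nat set \<Rightarrow> nat"
  assumes finV: "finite V" and E: "E \<subseteq> nsets V 2"
    and \<theta>: "0 < \<theta>" "\<theta> \<le> 1" and \<eta>: "0 < \<eta>" "\<eta> \<le> 1"
    and ix: "bij_betw ix E {..<card E}"
begin

definition Om :: "((nat set \<Rightarrow> nat set) \<times> nat set set \<times> nat set) set" where
  "Om = {\<sigma>. \<sigma> permutes E} \<times> Pow E \<times> Pow V"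

definition wt :: "(nat set \<Rightarrow> nat set) \<times> nat set set \<times> nat set \<Rightarrow> real" where
  "wt = (\<lambda>(\<sigma>, H, U). 1 / fact (card E) * (bern \<theta> E H * bern \<eta> V U))"

definition expect :: "((nat set \<Rightarrow> nat set) \<times> nat set set \<times> nat set \<Rightarrow> real) \<Rightarrow> real" where
  "expect F = (\<Sum>\<omega>\<in>Om. wt \<omega> * F \<omega>)"

text \<open>The edges outside \<open>H\<close> are revealed first, then the edges of \<open>H\<close> with \<open>0\<close>, \<open>1\<close> and \<open>2\<close>
  endpoints in \<open>U\<close>; within a phase the order is given by the random permutation \<open>\<sigma>\<close>.\<close>

definition phase where
  "phase \<omega> e = (if e \<in> fst (snd \<omega>) then 1 + card (e \<inter> snd (snd \<omega>)) else 0)"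

text \<open>Since \<open>ix\<close> stays below \<open>card E\<close>, comparing keys is comparing
  phases first and permuted ranks second.\<close>

definition key :: "(nat set \<Rightarrow> nat set) \<times> nat set set \<times> nat set \<Rightarrow> nat set \<Rightarrow> nat" where
  "key \<omega> f = phase \<omega> f * card E + ix (fst \<omega> f)"

lemma finE [simp]: "finite E"
  using finV E finite_imp_finite_nsets finite_subset by blast

lemma finOm [simp]: "finite Om"
  using finV by (simp add: Om_def finite_permutations)

lemma wt_nonneg: "wt \<omega> \<ge> 0"
  using \<theta> \<eta> by (auto simp: wt_def bern_def split: prod.splits)

lemma expect_nested:
  "expect F = (\<Sum>\<sigma>\<in>{\<sigma>. \<sigma> permutes E}. 1 / fact (card E) *
     (\<Sum>H\<in>Pow E. bern \<theta> E H * (\<Sum>U\<in>Pow V. bern \<eta> V U * F (\<sigma>, H, U))))"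
  unfolding expect_def Om_def sum.cartesian_product' wt_def
  by (simp add: sum_distrib_left mult.assoc)

lemma expect_const [simp]: "expect (\<lambda>_. c) = c"
proof -
  have "expect (\<lambda>_. c) = (\<Sum>\<sigma>\<in>{\<sigma>. \<sigma> permutes E}. 1 / fact (card E) * c)"
    unfolding expect_nested using finV by (simp add: sum_distrib_right[symmetric])
  also have "\<dots> = c" by (simp add: card_permutations)
  finally show ?thesis .
qed

lemma sum_wt: "sum wt Om = 1"
  using expect_const[of 1] unfolding expect_def by simp

lemma expect_mono: "(\<And>\<omega>. \<omega> \<in> Om \<Longrightarrow> F \<omega> \<le> G \<omega>) \<Longrightarrow> expect F \<le> expect G"
  unfolding expect_def by (intro sum_mono mult_left_mono wt_nonneg)

lemma expect_cong: "(\<And>\<omega>. \<omega> \<in> Om \<Longrightarrow> F \<omega> = G \<omega>) \<Longrightarrow> expect F = expect G"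
  unfolding expect_def by (intro sum.cong) auto

lemma expect_add: "expect (\<lambda>\<omega>. F \<omega> + G \<omega>) = expect F + expect G"
  by (simp add: expect_def distrib_left sum.distrib)

lemma expect_diff: "expect (\<lambda>\<omega>. F \<omega> - G \<omega>) = expect F - expect G"
  by (simp add: expect_def right_diff_distrib sum_subtractf)

lemma expect_cmult: "expect (\<lambda>\<omega>. c * F \<omega>) = c * expect F"
  by (simp add: expect_def sum_distrib_left algebra_simps)

lemma expect_sum: "expect (\<lambda>\<omega>. \<Sum>i\<in>I. F i \<omega>) = (\<Sum>i\<in>I. expect (F i))"
  unfolding expect_def sum_distrib_left by (rule sum.swap)

lemma expect_abs: "\<bar>expect F\<bar> \<le> expect (\<lambda>\<omega>. \<bar>F \<omega>\<bar>)"
proof -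
  have "\<bar>expect F\<bar> \<le> (\<Sum>\<omega>\<in>Om. \<bar>wt \<omega> * F \<omega>\<bar>)" unfolding expect_def by (rule sum_abs)
  thus ?thesis by (simp add: expect_def abs_mult wt_nonneg)
qed

lemma expect_late:
  assumes "f \<in> E" "\<And>\<sigma> H U. G (\<sigma>, insert f H, U) = G (\<sigma>, H, U)"
  shows "expect (\<lambda>\<omega>. of_bool (f \<in> fst (snd \<omega>)) * G \<omega>) = \<theta> * expect G"
proof -
  have "(\<Sum>H\<in>Pow E. bern \<theta> E H * (\<Sum>U\<in>Pow V. bern \<eta> V U * (of_bool (f \<in> H) * G (\<sigma>, H, U))))
     = \<theta> * (\<Sum>H\<in>Pow E. bern \<theta> E H * (\<Sum>U\<in>Pow V. bern \<eta> V U * G (\<sigma>, H, U)))" for \<sigma>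
  proof -
    have "(\<Sum>U\<in>Pow V. bern \<eta> V U * (of_bool (f \<in> H) * G (\<sigma>, H, U)))
       = of_bool (f \<in> H) * (\<Sum>U\<in>Pow V. bern \<eta> V U * G (\<sigma>, H, U))" for H
      by (simp add: sum_distrib_left algebra_simps)
    thus ?thesis using sum_bern_of_bool[OF finE assms(1)] assms(2) by simp
  qed
  thus ?thesis unfolding expect_nested by (simp add: sum_distrib_left algebra_simps)
qed

lemma expect_in_U:
  assumes "x \<in> V" "\<And>\<sigma> H U. G (\<sigma>, H, insert x U) = G (\<sigma>, H, U)"
  shows "expect (\<lambda>\<omega>. of_bool (x \<in> snd (snd \<omega>)) * G \<omega>) = \<eta> * expect G"
proof -
  have "(\<Sum>U\<in>Pow V. bern \<eta> V U * (of_bool (x \<in> U) * G (\<sigma>, H, U)))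
      = \<eta> * (\<Sum>U\<in>Pow V. bern \<eta> V U * G (\<sigma>, H, U))" for \<sigma> H
    using sum_bern_of_bool[OF finV assms(1)] assms(2) by simp
  thus ?thesis unfolding expect_nested by (simp add: sum_distrib_left algebra_simps)
qed

lemma inj_key:
  assumes "\<omega> \<in> Om"
  shows "inj_on (key \<omega>) E"
proof -
  obtain \<sigma> H U where o: "\<omega> = (\<sigma>, H, U)" "\<sigma> permutes E" using assms by (auto simp: Om_def)
  show ?thesis
  proof (rule inj_onI)
    fix f g assume fg: "f \<in> E" "g \<in> E" "key \<omega> f = key \<omega> g"
    have s: "\<sigma> f \<in> E" "\<sigma> g \<in> E" using fg o(2) by (auto simp: permutes_in_image)
    hence "ix (\<sigma> f) < card E" "ix (\<sigma> g) < card E" using ix by (auto simp: bij_betw_def)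
    moreover have "key \<omega> f mod card E = key \<omega> g mod card E" using fg by simp
    ultimately have "ix (\<sigma> f) = ix (\<sigma> g)" by (simp add: key_def o)
    hence "\<sigma> f = \<sigma> g" using s ix by (auto simp: bij_betw_def inj_on_def)
    thus "f = g" using o(2) by (metis permutes_inverses(2))
  qed
qed

text \<open>A weight-preserving involution, used with \<open>f = {v, x}\<close> and
  \<open>g = {v, y}\<close>. Exchanging only the edges would not preserve the order at
  \<open>v\<close>, since a phase depends on which endpoints lie in \<open>U\<close>; hence
  \<open>x\<close> and \<open>y\<close> are exchanged as well.\<close>

definition swap :: "nat set \<Rightarrow> nat set \<Rightarrow> nat \<Rightarrow> nat \<Rightarrow>
  (nat set \<Rightarrow> nat set) \<times> nat set set \<times> nat set \<Rightarrow> (nat set \<Rightarrow> nat set) \<times> nat set set \<times> nat set" where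
  "swap f g x y = (\<lambda>(\<sigma>, H, U). (\<sigma> \<circ> flip f g, flip f g ` H, flip x y ` U))"

lemma bern_transpose:
  assumes "a \<in> S" "b \<in> S"
  shows "bern p S (flip a b ` X) = bern p S X"
proof -
  have "S - flip a b ` X = flip a b ` (S - X)"
    using assms by (simp add: image_set_diff[OF inj_transpose])
  thus ?thesis by (simp add: bern_def)
qed

lemma swap_in_Om:
  assumes "f \<in> E" "g \<in> E" "x \<in> V" "y \<in> V" "\<omega> \<in> Om"
  shows "swap f g x y \<omega> \<in> Om"
proof -
  obtain \<sigma> H U where o: "\<omega> = (\<sigma>, H, U)" "\<sigma> permutes E" "H \<subseteq> E" "U \<subseteq> V" using assms by (auto simp: Om_def)
  thus ?thesis using assms(1-4)
    by (auto simp: Om_def swap_def Transposition.transpose_def intro!: permutes_compose permutes_swap_id)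
qed

lemma swap_swap [simp]: "swap f g x y (swap f g x y \<omega>) = \<omega>"
  by (auto simp: swap_def image_image comp_assoc split: prod.splits)

lemma wt_swap:
  assumes "f \<in> E" "g \<in> E" "x \<in> V" "y \<in> V"
  shows "wt (swap f g x y \<omega>) = wt \<omega>"
  using assms by (auto simp: wt_def swap_def bern_transpose split: prod.splits)

lemma expect_swap:
  assumes "f \<in> E" "g \<in> E" "x \<in> V" "y \<in> V"
  shows "expect (\<lambda>\<omega>. F (swap f g x y \<omega>)) = expect F"
  unfolding expect_def
  by (rule sum.reindex_bij_witness[of _ "swap f g x y" "swap f g x y"])
    (simp_all add: swap_in_Om[OF assms] wt_swap[OF assms])

text \<open>If the exchange of vertices moves \<open>h\<close> as the exchange of edges does, then
  membership in \<open>H\<close>, the number of endpoints in \<open>U\<close> and the rank are all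
  transported together.\<close>

lemma key_swap:
  assumes "flip x y ` h = flip f g h"
  shows "key (swap f g x y \<omega>) h = key \<omega> (flip f g h)"
proof -
  obtain \<sigma> H U where o: "\<omega> = (\<sigma>, H, U)" by (cases \<omega>)
  have "h \<in> flip f g ` H \<longleftrightarrow> flip f g h \<in> H"
    by (metis (no_types, lifting) image_iff transpose_involutory)
  moreover have "card (h \<inter> flip x y ` U) = card (flip f g h \<inter> U)"
  proof -
    have "h \<inter> flip x y ` U = flip x y ` (flip x y ` h \<inter> U)"
      by (simp add: image_Int[OF inj_transpose])
    thus ?thesis by (simp add: assms)
  qed
  ultimately show ?thesis by (simp add: o swap_def key_def phase_def)
qed

text \<open>An edge outside \<open>H\<close> has phase 0 whatever \<open>U\<close> is, so moving
  vertices in or out of \<open>U\<close> does not affect it.\<close>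

lemma key_swap_early:
  assumes "h \<noteq> f" "h \<noteq> g" "h \<notin> fst (snd \<omega>)"
  shows "key (swap f g x y \<omega>) h = key \<omega> h"
proof -
  obtain \<sigma> H U where o: "\<omega> = (\<sigma>, H, U)" by (cases \<omega>)
  have "h \<notin> flip f g ` H" using assms by (auto simp: o Transposition.transpose_def split: if_splits)
  thus ?thesis using assms by (simp add: o swap_def key_def phase_def Transposition.transpose_def)
qed

lemma key_less:
  assumes "\<omega> \<in> Om" "e \<in> E" "phase \<omega> e < phase \<omega> h"
  shows "key \<omega> e < key \<omega> h"
proof -
  have "fst \<omega> e \<in> E" using assms(1,2) by (auto simp: Om_def permutes_in_image)
  hence "ix (fst \<omega> e) < card E" using ix by (auto simp: bij_betw_def)
  hence "key \<omega> e < Suc (phase \<omega> e) * card E" by (simp add: key_def)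
  also have "\<dots> \<le> phase \<omega> h * card E" using assms(3) by (intro mult_right_mono) auto
  also have "\<dots> \<le> key \<omega> h" by (simp add: key_def)
  finally show ?thesis .
qed

lemma late_after_early:
  assumes "\<omega> \<in> Om" "h \<in> fst (snd \<omega>)" "e \<in> E" "e \<notin> fst (snd \<omega>)"
  shows "key \<omega> e < key \<omega> h"
  using assms by (intro key_less) (auto simp: phase_def)

end

section \<open>Near independence of the signs seen from the two ends of an edge\<close>

context late_order
begin

abbreviation later_at where
  "later_at \<omega> v e \<equiv> later (key \<omega>) (edges_at E v) e"

lemma edge_at_cases:
  assumes "h \<in> edges_at E v"
  obtains z where "h = {v, z}" "z \<noteq> v" "z \<in> V" "v \<in> V"
proof -
  have "h \<in> nsets V 2" "v \<in> h" using assms E by (auto simp: edges_at_def)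
  then obtain a b where "h = {a, b}" "a \<noteq> b" "a \<in> V" "b \<in> V" "v = a \<or> v = b"
    by (auto elim!: nsets_2_cases)
  thus ?thesis using that[of a] that[of b] by auto
qed

lemma self_in_later: "e \<in> edges_at E v \<Longrightarrow> e \<in> later_at \<omega> v e"
  by (simp add: later_def)

context
  fixes v w x y :: nat and e f g
  assumes e: "e \<in> E" "e = {v, w}" and f: "f \<in> E" "f = {v, x}" "f \<noteq> e"
    and g: "g \<in> E" "g = {v, y}" "g \<noteq> e"
begin

lemma swap_distinct: "v \<noteq> w" "x \<noteq> v" "x \<noteq> w" "y \<noteq> v" "y \<noteq> w" "x \<in> V" "y \<in> V" "v \<in> V" "w \<in> V"
  using e f g E by (auto simp: nsets_def)

text \<open>On the edges at \<open>v\<close> the exchange of \<open>x\<close> and \<open>y\<close>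
  acts exactly as the exchange of \<open>f\<close> and \<open>g\<close>, so from \<open>v\<close>
  the swap is a mere renaming.\<close>

lemma in_later_swap:
  assumes "h \<in> edges_at E v"
  shows "h \<in> later_at (swap f g x y \<omega>) v e \<longleftrightarrow> flip f g h \<in> later_at \<omega> v e"
proof -
  note d = swap_distinct
  have k: "key (swap f g x y \<omega>) h' = key \<omega> (flip f g h')" if h': "h' \<in> edges_at E v" for h'
  proof (rule key_swap)
    obtain z where "h' = {v, z}" "z \<noteq> v" using h' by (rule edge_at_cases)
    thus "flip x y ` h' = flip f g h'"
      using d f g by (auto simp: Transposition.transpose_def doubleton_eq_iff)
  qed
  have "e \<in> edges_at E v" using e by (simp add: edges_at_def)
  moreover have "flip f g e = e" using f g by (simp add: Transposition.transpose_def)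
  moreover have "flip f g h \<in> edges_at E v"
    using assms f g by (auto simp: Transposition.transpose_def edges_at_def)
  ultimately show ?thesis using assms by (simp add: later_def k)
qed

lemma card_later_swap: "card (later_at (swap f g x y \<omega>) v e) = card (later_at \<omega> v e)"
proof -
  have fl: "flip f g h \<in> edges_at E v" if "h \<in> edges_at E v" for h
    using that f g by (auto simp: Transposition.transpose_def edges_at_def)
  have sub: "later_at \<omega>' v e \<subseteq> edges_at E v" for \<omega>' by (auto simp: later_def)
  have "later_at (swap f g x y \<omega>) v e = flip f g ` later_at \<omega> v e"
  proof
    show "later_at (swap f g x y \<omega>) v e \<subseteq> flip f g ` later_at \<omega> v e"
    proof
      fix h assume h: "h \<in> later_at (swap f g x y \<omega>) v e"
      hence "flip f g h \<in> later_at \<omega> v e" using in_later_swap sub by blast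
      thus "h \<in> flip f g ` later_at \<omega> v e" by (rule rev_image_eqI) simp
    qed
    show "flip f g ` later_at \<omega> v e \<subseteq> later_at (swap f g x y \<omega>) v e"
    proof
      fix h assume "h \<in> flip f g ` later_at \<omega> v e"
      then obtain h' where h': "h' \<in> later_at \<omega> v e" "h = flip f g h'" by auto
      hence "h \<in> edges_at E v" using sub fl by blast
      thus "h \<in> later_at (swap f g x y \<omega>) v e" using in_later_swap[of h \<omega>] h' by simp
    qed
  qed
  thus ?thesis by simp
qed

text \<open>At \<open>w\<close> only \<open>{w, x}\<close> and \<open>{w, y}\<close> can move,
  because \<open>x\<close> and \<open>y\<close> trade places in \<open>U\<close>. If such an edge is
  early, its key is unchanged; if it is late and \<open>e\<close> is early, it comes after
  \<open>e\<close> both before and after the swap.\<close>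

lemma later_swap_other:
  assumes "\<omega> \<in> Om" "\<not> (e \<in> fst (snd \<omega>) \<and> ({w, x} \<in> fst (snd \<omega>) \<or> {w, y} \<in> fst (snd \<omega>)))"
  shows "later_at (swap f g x y \<omega>) w e = later_at \<omega> w e"
proof -
  note d = swap_distinct
  let ?\<omega> = "swap f g x y \<omega>"
  have om: "?\<omega> \<in> Om" using assms(1) d f(1) g(1) by (intro swap_in_Om) auto
  have H: "h \<in> fst (snd ?\<omega>) \<longleftrightarrow> h \<in> fst (snd \<omega>)" if "h \<noteq> f" "h \<noteq> g" for h
  proof -
    obtain \<sigma> K U where o: "\<omega> = (\<sigma>, K, U)" by (cases \<omega>)
    have "h \<in> flip f g ` K \<longleftrightarrow> flip f g h \<in> K"
      by (metis (no_types, lifting) image_iff transpose_involutory)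
    thus ?thesis using that by (simp add: o swap_def Transposition.transpose_def)
  qed
  have ke: "key ?\<omega> e = key \<omega> e"
  proof -
    have "flip x y ` e = flip f g e" using d e(2) f(3) g(3) by (auto simp: Transposition.transpose_def)
    thus ?thesis using key_swap[of x y e f g \<omega>] f(3) g(3) by (simp add: Transposition.transpose_def)
  qed
  have "key ?\<omega> e \<le> key ?\<omega> h \<longleftrightarrow> key \<omega> e \<le> key \<omega> h" if h: "h \<in> edges_at E w" for h
  proof -
    obtain z where z: "h = {w, z}" "z \<noteq> w" using h by (rule edge_at_cases)
    have hfg: "h \<noteq> f" "h \<noteq> g" using z d f(2) g(2) by (auto simp: doubleton_eq_iff)
    show ?thesis
    proof (cases "z = x \<or> z = y")
      case False
      hence "flip x y ` h = flip f g h" using hfg z d by (auto simp: Transposition.transpose_def)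
      hence "key ?\<omega> h = key \<omega> h" using key_swap[of x y h f g \<omega>] hfg by (simp add: Transposition.transpose_def)
      thus ?thesis using ke by simp
    next
      case True
      show ?thesis
      proof (cases "h \<in> fst (snd \<omega>)")
        case h1: True
        have e1: "e \<notin> fst (snd \<omega>)" using h1 True z assms(2) by auto
        have "key \<omega> e < key \<omega> h" by (rule late_after_early[OF assms(1) h1 e(1) e1])
        moreover have "key ?\<omega> e < key ?\<omega> h"
          by (rule late_after_early[OF om _ e(1)]) (use H hfg h1 e1 f(3) g(3) in auto)
        ultimately show ?thesis by simp
      next
        case False
        thus ?thesis using key_swap_early[OF hfg False] ke by simp
      qed
    qed
  qed
  thus ?thesis unfolding later_def by auto
qed

end

lemma expect_late3:
  assumes "e \<in> E" "f \<in> E" "e \<noteq> f" "h \<noteq> e" "h \<noteq> f"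
  shows "expect (\<lambda>\<omega>. of_bool (e \<in> fst (snd \<omega>)) * (of_bool (f \<in> fst (snd \<omega>)) * of_bool (h \<in> fst (snd \<omega>)))) \<le> \<theta> ^ 3"
proof (cases "h \<in> E")
  case True
  have "expect (\<lambda>\<omega>. of_bool (e \<in> fst (snd \<omega>)) * (of_bool (f \<in> fst (snd \<omega>)) * (of_bool (h \<in> fst (snd \<omega>)) * 1)))
     = \<theta> * (\<theta> * (\<theta> * 1))"
    using assms True by (subst expect_late, simp, simp)+ simp
  thus ?thesis by (simp add: power3_eq_cube)
next
  case False
  have "expect (\<lambda>\<omega>. of_bool (e \<in> fst (snd \<omega>)) * (of_bool (f \<in> fst (snd \<omega>)) * of_bool (h \<in> fst (snd \<omega>))))
     = expect (\<lambda>_. 0)"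
    using False by (intro expect_cong) (auto simp: Om_def)
  thus ?thesis using \<theta> by simp
qed

text \<open>Exchanging the roles of the edges \<open>{v, x}\<close> and \<open>{v, y}\<close> changes what is seen from \<open>w\<close> only if
  \<open>{v, w}\<close>, one of these two edges, and one of \<open>{w, x}\<close>, \<open>{w, y}\<close> are all late.\<close>

lemma expect_swap_diff:
  assumes e: "e \<in> E" "e = {v, w}" and f: "f \<in> E" "f = {v, x}" "f \<noteq> e"
    and g: "g \<in> E" "g = {v, y}" "g \<noteq> e"
    and F1: "\<And>\<omega>. \<omega> \<in> Om \<Longrightarrow> \<bar>F \<omega>\<bar> \<le> 1"
    and Fswap: "\<And>\<omega>. \<omega> \<in> Om \<Longrightarrow> \<not> (e \<in> fst (snd \<omega>) \<and> ({w, x} \<in> fst (snd \<omega>) \<or> {w, y} \<in> fst (snd \<omega>)))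
       \<Longrightarrow> F (swap f g x y \<omega>) = F \<omega>"
  shows "\<bar>expect (\<lambda>\<omega>. of_bool (f \<in> later_at \<omega> v e) * F \<omega>) - expect (\<lambda>\<omega>. of_bool (g \<in> later_at \<omega> v e) * F \<omega>)\<bar> \<le> 4 * \<theta> ^ 3"
proof -
  note d = swap_distinct[OF e f g]
  have fv: "f \<in> edges_at E v" "g \<in> edges_at E v" using f g by (auto simp: edges_at_def)
  let ?l = "\<lambda>h \<omega>. of_bool (h \<in> fst (snd \<omega>)) :: real"
  have "expect (\<lambda>\<omega>. of_bool (g \<in> later_at \<omega> v e) * F \<omega>)
     = expect (\<lambda>\<omega>. of_bool (g \<in> later_at (swap f g x y \<omega>) v e) * F (swap f g x y \<omega>))"
    by (rule expect_swap[OF f(1) g(1) d(6,7), symmetric])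
  also have "\<dots> = expect (\<lambda>\<omega>. of_bool (f \<in> later_at \<omega> v e) * F (swap f g x y \<omega>))"
    using in_later_swap[OF e f g fv(2)] by simp
  finally have "expect (\<lambda>\<omega>. of_bool (f \<in> later_at \<omega> v e) * F \<omega>) - expect (\<lambda>\<omega>. of_bool (g \<in> later_at \<omega> v e) * F \<omega>)
      = expect (\<lambda>\<omega>. of_bool (f \<in> later_at \<omega> v e) * (F \<omega> - F (swap f g x y \<omega>)))"
    by (simp add: expect_diff[symmetric] right_diff_distrib)
  also have "\<bar>\<dots>\<bar> \<le> expect (\<lambda>\<omega>. \<bar>of_bool (f \<in> later_at \<omega> v e) * (F \<omega> - F (swap f g x y \<omega>))\<bar>)"
    by (rule expect_abs)
  also have "\<dots> \<le> expect (\<lambda>\<omega>. 2 * (?l e \<omega> * (?l f \<omega> * ?l {w, x} \<omega>)) + 2 * (?l e \<omega> * (?l f \<omega> * ?l {w, y} \<omega>)))"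
  proof (rule expect_mono)
    fix \<omega> assume o: "\<omega> \<in> Om"
    have b: "\<bar>F \<omega> - F (swap f g x y \<omega>)\<bar> \<le> 2"
      using F1[OF o] F1[OF swap_in_Om[OF f(1) g(1) d(6,7) o]] by linarith
    \<comment> \<open>When a late edge is revealed, everything still to come is late. This supplies
      the third late edge, hence the cube of \<open>\<theta>\<close>.\<close>
    have le: "f \<in> fst (snd \<omega>)" if "e \<in> fst (snd \<omega>)" "f \<in> later_at \<omega> v e"
      using late_after_early[OF o that(1) f(1)] that(2) by (auto simp: later_def)
    show "\<bar>of_bool (f \<in> later_at \<omega> v e) * (F \<omega> - F (swap f g x y \<omega>))\<bar>
       \<le> 2 * (?l e \<omega> * (?l f \<omega> * ?l {w, x} \<omega>)) + 2 * (?l e \<omega> * (?l f \<omega> * ?l {w, y} \<omega>))"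
    proof (cases "e \<in> fst (snd \<omega>) \<and> ({w, x} \<in> fst (snd \<omega>) \<or> {w, y} \<in> fst (snd \<omega>)) \<and> f \<in> later_at \<omega> v e")
      case True
      thus ?thesis using le b by auto
    next
      case False
      thus ?thesis using Fswap[OF o] by auto
    qed
  qed
  also have "\<dots> = 2 * expect (\<lambda>\<omega>. ?l e \<omega> * (?l f \<omega> * ?l {w, x} \<omega>)) + 2 * expect (\<lambda>\<omega>. ?l e \<omega> * (?l f \<omega> * ?l {w, y} \<omega>))"
    by (simp only: expect_add expect_cmult)
  also have "\<dots> \<le> 2 * \<theta> ^ 3 + 2 * \<theta> ^ 3"
    using d e f by (intro add_mono mult_left_mono expect_late3) (auto simp: doubleton_eq_iff)
  finally show ?thesis by simp
qed

text \<open>The weights \<open>c h\<close> of the edges \<open>h \<noteq> e\<close> at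
  \<open>v\<close> nearly coincide by the exchange argument, so each may be replaced by their mean
  \<open>m\<close>. By balance the signs of these edges sum to \<open>- s e\<close>, which leaves
  \<open>s e * (expect F - m)\<close>; the displayed factor is this difference written with the
  remaining count.\<close>

lemma expect_sum_later:
  assumes e: "e \<in> E" "e = {v, w}"
    and F1: "\<And>\<omega>. \<omega> \<in> Om \<Longrightarrow> \<bar>F \<omega>\<bar> \<le> 1"
    and Fswap: "\<And>\<omega> f g x y. \<omega> \<in> Om \<Longrightarrow> f \<in> E \<Longrightarrow> f = {v, x} \<Longrightarrow> f \<noteq> e \<Longrightarrow> g \<in> E \<Longrightarrow> g = {v, y} \<Longrightarrow> g \<noteq> e \<Longrightarrow>
       \<not> (e \<in> fst (snd \<omega>) \<and> ({w, x} \<in> fst (snd \<omega>) \<or> {w, y} \<in> fst (snd \<omega>)))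
       \<Longrightarrow> F (swap f g x y \<omega>) = F \<omega>"
    and s: "\<And>h. h \<in> edges_at E v \<Longrightarrow> \<bar>s h\<bar> \<le> 1" "(\<Sum>h\<in>edges_at E v. s h) = 0"
    and d: "card (edges_at E v) \<ge> 2"
  shows "\<bar>expect (\<lambda>\<omega>. (\<Sum>h\<in>later_at \<omega> v e. s h) * F \<omega>)
      - s e * expect (\<lambda>\<omega>. (1 - (real (card (later_at \<omega> v e)) - 1) / (real (card (edges_at E v)) - 1)) * F \<omega>)\<bar>
      \<le> 4 * real (card (edges_at E v)) * \<theta> ^ 3"
proof -
  define T where "T = edges_at E v - {e}"
  define c where "c = (\<lambda>h. expect (\<lambda>\<omega>. of_bool (h \<in> later_at \<omega> v e) * F \<omega>))"
  define m where "m = (\<Sum>h\<in>T. c h) / real (card T)"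
  have ev: "e \<in> edges_at E v" using e by (simp add: edges_at_def)
  have finT: "finite T" by (simp add: T_def)
  have ins: "edges_at E v = insert e T" "e \<notin> T" using ev by (auto simp: T_def)
  have cT: "real (card T) = real (card (edges_at E v)) - 1" using ins finT by simp
  have cTpos: "real (card T) > 0" using d cT by simp
  have sub: "later_at \<omega> v e \<subseteq> edges_at E v" for \<omega> by (auto simp: later_def)
  have ce: "c e = expect F" by (simp add: c_def self_in_later[OF ev])
  have 1: "expect (\<lambda>\<omega>. (\<Sum>h\<in>later_at \<omega> v e. s h) * F \<omega>) = s e * expect F + (\<Sum>h\<in>T. s h * c h)"
  proof -
    have "(\<Sum>h\<in>later_at \<omega> v e. s h) * F \<omega> = (\<Sum>h\<in>edges_at E v. s h * (of_bool (h \<in> later_at \<omega> v e) * F \<omega>))" for \<omega>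
    proof -
      have "(\<Sum>h\<in>later_at \<omega> v e. s h) = (\<Sum>h\<in>edges_at E v. s h * of_bool (h \<in> later_at \<omega> v e))"
        using sub[of \<omega>] by (intro sum.mono_neutral_cong_left) auto
      thus ?thesis by (simp only: sum_distrib_right mult.assoc)
    qed
    hence "expect (\<lambda>\<omega>. (\<Sum>h\<in>later_at \<omega> v e. s h) * F \<omega>) = (\<Sum>h\<in>edges_at E v. s h * c h)"
      by (simp add: expect_sum expect_cmult c_def)
    thus ?thesis using ins finT ce by simp
  qed
  have 2: "expect (\<lambda>\<omega>. (1 - (real (card (later_at \<omega> v e)) - 1) / (real (card (edges_at E v)) - 1)) * F \<omega>) = expect F - m"
  proof -
    have "real (card (later_at \<omega> v e)) - 1 = (\<Sum>h\<in>T. of_bool (h \<in> later_at \<omega> v e))" for \<omega>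
    proof -
      have "later_at \<omega> v e = insert e {h\<in>T. h \<in> later_at \<omega> v e}"
        using self_in_later[OF ev, of \<omega>] ins sub[of \<omega>] by auto
      hence "card (later_at \<omega> v e) = Suc (card {h\<in>T. h \<in> later_at \<omega> v e})"
        using ins(2) finT by (metis (no_types, lifting) card_insert_disjoint finite_subset mem_Collect_eq subsetI)
      thus ?thesis using finT by (simp add: of_bool_def sum.If_cases Int_def)
    qed
    hence "(1 - (real (card (later_at \<omega> v e)) - 1) / (real (card (edges_at E v)) - 1)) * F \<omega>
        = F \<omega> - 1 / real (card T) * (\<Sum>h\<in>T. of_bool (h \<in> later_at \<omega> v e) * F \<omega>)" for \<omega>
      by (simp only: cT[symmetric] sum_distrib_right[symmetric]) (simp add: left_diff_distrib)
    hence "expect (\<lambda>\<omega>. (1 - (real (card (later_at \<omega> v e)) - 1) / (real (card (edges_at E v)) - 1)) * F \<omega>)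
       = expect (\<lambda>\<omega>. F \<omega> - 1 / real (card T) * (\<Sum>h\<in>T. of_bool (h \<in> later_at \<omega> v e) * F \<omega>))"
      by simp
    also have "\<dots> = expect F - 1 / real (card T) * (\<Sum>h\<in>T. c h)"
      by (simp only: expect_diff expect_cmult expect_sum c_def)
    finally show ?thesis by (simp add: m_def)
  qed
  have sT: "(\<Sum>h\<in>T. s h) = - s e" using s(2) ins finT by simp
  have dev: "\<bar>c h - m\<bar> \<le> 4 * \<theta> ^ 3" if h: "h \<in> T" for h
  proof -
    have pair: "\<bar>c h - c h'\<bar> \<le> 4 * \<theta> ^ 3" if h': "h' \<in> T" for h'
    proof -
      obtain x where x: "h = {v, x}" using h unfolding T_def by (meson DiffD1 edge_at_cases)
      obtain y where y: "h' = {v, y}" using h' unfolding T_def by (meson DiffD1 edge_at_cases)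
      have hh: "h \<in> E" "h \<noteq> e" "h' \<in> E" "h' \<noteq> e" using h h' by (auto simp: T_def edges_at_def)
      show ?thesis unfolding c_def
        by (rule expect_swap_diff[OF e hh(1) x hh(2) hh(3) y hh(4) F1])
          (use Fswap hh x y in \<open>auto\<close>)
    qed
    have "c h - m = (\<Sum>h'\<in>T. c h - c h') / real (card T)"
      using cTpos by (simp add: m_def sum_subtractf field_simps)
    also have "\<bar>\<dots>\<bar> \<le> (\<Sum>h'\<in>T. 4 * \<theta> ^ 3) / real (card T)"
      unfolding abs_divide
      by (simp only: abs_of_nat, rule divide_right_mono, rule order_trans[OF sum_abs sum_mono[OF pair]]) auto
    finally show ?thesis using cTpos by simp
  qed
  have "(\<Sum>h\<in>T. s h * c h) = (\<Sum>h\<in>T. s h * (c h - m)) - s e * m"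
    by (simp add: right_diff_distrib sum_subtractf sum_distrib_right[symmetric] sT)
  hence "expect (\<lambda>\<omega>. (\<Sum>h\<in>later_at \<omega> v e. s h) * F \<omega>)
      - s e * expect (\<lambda>\<omega>. (1 - (real (card (later_at \<omega> v e)) - 1) / (real (card (edges_at E v)) - 1)) * F \<omega>)
     = (\<Sum>h\<in>T. s h * (c h - m))"
    unfolding 1 2 by (simp add: algebra_simps)
  also have "\<bar>\<dots>\<bar> \<le> (\<Sum>h\<in>T. \<bar>s h * (c h - m)\<bar>)" by (rule sum_abs)
  also have "\<dots> \<le> (\<Sum>h\<in>T. 4 * \<theta> ^ 3)"
  proof (rule sum_mono)
    fix h assume h: "h \<in> T"
    have "\<bar>s h\<bar> \<le> 1" using s(1) h by (simp add: T_def)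
    hence "\<bar>s h\<bar> * \<bar>c h - m\<bar> \<le> 1 * (4 * \<theta> ^ 3)" using dev[OF h] by (intro mult_mono) auto
    thus "\<bar>s h * (c h - m)\<bar> \<le> 4 * \<theta> ^ 3" by (simp add: abs_mult)
  qed
  also have "\<dots> = real (card T) * (4 * \<theta> ^ 3)" by simp
  also have "\<dots> \<le> real (card (edges_at E v)) * (4 * \<theta> ^ 3)"
    using \<theta> cT by (intro mult_right_mono) auto
  finally show ?thesis by simp
qed

text \<open>\<open>expect_sum_later\<close> is applied at \<open>v\<close> and then at
  \<open>w\<close>. Each application replaces a sum of remaining signs by the sign of
  \<open>e\<close> times a factor in [0, 1], with error at most \<open>4 * D * \<theta>^3\<close>.
  The two signs of \<open>e\<close> multiply to -1, so the negated correlation is nonnegative in the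
  main term and at most the mean of \<open>1 / (R * R)\<close>.\<close>

lemma expect_corr:
  assumes e: "e \<in> E" "e = {v, w}" "v \<noteq> w"
    and s: "\<And>h. h \<in> edges_at E v \<Longrightarrow> \<bar>s h\<bar> \<le> 1" "(\<Sum>h\<in>edges_at E v. s h) = 0"
    and t: "\<And>h. h \<in> edges_at E w \<Longrightarrow> \<bar>t h\<bar> \<le> 1" "(\<Sum>h\<in>edges_at E w. t h) = 0"
    and st: "s e * t e = -1"
    and d: "card (edges_at E v) \<ge> 2" "card (edges_at E w) \<ge> 2"
      "card (edges_at E v) \<le> D" "card (edges_at E w) \<le> D"
  shows "expect (\<lambda>\<omega>. - (bias s (key \<omega>) (edges_at E v) e * bias t (key \<omega>) (edges_at E w) e))
     \<le> expect (\<lambda>\<omega>. 1 / (real (card (later_at \<omega> v e)) * real (card (later_at \<omega> w e)))) + 8 * real D * \<theta> ^ 3"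
proof -
  let ?R = "\<lambda>u \<omega>. real (card (later_at \<omega> u e))"
  let ?g = "\<lambda>u \<omega>. 1 - (?R u \<omega> - 1) / (real (card (edges_at E u)) - 1)"
  have ev: "e \<in> edges_at E v" "e \<in> edges_at E w" using e by (auto simp: edges_at_def)
  have R1: "?R u \<omega> \<ge> 1" "?R u \<omega> \<le> real (card (edges_at E u))" if "u = v \<or> u = w" for u \<omega>
  proof -
    have "e \<in> later_at \<omega> u e" using that ev by (auto intro: self_in_later)
    hence "card (later_at \<omega> u e) > 0" by (auto simp: card_gt_0_iff)
    thus "?R u \<omega> \<ge> 1" by simp
    have "card (later_at \<omega> u e) \<le> card (edges_at E u)" by (intro card_mono) (auto simp: later_def)
    thus "?R u \<omega> \<le> real (card (edges_at E u))" by simp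
  qed
  have g01: "0 \<le> ?g u \<omega>" "?g u \<omega> \<le> 1" if "u = v \<or> u = w" for u \<omega>
    using R1[OF that, of \<omega>] d(1,2) that by (auto simp: field_simps)
  have tR: "\<bar>\<Sum>h\<in>later_at \<omega> w e. t h\<bar> \<le> ?R w \<omega>" for \<omega>
  proof -
    have "\<bar>\<Sum>h\<in>later_at \<omega> w e. t h\<bar> \<le> (\<Sum>h\<in>later_at \<omega> w e. \<bar>t h\<bar>)" by (rule sum_abs)
    also have "\<dots> \<le> (\<Sum>h\<in>later_at \<omega> w e. 1)" using t(1) by (intro sum_mono) (auto simp: later_def)
    finally show ?thesis by simp
  qed
  have se1: "\<bar>s e\<bar> \<le> 1" using s(1) ev by auto
  have te1: "\<bar>t e\<bar> \<le> 1" using t(1) ev by auto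
  \<comment> \<open>Both denominators go into the weight: this bounds \<open>?F\<close> and
    \<open>?G\<close> by 1, and they depend only on data that the swaps at \<open>v\<close> and at
    \<open>w\<close>, respectively, leave alone outside the exceptional event.\<close>
  let ?F = "\<lambda>\<omega>. (\<Sum>h\<in>later_at \<omega> w e. t h) / (?R v \<omega> * ?R w \<omega>)"
  let ?G = "\<lambda>\<omega>. ?g v \<omega> / (?R v \<omega> * ?R w \<omega>)"
  have RR: "1 \<le> ?R v \<omega> * ?R w \<omega>" "?R w \<omega> \<le> ?R v \<omega> * ?R w \<omega>" for \<omega>
    using R1(1)[of v \<omega>] R1(1)[of w \<omega>] mult_mono[of 1 "?R v \<omega>" 1 "?R w \<omega>"] mult_right_mono[of 1 "?R v \<omega>" "?R w \<omega>"] by auto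
  have A: "\<bar>expect (\<lambda>\<omega>. (\<Sum>h\<in>later_at \<omega> v e. s h) * ?F \<omega>) - s e * expect (\<lambda>\<omega>. ?g v \<omega> * ?F \<omega>)\<bar>
      \<le> 4 * real (card (edges_at E v)) * \<theta> ^ 3"
  proof (rule expect_sum_later[OF e(1,2) _ _ s d(1)])
    show "\<bar>?F \<omega>\<bar> \<le> 1" for \<omega>
      using tR[of \<omega>] RR[of \<omega>] by (simp add: abs_divide abs_mult divide_le_eq_1)
    show "?F (swap f g x y \<omega>) = ?F \<omega>" if "\<omega> \<in> Om" "f \<in> E" "f = {v, x}" "f \<noteq> e" "g \<in> E" "g = {v, y}" "g \<noteq> e"
       "\<not> (e \<in> fst (snd \<omega>) \<and> ({w, x} \<in> fst (snd \<omega>) \<or> {w, y} \<in> fst (snd \<omega>)))" for \<omega> f g x y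
      using card_later_swap[OF e(1,2) that(2-7)] later_swap_other[OF e(1,2) that(2-7) that(1,8)] by simp
  qed
  have e': "e = {w, v}" using e by auto
  have B: "\<bar>expect (\<lambda>\<omega>. (\<Sum>h\<in>later_at \<omega> w e. t h) * ?G \<omega>) - t e * expect (\<lambda>\<omega>. ?g w \<omega> * ?G \<omega>)\<bar>
      \<le> 4 * real (card (edges_at E w)) * \<theta> ^ 3"
  proof (rule expect_sum_later[OF e(1) e' _ _ t d(2)])
    show "\<bar>?G \<omega>\<bar> \<le> 1" for \<omega>
      using g01[of v \<omega>] RR[of \<omega>] by (simp add: abs_divide abs_mult divide_le_eq_1)
    show "?G (swap f g x y \<omega>) = ?G \<omega>" if "\<omega> \<in> Om" "f \<in> E" "f = {w, x}" "f \<noteq> e" "g \<in> E" "g = {w, y}" "g \<noteq> e"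
       "\<not> (e \<in> fst (snd \<omega>) \<and> ({v, x} \<in> fst (snd \<omega>) \<or> {v, y} \<in> fst (snd \<omega>)))" for \<omega> f g x y
      using card_later_swap[OF e(1) e' that(2-7)] later_swap_other[OF e(1) e' that(2-7) that(1,8)] by simp
  qed
  have FG: "expect (\<lambda>\<omega>. ?g v \<omega> * ?F \<omega>) = expect (\<lambda>\<omega>. (\<Sum>h\<in>later_at \<omega> w e. t h) * ?G \<omega>)"
    by (intro expect_cong) simp
  have C: "expect (\<lambda>\<omega>. ?g w \<omega> * ?G \<omega>) \<le> expect (\<lambda>\<omega>. 1 / (?R v \<omega> * ?R w \<omega>))"
  proof (rule expect_mono)
    fix \<omega>
    have "?g w \<omega> * ?g v \<omega> \<le> 1" using g01[of v \<omega>] g01[of w \<omega>] by (intro mult_le_one) auto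
    hence "(?g w \<omega> * ?g v \<omega>) / (?R v \<omega> * ?R w \<omega>) \<le> 1 / (?R v \<omega> * ?R w \<omega>)"
      using RR[of \<omega>] by (intro divide_right_mono) auto
    thus "?g w \<omega> * ?G \<omega> \<le> 1 / (?R v \<omega> * ?R w \<omega>)" by simp
  qed
  have bb: "bias s (key \<omega>) (edges_at E v) e * bias t (key \<omega>) (edges_at E w) e
      = (\<Sum>h\<in>later_at \<omega> v e. s h) * ?F \<omega>" for \<omega>
    by (simp add: bias_def)
  define P where "P = expect (\<lambda>\<omega>. (\<Sum>h\<in>later_at \<omega> v e. s h) * ?F \<omega>)"
  define Q where "Q = expect (\<lambda>\<omega>. ?g v \<omega> * ?F \<omega>)"
  define K where "K = expect (\<lambda>\<omega>. ?g w \<omega> * ?G \<omega>)"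
  have "\<bar>Q - t e * K\<bar> \<le> 4 * real D * \<theta> ^ 3"
  proof -
    have "\<bar>Q - t e * K\<bar> \<le> 4 * real (card (edges_at E w)) * \<theta> ^ 3"
      using B unfolding Q_def FG K_def .
    also have "\<dots> \<le> 4 * real D * \<theta> ^ 3" using d(4) \<theta> by (intro mult_right_mono) auto
    finally show ?thesis .
  qed
  hence "\<bar>s e\<bar> * \<bar>Q - t e * K\<bar> \<le> 1 * (4 * real D * \<theta> ^ 3)"
    using se1 by (intro mult_mono) auto
  hence "\<bar>s e * Q - (s e * t e) * K\<bar> \<le> 4 * real D * \<theta> ^ 3"
    by (simp add: abs_mult[symmetric] right_diff_distrib mult.assoc)
  hence q: "\<bar>s e * Q + K\<bar> \<le> 4 * real D * \<theta> ^ 3" by (simp add: st)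
  have p: "\<bar>P - s e * Q\<bar> \<le> 4 * real D * \<theta> ^ 3"
  proof -
    have "\<bar>P - s e * Q\<bar> \<le> 4 * real (card (edges_at E v)) * \<theta> ^ 3"
      using A unfolding P_def Q_def .
    also have "\<dots> \<le> 4 * real D * \<theta> ^ 3" using d(3) \<theta> by (intro mult_right_mono) auto
    finally show ?thesis .
  qed
  have "expect (\<lambda>\<omega>. - (bias s (key \<omega>) (edges_at E v) e * bias t (key \<omega>) (edges_at E w) e)) = - P"
    unfolding bb P_def using expect_cmult[of "-1"] by simp
  thus ?thesis using p q C unfolding K_def by linarith
qed

end

section \<open>The expected loss of an order with late phases\<close>

lemma inj_on_card_later:
  assumes "finite I" "inj_on \<kappa> I"
  shows "inj_on (\<lambda>e. card (later \<kappa> I e)) I"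
proof (rule inj_onI)
  fix e f assume ef: "e \<in> I" "f \<in> I" "card (later \<kappa> I e) = card (later \<kappa> I f)"
  have *: "card (later \<kappa> I f) < card (later \<kappa> I e)" if "e \<in> I" "f \<in> I" "\<kappa> e < \<kappa> f" for e f
  proof (rule psubset_card_mono)
    show "finite (later \<kappa> I e)" using assms(1) by simp
    have "later \<kappa> I f \<subseteq> later \<kappa> I e" "e \<in> later \<kappa> I e" "e \<notin> later \<kappa> I f"
      using that by (auto simp: later_def)
    thus "later \<kappa> I f \<subset> later \<kappa> I e" by blast
  qed
  show "e = f" using *[OF ef(1,2)] *[OF ef(2,1)] ef assms(2)
    by (metis inj_onD less_irrefl linorder_neqE_nat)
qed

text \<open>Meant for the remaining counts at one vertex, which are distinct integers. The bound
  comes from telescoping \<open>1 / q^2 \<le> 2 / q - 2 / (q + 1)\<close> for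
  \<open>q \<ge> 1\<close>.\<close>

lemma sum_inverse_squares_le:
  assumes "finite S" "S \<subseteq> {Suc k..}"
  shows "(\<Sum>r\<in>S. 1 / (real r)\<^sup>2) \<le> 2 / (real k + 1)"
proof -
  obtain N where N: "S \<subseteq> {Suc k..<Suc k + N}"
  proof
    show "S \<subseteq> {Suc k..<Suc k + Suc (Max S)}"
    proof
      fix t assume t: "t \<in> S"
      have "t \<le> Max S" using assms(1) t by (rule Max_ge)
      thus "t \<in> {Suc k..<Suc k + Suc (Max S)}" using assms(2) t by auto
    qed
  qed
  have "(\<Sum>r\<in>S. 1 / (real r)\<^sup>2) \<le> (\<Sum>r=Suc k..<Suc k + N. 1 / (real r)\<^sup>2)"
    using N by (intro sum_mono2) auto
  also have "\<dots> \<le> 2 / (real k + 1) - 2 / (real k + 1 + real N)"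
  proof (induction N)
    case (Suc N)
    define q where "q = real k + 1 + real N"
    have q: "q \<ge> 1" by (simp add: q_def)
    have "1 / q\<^sup>2 = 2 / (2 * q\<^sup>2)" by simp
    also have "\<dots> \<le> 2 / (q * (q + 1))"
      using q by (intro frac_le) (auto simp: power2_eq_square algebra_simps intro: add_pos_nonneg)
    also have "\<dots> = 2 / q - 2 / (q + 1)" using q by (simp add: field_simps)
    finally have "1 / q\<^sup>2 \<le> 2 / q - 2 / (q + 1)" .
    moreover have q': "real (Suc k + N) = q" "real k + 1 + real (Suc N) = q + 1" by (simp_all add: q_def)
    moreover have s: "(\<Sum>r=Suc k..<Suc k + Suc N. 1 / (real r)\<^sup>2)
        = (\<Sum>r=Suc k..<Suc k + N. 1 / (real r)\<^sup>2) + 1 / (real (Suc k + N))\<^sup>2"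
      unfolding add_Suc_right by (rule sum.atLeastLessThan_Suc) simp
    ultimately show ?case using Suc[folded q_def] unfolding s q' by linarith
  qed simp
  also have "\<dots> \<le> 2 / (real k + 1)" by simp
  finally show ?thesis .
qed

lemma sum_card_edges_at:
  assumes "finite V" "E \<subseteq> nsets V 2"
  shows "(\<Sum>v\<in>V. card (edges_at E v)) = 2 * card E"
proof -
  have finE: "finite E" using assms finite_imp_finite_nsets finite_subset by blast
  have "(\<Sum>v\<in>V. card (edges_at E v)) = (\<Sum>v\<in>V. \<Sum>e | e \<in> E \<and> v \<in> e. 1)"
    by (simp add: edges_at_def)
  also have "\<dots> = (\<Sum>e\<in>E. \<Sum>v | v \<in> V \<and> v \<in> e. 1)" by (rule sum.swap_restrict[OF assms(1) finE])
  also have "\<dots> = (\<Sum>e\<in>E. 2)"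
  proof (intro sum.cong refl)
    fix e assume "e \<in> E"
    hence "e \<subseteq> V" "card e = 2" using assms(2) by (auto simp: nsets_def)
    moreover from this have "{v. v \<in> V \<and> v \<in> e} = e" by auto
    ultimately show "(\<Sum>v | v \<in> V \<and> v \<in> e. 1) = (2::nat)" by simp
  qed
  finally show ?thesis by simp
qed

context late_order
begin

definition late_nbrs where
  "late_nbrs \<omega> v = card {h \<in> edges_at E v. h \<in> fst (snd \<omega>) \<and> h - {v} \<subseteq> snd (snd \<omega>)}"

text \<open>The edges counted by \<open>late_nbrs\<close> all have phase
  \<open>2 + of_bool (v \<in> U)\<close>, the largest possible at \<open>v\<close>. Any edge of
  smaller phase precedes all of them and also counts itself, hence the strict inequality.\<close>

lemma late_nbrs_less_card_later:
  assumes "\<omega> \<in> Om" "e \<in> edges_at E v" "phase \<omega> e < 2 + of_bool (v \<in> snd (snd \<omega>))"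
  shows "late_nbrs \<omega> v < card (later_at \<omega> v e)"
proof -
  let ?L = "{h \<in> edges_at E v. h \<in> fst (snd \<omega>) \<and> h - {v} \<subseteq> snd (snd \<omega>)}"
  have e: "e \<in> E" using assms(2) by (simp add: edges_at_def)
  have lt: "key \<omega> e < key \<omega> h" if h: "h \<in> ?L" for h
  proof -
    obtain x where x: "h = {v, x}" "x \<noteq> v" using h by (auto elim: edge_at_cases)
    have "card (h \<inter> snd (snd \<omega>)) = 1 + of_bool (v \<in> snd (snd \<omega>))"
    proof -
      have "x \<in> snd (snd \<omega>)" using h x by auto
      hence "h \<inter> snd (snd \<omega>) = (if v \<in> snd (snd \<omega>) then {v, x} else {x})" using x by auto
      thus ?thesis using x by simp
    qed
    hence "phase \<omega> h = 2 + of_bool (v \<in> snd (snd \<omega>))" using h by (simp add: phase_def)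
    thus ?thesis using key_less[OF assms(1) e] assms(3) by simp
  qed
  have "insert e ?L \<subseteq> later_at \<omega> v e"
    using assms(2) less_imp_le[OF lt] by (auto simp: later_def)
  hence "card (insert e ?L) \<le> card (later_at \<omega> v e)" by (intro card_mono) auto
  moreover have "e \<notin> ?L" using lt[of e] by auto
  ultimately show ?thesis by (simp add: late_nbrs_def)
qed

text \<open>In phase 2 the endpoint outside \<open>U\<close> may have few remaining edges, but then the endpoint in \<open>U\<close>
  still has many; the weights \<open>a\<close> and \<open>1 / a\<close> exploit this through the arithmetic-geometric mean inequality.\<close>

definition cost where
  "cost a \<omega> v e = (if phase \<omega> e < 2 + of_bool (v \<in> snd (snd \<omega>)) then 1 / a
      else if v \<in> snd (snd \<omega>) then 1 else a) / (real (card (later_at \<omega> v e)))\<^sup>2"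

text \<open>The weights at the two ends always have product at least 1, as the arithmetic-geometric
  mean inequality requires: \<open>1 / a\<close> twice for early edges and for phase 1,
  \<open>1 / a\<close> at the end in \<open>U\<close> against \<open>a\<close> at the other end in
  phase 2, and 1 twice in phase 3.\<close>

lemma inverse_le_cost:
  assumes "e \<in> E" "e = {v, w}" "v \<noteq> w" "0 < a" "a \<le> 1"
  shows "1 / (real (card (later_at \<omega> v e)) * real (card (later_at \<omega> w e))) \<le> cost a \<omega> v e + cost a \<omega> w e"
proof -
  let ?U = "snd (snd \<omega>)"
  have am: "p * q \<le> c * p\<^sup>2 + d * q\<^sup>2" if "c > 0" "d \<ge> 1 / c" "p \<ge> 0" "q \<ge> 0" for p q c d :: real
  proof -
    have "0 \<le> (c * p - q)\<^sup>2 / c" using that by simp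
    also have "\<dots> = c * p\<^sup>2 + 1 / c * q\<^sup>2 - 2 * (p * q)" using that by (simp add: power2_eq_square field_simps)
    finally have "p * q \<le> c * p\<^sup>2 + 1 / c * q\<^sup>2" using that by (simp add: mult_nonneg_nonneg) (smt (verit) mult_nonneg_nonneg)
    also have "\<dots> \<le> c * p\<^sup>2 + d * q\<^sup>2" using that by (intro add_mono mult_right_mono) auto
    finally show ?thesis .
  qed
  have a1: "1 / a \<ge> 1" "1 / (1 / a) \<le> 1 / a" using assms(4,5) mult_le_one[of a a] by (auto simp: field_simps)
  have ph: "phase \<omega> e = (if e \<in> fst (snd \<omega>) then 1 + of_bool (v \<in> ?U) + of_bool (w \<in> ?U) else 0)"
  proof -
    have "card (e \<inter> ?U) = of_bool (v \<in> ?U) + of_bool (w \<in> ?U)"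
      using assms(2,3) by (cases "v \<in> ?U"; cases "w \<in> ?U") (auto simp: Int_insert_left)
    thus ?thesis by (simp add: phase_def)
  qed
  define p q where "p = 1 / real (card (later_at \<omega> v e))" and "q = 1 / real (card (later_at \<omega> w e))"
  have pq: "p \<ge> 0" "q \<ge> 0" by (auto simp: p_def q_def)
  have cost_eq: "cost a \<omega> u e = (if phase \<omega> e < 2 + of_bool (u \<in> ?U) then 1 / a
      else if u \<in> ?U then 1 else a) * (1 / real (card (later_at \<omega> u e)))\<^sup>2" for u
    by (simp add: cost_def power_divide)
  have "p * q \<le> cost a \<omega> v e + cost a \<omega> w e"
    unfolding cost_eq p_def[symmetric] q_def[symmetric] ph
    using am[OF _ _ pq, of "1/a" "1/a"] am[OF _ _ pq, of a "1/a"] am[OF _ _ pq, of "1/a" a] am[OF _ _ pq, of 1 1] assms(4) a1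
    by (cases "v \<in> ?U"; cases "w \<in> ?U"; cases "e \<in> fst (snd \<omega>)") auto
  thus ?thesis by (simp add: p_def q_def)
qed

text \<open>The large weight \<open>1 / a\<close> meets only counts above \<open>late_nbrs\<close>,
  so its sum is small; the weight 1 occurs only at the rare vertices of \<open>U\<close>; the weight
  \<open>a\<close> is small by choice. Each full sum of inverse squares is at most 2.\<close>

lemma sum_cost_le:
  assumes "\<omega> \<in> Om" "0 < a"
  shows "(\<Sum>e\<in>edges_at E v. cost a \<omega> v e) \<le> 2 / a * (1 / (real (late_nbrs \<omega> v) + 1)) + 2 * of_bool (v \<in> snd (snd \<omega>)) + 2 * a"
proof -
  let ?I = "edges_at E v" and ?R = "\<lambda>e. card (later_at \<omega> v e)" and ?k = "late_nbrs \<omega> v"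
  have inj: "inj_on ?R ?I"
    by (rule inj_on_card_later) (use inj_key[OF assms(1)] in \<open>auto simp: inj_on_def edges_at_def\<close>)
  have R0: "?R e > 0" if "e \<in> ?I" for e
    using self_in_later[OF that, of \<omega>] by (auto simp: card_gt_0_iff)
  have S: "(\<Sum>e\<in>J. 1 / (real (?R e))\<^sup>2) \<le> 2 / (real k + 1)" if "J \<subseteq> ?I" "\<And>e. e \<in> J \<Longrightarrow> k < ?R e" for J k
  proof -
    have "(\<Sum>e\<in>J. 1 / (real (?R e))\<^sup>2) = (\<Sum>r\<in>?R ` J. 1 / (real r)\<^sup>2)"
      using inj_on_subset[OF inj that(1)] by (simp add: sum.reindex)
    also have "\<dots> \<le> 2 / (real k + 1)"
      using that finite_subset[OF that(1)] by (intro sum_inverse_squares_le) (auto simp: Suc_le_eq)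
    finally show ?thesis .
  qed
  define J where "J = {e \<in> ?I. ?k < ?R e}"
  have "(\<Sum>e\<in>?I. cost a \<omega> v e) \<le> (\<Sum>e\<in>?I. 1 / a * (if e \<in> J then 1 / (real (?R e))\<^sup>2 else 0)
      + of_bool (v \<in> snd (snd \<omega>)) * (1 / (real (?R e))\<^sup>2) + a * (1 / (real (?R e))\<^sup>2))"
  proof (rule sum_mono)
    fix e assume e: "e \<in> ?I"
    define r where "r = 1 / (real (?R e))\<^sup>2"
    have "e \<in> J" if "phase \<omega> e < 2 + of_bool (v \<in> snd (snd \<omega>))"
      using late_nbrs_less_card_later[OF assms(1) e that] e by (simp add: J_def)
    moreover have "cost a \<omega> v e = (if phase \<omega> e < 2 + of_bool (v \<in> snd (snd \<omega>)) then 1 / a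
      else if v \<in> snd (snd \<omega>) then 1 else a) * r" by (simp add: cost_def r_def)
    moreover have "r \<ge> 0" "1 / a > 0" using assms(2) by (auto simp: r_def)
    ultimately show "cost a \<omega> v e \<le> 1 / a * (if e \<in> J then 1 / (real (?R e))\<^sup>2 else 0)
      + of_bool (v \<in> snd (snd \<omega>)) * (1 / (real (?R e))\<^sup>2) + a * (1 / (real (?R e))\<^sup>2)"
      unfolding r_def[symmetric] using assms(2) by auto
  qed
  also have "\<dots> = 1 / a * (\<Sum>e\<in>J. 1 / (real (?R e))\<^sup>2)
      + of_bool (v \<in> snd (snd \<omega>)) * (\<Sum>e\<in>?I. 1 / (real (?R e))\<^sup>2) + a * (\<Sum>e\<in>?I. 1 / (real (?R e))\<^sup>2)"
  proof -
    have "(\<Sum>e\<in>?I. if e \<in> J then 1 / (real (?R e))\<^sup>2 else 0) = (\<Sum>e\<in>J. 1 / (real (?R e))\<^sup>2)"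
      by (subst sum.If_cases) (auto simp: J_def Int_def intro!: sum.cong)
    thus ?thesis by (simp only: sum.distrib sum_distrib_left[symmetric])
  qed
  also have "\<dots> \<le> 1 / a * (2 / (real ?k + 1)) + of_bool (v \<in> snd (snd \<omega>)) * (2 / (real 0 + 1)) + a * (2 / (real 0 + 1))"
    using assms(2) by (intro add_mono mult_left_mono S) (auto simp: J_def R0)
  finally show ?thesis by simp
qed

text \<open>The number of late neighbours in \<open>U\<close> is binomial; the bound follows from
  \<open>(\<Sum>h\<in>L. 1 / card L) \<le> 1\<close> because the membership of \<open>h\<close> in \<open>L\<close> is independent of \<open>L - {h}\<close>.\<close>

lemma expect_late_nbrs:
  "\<theta> * \<eta> * real (card (edges_at E v)) * expect (\<lambda>\<omega>. 1 / (real (late_nbrs \<omega> v) + 1)) \<le> 1"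
proof -
  let ?I = "edges_at E v"
  define L where "L = (\<lambda>(\<omega> :: (nat set \<Rightarrow> nat set) \<times> nat set set \<times> nat set). {h \<in> ?I. h \<in> fst (snd \<omega>) \<and> h - {v} \<subseteq> snd (snd \<omega>)})"
  define G where "G = (\<lambda>h \<omega>. 1 / (real (card (L \<omega> - {h})) + 1))"
  have finL: "finite (L \<omega>)" for \<omega> by (simp add: L_def)
  have one: "\<theta> * (\<eta> * expect (G h)) = expect (\<lambda>\<omega>. of_bool (h \<in> L \<omega>) * G h \<omega>)" if h: "h \<in> ?I" for h
  proof -
    obtain x where x: "h = {v, x}" "x \<noteq> v" "x \<in> V" using h by (rule edge_at_cases)
    have G1: "G h (\<sigma>, insert h H, U) = G h (\<sigma>, H, U)" for \<sigma> H U
    proof -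
      have "L (\<sigma>, insert h H, U) - {h} = L (\<sigma>, H, U) - {h}" by (auto simp: L_def)
      thus ?thesis by (simp add: G_def)
    qed
    \<comment> \<open>In a simple graph \<open>x\<close> is the far endpoint of no edge at
      \<open>v\<close> other than \<open>h\<close>, so its membership in \<open>U\<close> is
      invisible once \<open>h\<close> is removed.\<close>
    have G2: "G h (\<sigma>, H, insert x U) = G h (\<sigma>, H, U)" for \<sigma> H U
    proof -
      have "g - {v} \<subseteq> insert x U \<longleftrightarrow> g - {v} \<subseteq> U" if "g \<in> ?I" "g \<noteq> h" for g
      proof -
        obtain y where "g = {v, y}" "y \<noteq> v" using \<open>g \<in> ?I\<close> by (rule edge_at_cases)
        thus ?thesis using x that by auto
      qed
      hence "L (\<sigma>, H, insert x U) - {h} = L (\<sigma>, H, U) - {h}" unfolding L_def by auto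
      thus ?thesis by (simp add: G_def)
    qed
    have "\<theta> * (\<eta> * expect (G h)) = \<theta> * expect (\<lambda>\<omega>. of_bool (x \<in> snd (snd \<omega>)) * G h \<omega>)"
      using expect_in_U[OF x(3), of "G h"] G2 by simp
    also have "\<dots> = expect (\<lambda>\<omega>. of_bool (h \<in> fst (snd \<omega>)) * (of_bool (x \<in> snd (snd \<omega>)) * G h \<omega>))"
      using h G1 by (intro expect_late[symmetric]) (auto simp: edges_at_def)
    also have "\<dots> = expect (\<lambda>\<omega>. of_bool (h \<in> L \<omega>) * G h \<omega>)"
      using h x by (intro expect_cong) (auto simp: L_def)
    finally show ?thesis .
  qed
  have "\<theta> * \<eta> * real (card ?I) * expect (\<lambda>\<omega>. 1 / (real (late_nbrs \<omega> v) + 1))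
     = (\<Sum>h\<in>?I. \<theta> * (\<eta> * expect (\<lambda>\<omega>. 1 / (real (late_nbrs \<omega> v) + 1))))" by simp
  also have "\<dots> \<le> (\<Sum>h\<in>?I. \<theta> * (\<eta> * expect (G h)))"
  proof (intro sum_mono mult_left_mono expect_mono)
    fix h \<omega>
    have "card (L \<omega> - {h}) \<le> card (L \<omega>)" using finL by (intro card_mono) auto
    thus "1 / (real (late_nbrs \<omega> v) + 1) \<le> G h \<omega>"
      unfolding G_def late_nbrs_def L_def[symmetric, THEN fun_cong] by (intro divide_left_mono) auto
  qed (use \<theta> \<eta> in auto)
  also have "\<dots> = expect (\<lambda>\<omega>. \<Sum>h\<in>?I. of_bool (h \<in> L \<omega>) * G h \<omega>)"
    unfolding expect_sum by (intro sum.cong refl one)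
  also have "\<dots> \<le> expect (\<lambda>_. 1)"
  proof (rule expect_mono)
    fix \<omega>
    have "(\<Sum>h\<in>?I. of_bool (h \<in> L \<omega>) * G h \<omega>) = (\<Sum>h\<in>L \<omega>. 1 / real (card (L \<omega>)))"
    proof (intro sum.mono_neutral_cong_right)
      fix h assume h: "h \<in> L \<omega>"
      have eq: "real (card (L \<omega> - {h})) + 1 = real (card (L \<omega>))" using card.remove[OF finL h] by simp
      show "of_bool (h \<in> L \<omega>) * G h \<omega> = 1 / real (card (L \<omega>))" unfolding G_def eq using h by simp
    qed (auto simp: L_def)
    also have "\<dots> \<le> 1" by simp
    finally show "(\<Sum>h\<in>?I. of_bool (h \<in> L \<omega>) * G h \<omega>) \<le> 1" .
  qed
  finally show ?thesis by simp
qed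

text \<open>The first three terms average the three weights of \<open>cost\<close>. The last one
  collects the exchange errors \<open>8 * D * \<theta>^3\<close> over the edges, of which there are
  at most \<open>card V * D / 2\<close>.\<close>

lemma expect_loss:
  assumes x: "\<And>e. e \<in> E \<Longrightarrow> x e = 1 \<or> x e = -1"
    and bal: "\<And>v. v \<in> V \<Longrightarrow> (\<Sum>e\<in>edges_at E v. esgn x v e) = 0"
    and d: "\<And>v. v \<in> V \<Longrightarrow> 2 \<le> card (edges_at E v) \<and> dl \<le> real (card (edges_at E v)) \<and> card (edges_at E v) \<le> D"
    and a: "0 < a" "a \<le> 1" and dl: "dl > 0"
  shows "expect (\<lambda>\<omega>. \<Sum>e\<in>E. - corr (key \<omega>) E x e)
    \<le> real (card V) * (2 / (a * dl * \<theta> * \<eta>) + 2 * \<eta> + 2 * a + 4 * (real D)\<^sup>2 * \<theta> ^ 3)"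
proof -
  have loss: "expect (\<lambda>\<omega>. - corr (key \<omega>) E x e) \<le> expect (\<lambda>\<omega>. \<Sum>v\<in>e. cost a \<omega> v e) + 8 * real D * \<theta> ^ 3"
    if e: "e \<in> E" for e
  proof -
    have "e \<in> nsets V 2" using e E by auto
    then obtain v w where vw: "v < w" "e = {v, w}" "v \<in> V" "w \<in> V" "Min e = v" "Max e = w" by (rule nsets_2_cases)
    have "expect (\<lambda>\<omega>. - corr (key \<omega>) E x e) \<le>
      expect (\<lambda>\<omega>. 1 / (real (card (later_at \<omega> v e)) * real (card (later_at \<omega> w e)))) + 8 * real D * \<theta> ^ 3"
      unfolding corr_def vw(5,6)
    proof (rule expect_corr[OF e vw(2)])
      show "\<bar>esgn x v h\<bar> \<le> 1" if "h \<in> edges_at E v" for h using x[of h] that by (auto simp: edges_at_def esgn_def)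
      show "\<bar>esgn x w h\<bar> \<le> 1" if "h \<in> edges_at E w" for h using x[of h] that by (auto simp: edges_at_def esgn_def)
      show "esgn x v e * esgn x w e = -1" using x[OF e] vw by (auto simp: esgn_def)
    qed (use vw bal d in auto)
    also have "expect (\<lambda>\<omega>. 1 / (real (card (later_at \<omega> v e)) * real (card (later_at \<omega> w e))))
       \<le> expect (\<lambda>\<omega>. \<Sum>v\<in>e. cost a \<omega> v e)"
    proof (rule expect_mono)
      fix \<omega>
      have "(\<Sum>v\<in>e. cost a \<omega> v e) = cost a \<omega> v e + cost a \<omega> w e" using vw(1) by (subst (1) vw(2)) simp
      thus "1 / (real (card (later_at \<omega> v e)) * real (card (later_at \<omega> w e))) \<le> (\<Sum>v\<in>e. cost a \<omega> v e)"
        using inverse_le_cost[OF e vw(2) _ a, of \<omega>] vw(1) by simp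
    qed
    finally show ?thesis by simp
  qed
  have "expect (\<lambda>\<omega>. \<Sum>e\<in>E. - corr (key \<omega>) E x e) = (\<Sum>e\<in>E. expect (\<lambda>\<omega>. - corr (key \<omega>) E x e))"
    by (rule expect_sum)
  also have "\<dots> \<le> (\<Sum>e\<in>E. expect (\<lambda>\<omega>. \<Sum>v\<in>e. cost a \<omega> v e) + 8 * real D * \<theta> ^ 3)"
    by (rule sum_mono[OF loss])
  also have "\<dots> = expect (\<lambda>\<omega>. \<Sum>e\<in>E. \<Sum>v\<in>e. cost a \<omega> v e) + real (card E) * (8 * real D * \<theta> ^ 3)"
    by (simp add: sum.distrib expect_sum)
  also have "expect (\<lambda>\<omega>. \<Sum>e\<in>E. \<Sum>v\<in>e. cost a \<omega> v e) \<le> real (card V) * (2 / (a * dl * \<theta> * \<eta>) + 2 * \<eta> + 2 * a)"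
  proof -
    have "(\<Sum>e\<in>E. \<Sum>v\<in>e. cost a \<omega> v e) = (\<Sum>v\<in>V. \<Sum>e\<in>edges_at E v. cost a \<omega> v e)" for \<omega>
    proof -
      have "(\<Sum>e\<in>E. \<Sum>v\<in>e. cost a \<omega> v e) = (\<Sum>e\<in>E. \<Sum>v | v \<in> V \<and> v \<in> e. cost a \<omega> v e)"
        using E by (intro sum.cong refl) (auto simp: nsets_def)
      also have "\<dots> = (\<Sum>v\<in>V. \<Sum>e | e \<in> E \<and> v \<in> e. cost a \<omega> v e)"
        by (rule sum.swap_restrict[OF finE finV])
      finally show ?thesis by (simp add: edges_at_def)
    qed
    hence "expect (\<lambda>\<omega>. \<Sum>e\<in>E. \<Sum>v\<in>e. cost a \<omega> v e) = (\<Sum>v\<in>V. expect (\<lambda>\<omega>. \<Sum>e\<in>edges_at E v. cost a \<omega> v e))"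
      by (simp add: expect_sum)
    also have "\<dots> \<le> (\<Sum>v\<in>V. 2 / (a * dl * \<theta> * \<eta>) + 2 * \<eta> + 2 * a)"
    proof (rule sum_mono)
      fix v assume v: "v \<in> V"
      have "expect (\<lambda>\<omega>. \<Sum>e\<in>edges_at E v. cost a \<omega> v e)
        \<le> expect (\<lambda>\<omega>. 2 / a * (1 / (real (late_nbrs \<omega> v) + 1)) + 2 * (of_bool (v \<in> snd (snd \<omega>)) * 1) + 2 * a)"
        using sum_cost_le[OF _ a(1)] by (intro expect_mono) simp
      also have "\<dots> = 2 / a * expect (\<lambda>\<omega>. 1 / (real (late_nbrs \<omega> v) + 1)) + 2 * (\<eta> * 1) + 2 * a"
        using expect_in_U[OF v, of "\<lambda>_. 1"] by (simp only: expect_add expect_cmult expect_const)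
      also have "expect (\<lambda>\<omega>. 1 / (real (late_nbrs \<omega> v) + 1)) \<le> 1 / (dl * \<theta> * \<eta>)"
      proof -
        have X: "0 \<le> expect (\<lambda>\<omega>. 1 / (real (late_nbrs \<omega> v) + 1))"
          using expect_mono[of "\<lambda>_. 0" "\<lambda>\<omega>. 1 / (real (late_nbrs \<omega> v) + 1)"] by simp
        have "(\<theta> * \<eta> * dl) * expect (\<lambda>\<omega>. 1 / (real (late_nbrs \<omega> v) + 1))
           \<le> \<theta> * \<eta> * real (card (edges_at E v)) * expect (\<lambda>\<omega>. 1 / (real (late_nbrs \<omega> v) + 1))"
          using d[OF v] \<theta> \<eta> X by (intro mult_right_mono mult_left_mono) auto
        also have "\<dots> \<le> 1" by (rule expect_late_nbrs)
        finally show ?thesis using \<theta> \<eta> dl by (simp add: pos_le_divide_eq mult_ac)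
      qed
      finally show "expect (\<lambda>\<omega>. \<Sum>e\<in>edges_at E v. cost a \<omega> v e) \<le> 2 / (a * dl * \<theta> * \<eta>) + 2 * \<eta> + 2 * a"
        using a by (simp add: mult_left_mono divide_right_mono mult_ac)
    qed
    also have "\<dots> = real (card V) * (2 / (a * dl * \<theta> * \<eta>) + 2 * \<eta> + 2 * a)" by simp
    finally show ?thesis .
  qed
  also have "real (card E) * (8 * real D * \<theta> ^ 3) \<le> real (card V) * (4 * (real D)\<^sup>2 * \<theta> ^ 3)"
  proof -
    have "2 * card E \<le> card V * D"
      unfolding sum_card_edges_at[OF finV E, symmetric] using d sum_bounded_above[of V "\<lambda>v. card (edges_at E v)" D] by simp
    hence "2 * real (card E) \<le> real (card V) * real D" by (metis of_nat_le_iff of_nat_mult of_nat_numeral)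
    hence "(2 * real (card E)) * (4 * real D * \<theta> ^ 3) \<le> (real (card V) * real D) * (4 * real D * \<theta> ^ 3)"
      using \<theta> by (intro mult_right_mono) auto
    thus ?thesis by (simp add: power2_eq_square algebra_simps)
  qed
  finally show ?thesis by (simp add: algebra_simps)
qed

end

lemma EO_le_exp_rho_hat:
  assumes E: "E \<subseteq> nsets {1..n} 2" and n: "n > 0"
    and d: "\<And>v. v \<in> {1..n} \<Longrightarrow> 2 \<le> deg E v \<and> dl \<le> real (deg E v) \<and> deg E v \<le> D"
    and pos: "0 < \<theta>" "\<theta> \<le> 1" "0 < \<eta>" "\<eta> \<le> 1" "0 < a" "a \<le> 1" "dl > 0"
  shows "real (EO n E) \<le>
    exp (real n * (rho_hat n E + 2 / (a * dl * \<theta> * \<eta>) + 2 * \<eta> + 2 * a + 4 * (real D)\<^sup>2 * \<theta> ^ 3))"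
proof -
  have finE: "finite E" using E finite_imp_finite_nsets finite_subset by blast
  obtain ix where "bij_betw ix E {..<card E}" using finE by (metis atLeast0LessThan ex_bij_betw_finite_nat)
  then interpret late_order "{1..n}" E \<theta> \<eta> ix
    by unfold_locales (use E pos in auto)
  have deg: "deg E v = card (edges_at E v)" for v by (simp add: deg_def edges_at_def)
  define Lam where "Lam = real (card {1..n}) * (2 / (a * dl * \<theta> * \<eta>) + 2 * \<eta> + 2 * a + 4 * (real D)\<^sup>2 * \<theta> ^ 3)"
  have "finite (balanced_signs n E)"
    using finE by (auto simp: balanced_signs_def intro: finite_subset[OF _ finite_PiE[of E "\<lambda>_. {1, -1}"]])
  hence "real (card (balanced_signs n E)) \<le>
     exp ((\<Sum>v\<in>{1..n}. ln (real (card (edges_at E v) choose (card (edges_at E v) div 2)))) - real (card E) * ln 2 + Lam)"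
  proof (rule card_balanced_le[OF finite_atLeastAtMost E _ finOm _ _ _ wt_nonneg sum_wt inj_key])
    show "x e = 1 \<or> x e = -1" if "x \<in> balanced_signs n E" "e \<in> E" for x e
      using that by (auto simp: balanced_signs_def)
    show "(\<Sum>e\<in>edges_at E v. esgn x v e) = 0" if "x \<in> balanced_signs n E" "v \<in> {1..n}" for x v
      using that by (auto simp: balanced_signs_def)
    show "x = y" if "x \<in> balanced_signs n E" "y \<in> balanced_signs n E" "\<forall>e\<in>E. x e = y e" for x y
      using that by (intro PiE_ext[of x E "\<lambda>_. {1, -1}" y]) (auto simp: balanced_signs_def)
    show "(\<Sum>\<omega>\<in>Om. wt \<omega> * (\<Sum>e\<in>E. - corr (key \<omega>) E x e)) \<le> Lam" if x: "x \<in> balanced_signs n E" for x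
      unfolding expect_def[symmetric] Lam_def
      by (rule expect_loss) (use x d pos deg in \<open>auto simp: balanced_signs_def\<close>)
  qed
  also have "(\<Sum>v\<in>{1..n}. ln (real (card (edges_at E v) choose (card (edges_at E v) div 2)))) - real (card E) * ln 2
      = real n * rho_hat n E"
  proof -
    have "(\<Sum>v\<in>{1..n}. real (deg E v)) = 2 * real (card E)"
      using sum_card_edges_at[OF _ E] deg by (simp flip: of_nat_sum)
    hence "(\<Sum>v\<in>{1..n}. real (deg E v) / 2 * ln 2) = real (card E) * ln 2"
      by (simp add: sum_distrib_right[symmetric] sum_divide_distrib[symmetric])
    thus ?thesis using n by (simp add: rho_hat_def sum_subtractf deg)
  qed
  finally have "real (card (balanced_signs n E)) \<le> exp (real n * rho_hat n E + Lam)" .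
  moreover have "real (EO n E) \<le> real (card (balanced_signs n E))"
    using EO_le_card_balanced_signs[OF E] by simp
  ultimately show ?thesis by (simp add: Lam_def algebra_simps)
qed

section \<open>Switchings in the configuration model\<close>

text \<open>A pairing of the configuration model is a word \<open>xs\<close> in which vertex \<open>i\<close> occurs \<open>d i\<close> times;
  the positions \<open>2 * k\<close> and \<open>2 * k + 1\<close> hold the endpoints of the \<open>k\<close>-th edge. A switching
  exchanges two letters.\<close>

definition partner :: "nat \<Rightarrow> nat" where
  "partner i = (if even i then i + 1 else i - 1)"

definition pair :: "nat list \<Rightarrow> nat \<Rightarrow> nat set" where
  "pair xs k = {xs ! (2 * k), xs ! (2 * k + 1)}"

definition pairs :: "nat \<Rightarrow> nat list \<Rightarrow> nat set set" where
  "pairs m xs = pair xs ` {k. k < m \<and> xs ! (2 * k) \<noteq> xs ! (2 * k + 1)}"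

text \<open>Loops and repeated edges are measured by one number, which is 0 exactly for simple
  pairings. By \<open>card_pairs_le\<close> the subtraction is never truncated.\<close>

definition defect :: "nat \<Rightarrow> nat list \<Rightarrow> nat" where
  "defect m xs = m - card (pairs m xs)"

text \<open>Positions holding \<open>a\<close> itself or a vertex joined to \<open>a\<close>:
  placing such a letter opposite \<open>a\<close> would create a loop or repeat an edge.\<close>

definition near :: "nat \<Rightarrow> nat list \<Rightarrow> nat \<Rightarrow> nat set" where
  "near m xs a = {q. q < 2 * m \<and> (xs ! q = a \<or> (\<exists>r<2 * m. xs ! r = a \<and> xs ! q = xs ! partner r))}"

text \<open>The first copy of a repeated edge is not bad, so dissolving a bad pair never removes an
  edge of the graph.\<close>

definition bad :: "nat \<Rightarrow> nat list \<Rightarrow> nat set" where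
  "bad m xs = {k. k < m \<and> (xs ! (2 * k) = xs ! (2 * k + 1) \<or> (\<exists>j<k. pair xs j = pair xs k))}"

text \<open>Exchanging the positions \<open>2 * k + 1\<close> and \<open>q\<close> pairs
  \<open>xs ! q\<close> with \<open>xs ! (2 * k)\<close> and \<open>xs ! (2 * k + 1)\<close> with
  \<open>xs ! partner q\<close>; validity makes both of these non-loops and absent so far.\<close>

definition valid :: "nat \<Rightarrow> nat list \<Rightarrow> nat \<Rightarrow> nat set" where
  "valid m xs k = {q. q < 2 * m \<and> q \<notin> near m xs (xs ! (2 * k)) \<and> partner q \<notin> near m xs (xs ! (2 * k + 1))}"

definition switch :: "nat \<Rightarrow> nat \<Rightarrow> nat list \<Rightarrow> nat list" where
  "switch k q xs = permute_list (Transposition.transpose (2 * k + 1) q) xs"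

lemma partner_partner [simp]: "partner (partner i) = i"
  by (auto simp: partner_def elim!: oddE)

lemma partner_less: "i < 2 * m \<Longrightarrow> partner i < 2 * m"
  by (auto simp: partner_def elim!: evenE)

lemma partner_even [simp]: "partner (2 * k) = 2 * k + 1" "partner (2 * k + 1) = 2 * k" "partner (Suc (2 * k)) = 2 * k"
  by (auto simp: partner_def)

lemma pair_div_2: "pair xs (q div 2) = {xs ! q, xs ! partner q}"
proof (cases "even q")
  case True
  then obtain k where "q = 2 * k" by (elim evenE)
  thus ?thesis by (simp add: pair_def)
next
  case False
  then obtain k where "q = 2 * k + 1" by (elim oddE)
  thus ?thesis by (auto simp: pair_def)
qed

lemma finite_pairs [simp]: "finite (pairs m xs)"
  by (simp add: pairs_def)

lemma card_pairs_le: "card (pairs m xs) \<le> m"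
proof -
  have "card (pairs m xs) \<le> card {k. k < m \<and> xs ! (2 * k) \<noteq> xs ! (2 * k + 1)}"
    unfolding pairs_def by (rule card_image_le) simp
  also have "\<dots> \<le> card {..<m}" by (rule card_mono) auto
  finally show ?thesis by simp
qed

lemma finite_bad [simp]: "finite (bad m xs)" by (simp add: bad_def)
lemma finite_valid [simp]: "finite (valid m xs k)" by (simp add: valid_def)
lemma finite_near [simp]: "finite (near m xs a)" by (simp add: near_def)

lemma defect_le_card_bad: "defect m xs \<le> card (bad m xs)"
proof -
  have "inj_on (pair xs) ({..<m} - bad m xs)"
  proof (rule inj_onI)
    fix i j assume "i \<in> {..<m} - bad m xs" "j \<in> {..<m} - bad m xs" "pair xs i = pair xs j"
    thus "i = j" by (auto simp: bad_def) (metis linorder_neqE_nat)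
  qed
  hence "card ({..<m} - bad m xs) \<le> card (pairs m xs)"
    by (rule card_inj_on_le) (auto simp: pairs_def bad_def)
  moreover have "card ({..<m} - bad m xs) = m - card (bad m xs)"
    by (subst card_Diff_subset) (auto simp: bad_def)
  ultimately show ?thesis by (simp add: defect_def)
qed

lemma pair_in_near:
  assumes "j < m" "pair xs j = {a, c}" "q < 2 * m" "xs ! q = c"
  shows "q \<in> near m xs a"
proof -
  have "\<exists>r<2 * m. xs ! r = a \<and> xs ! partner r = c"
  proof (cases "xs ! (2 * j) = a \<and> xs ! (2 * j + 1) = c")
    case True
    thus ?thesis using assms(1) by (intro exI[of _ "2 * j"]) auto
  next
    case False
    hence "xs ! (2 * j) = c \<and> xs ! (2 * j + 1) = a" using assms(2) by (auto simp: pair_def doubleton_eq_iff)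
    thus ?thesis using assms(1) by (intro exI[of _ "2 * j + 1"]) auto
  qed
  thus ?thesis using assms(3,4) by (auto simp: near_def)
qed

context
  fixes m k q :: nat and xs :: "nat list"
  assumes len: "length xs = 2 * m" and k: "k \<in> bad m xs" and q: "q \<in> valid m xs k"
begin

lemma q_facts: "q < 2 * m" "k < m" "xs ! q \<noteq> xs ! (2 * k)" "xs ! partner q \<noteq> xs ! (2 * k + 1)"
  "{xs ! (2 * k), xs ! q} \<notin> pairs m xs" "{xs ! (2 * k + 1), xs ! partner q} \<notin> pairs m xs"
proof -
  show qm: "q < 2 * m" using q by (simp add: valid_def)
  show "k < m" using k by (simp add: bad_def)
  have n: "q \<notin> near m xs (xs ! (2 * k))" "partner q \<notin> near m xs (xs ! (2 * k + 1))"
    using q by (auto simp: valid_def)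
  show "xs ! q \<noteq> xs ! (2 * k)" using n qm by (auto simp: near_def)
  show "xs ! partner q \<noteq> xs ! (2 * k + 1)" using n partner_less[OF qm] by (auto simp: near_def)
  show "{xs ! (2 * k), xs ! q} \<notin> pairs m xs"
    using n(1) pair_in_near[OF _ _ qm refl] by (fastforce simp: pairs_def)
  show "{xs ! (2 * k + 1), xs ! partner q} \<notin> pairs m xs"
    using n(2) pair_in_near[OF _ _ partner_less[OF qm] refl] by (fastforce simp: pairs_def)
qed

lemma q_neq: "q \<noteq> 2 * k" "q \<noteq> 2 * k + 1" "partner q \<noteq> 2 * k" "partner q \<noteq> 2 * k + 1" "q div 2 \<noteq> k"
proof -
  have qn: "q \<notin> near m xs (xs ! (2 * k))" using q by (simp add: valid_def)
  show 1: "q \<noteq> 2 * k" using q_facts by auto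
  have "2 * k < 2 * m" using q_facts by simp
  hence "2 * k + 1 \<in> near m xs (xs ! (2 * k))"
    unfolding near_def using q_facts(2) by (auto intro!: exI[of _ "2 * k"])
  thus 2: "q \<noteq> 2 * k + 1" using qn by auto
  show "partner q \<noteq> 2 * k" using 2 by (metis partner_even(1) partner_partner)
  show "partner q \<noteq> 2 * k + 1" using 1 by (metis partner_even(2) partner_partner)
  show "q div 2 \<noteq> k" using 1 2 by auto
qed

lemma switch_nth:
  assumes "i < 2 * m"
  shows "switch k q xs ! i = (if i = 2 * k + 1 then xs ! q else if i = q then xs ! (2 * k + 1) else xs ! i)"
proof -
  have "Transposition.transpose (2 * k + 1) q permutes {..<length xs}"
    using q_facts(1,2) len by (intro permutes_swap_id) auto
  thus ?thesis using assms len
    by (auto simp: switch_def permute_list_nth Transposition.transpose_def)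
qed

lemma pair_switch:
  assumes "j < m" "j \<noteq> k" "j \<noteq> q div 2"
  shows "pair (switch k q xs) j = pair xs j" "switch k q xs ! (2 * j) = xs ! (2 * j)"
    "switch k q xs ! (2 * j + 1) = xs ! (2 * j + 1)"
proof -
  have "2 * j \<noteq> 2 * k + 1" by presburger
  thus "switch k q xs ! (2 * j) = xs ! (2 * j)" "switch k q xs ! (2 * j + 1) = xs ! (2 * j + 1)"
    using assms by (subst switch_nth; auto)+
  thus "pair (switch k q xs) j = pair xs j" by (simp add: pair_def)
qed

text \<open>The switching dissolves two pairs. The one at \<open>k\<close> is a loop or has an
  earlier copy, so only the one containing \<open>q\<close> can be lost.\<close>

lemma pairs_not_removed: "pairs m xs - {pair xs (q div 2)} \<subseteq> pairs m (switch k q xs)"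
proof
  fix e assume e: "e \<in> pairs m xs - {pair xs (q div 2)}"
  then obtain j where j: "j < m" "xs ! (2 * j) \<noteq> xs ! (2 * j + 1)" "e = pair xs j" by (auto simp: pairs_def)
  have "\<exists>i<m. i \<noteq> k \<and> pair xs i = e"
  proof (cases "j = k")
    case True
    then obtain i where "i < k" "pair xs i = pair xs k" using k j by (auto simp: bad_def)
    thus ?thesis using True j q_facts(2) by (intro exI[of _ i]) auto
  qed (use j in auto)
  then obtain i where i: "i < m" "i \<noteq> k" "pair xs i = e" by blast
  have "i \<noteq> q div 2" using i e by auto
  note p = pair_switch[OF i(1,2) this]
  have "xs ! (2 * i) \<noteq> xs ! (2 * i + 1)" using i(3) j by (auto simp: pair_def doubleton_eq_iff)
  thus "e \<in> pairs m (switch k q xs)" unfolding pairs_def using i p by (intro image_eqI[of _ _ i]) auto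
qed

lemma new_pairs: "{xs ! (2 * k), xs ! q} \<in> pairs m (switch k q xs)"
   "{xs ! (2 * k + 1), xs ! partner q} \<in> pairs m (switch k q xs)"
proof -
  have "switch k q xs ! (2 * k) = xs ! (2 * k)" "switch k q xs ! (2 * k + 1) = xs ! q"
    using q_facts q_neq by (subst switch_nth; auto)+
  thus "{xs ! (2 * k), xs ! q} \<in> pairs m (switch k q xs)"
    unfolding pairs_def using q_facts by (intro image_eqI[of _ _ k]) (auto simp: pair_def)
  have s: "switch k q xs ! q = xs ! (2 * k + 1)" using q_neq q_facts by (subst switch_nth) auto
  have pq: "partner q \<noteq> q" by (auto simp: partner_def elim!: oddE)
  have s': "switch k q xs ! partner q = xs ! partner q"
    using q_neq pq partner_less[OF q_facts(1)] by (subst switch_nth) auto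
  have e: "pair (switch k q xs) (q div 2) = {xs ! (2 * k + 1), xs ! partner q}"
    unfolding pair_div_2 s s' ..
  hence "switch k q xs ! (2 * (q div 2)) \<noteq> switch k q xs ! (2 * (q div 2) + 1)"
    using q_facts(4) by (auto simp: pair_def doubleton_eq_iff)
  thus "{xs ! (2 * k + 1), xs ! partner q} \<in> pairs m (switch k q xs)"
    unfolding pairs_def e[symmetric] using q_facts(1) by (intro imageI) auto
qed

lemma pair_k_neq: "pair xs (q div 2) \<noteq> pair xs k"
proof
  assume "pair xs (q div 2) = pair xs k"
  hence "{xs ! q, xs ! partner q} = {xs ! (2 * k), xs ! (2 * k + 1)}" unfolding pair_div_2 by (simp add: pair_def)
  hence "xs ! q = xs ! (2 * k + 1)" using q_facts(3) by (auto simp: doubleton_eq_iff)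
  hence "{xs ! (2 * k), xs ! q} = pair xs k" "xs ! (2 * k) \<noteq> xs ! (2 * k + 1)"
    using q_facts(3) by (auto simp: pair_def)
  thus False using q_facts(2,5) by (auto simp: pairs_def)
qed

text \<open>Two edges appear and at most one is lost. If the two new edges coincide, then the pair
  containing \<open>q\<close> was a loop, because it cannot equal the pair at \<open>k\<close>; in
  that case one edge appears and none is lost.\<close>

lemma defect_switch: "defect m (switch k q xs) + 1 \<le> defect m xs"
proof -
  let ?N1 = "{xs ! (2 * k), xs ! q}" and ?N2 = "{xs ! (2 * k + 1), xs ! partner q}"
  let ?R = "pairs m xs - {pair xs (q div 2)}"
  have sub: "?R \<union> {?N1, ?N2} \<subseteq> pairs m (switch k q xs)" using pairs_not_removed new_pairs by auto
  have disj: "?R \<inter> {?N1, ?N2} = {}" using q_facts(5,6) by auto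
  have "card ?R + card {?N1, ?N2} = card (?R \<union> {?N1, ?N2})"
    by (rule card_Un_disjoint[symmetric]) (use disj in auto)
  also have "\<dots> \<le> card (pairs m (switch k q xs))" by (intro card_mono sub) simp
  finally have c: "card ?R + card {?N1, ?N2} \<le> card (pairs m (switch k q xs))" .
  have "card (pairs m xs) + 1 \<le> card ?R + card {?N1, ?N2}"
  proof (cases "?N1 = ?N2")
    case False
    have "card (pairs m xs) - card {pair xs (q div 2)} \<le> card ?R" by (rule diff_card_le_card_Diff) simp
    thus ?thesis using False by simp
  next
    case True
    have "xs ! q = xs ! partner q"
    proof (rule ccontr)
      assume "xs ! q \<noteq> xs ! partner q"
      hence *: "xs ! (2 * k) = xs ! partner q" "xs ! q = xs ! (2 * k + 1)"
        using True by (auto simp: doubleton_eq_iff)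
      hence "pair xs (q div 2) = pair xs k" unfolding pair_div_2 by (auto simp: pair_def)
      thus False using pair_k_neq by simp
    qed
    hence "pair xs (q div 2) = {xs ! q}" unfolding pair_div_2 by simp
    moreover have "{xs ! q} \<notin> pairs m xs" by (auto simp: pairs_def pair_def)
    ultimately have "?R = pairs m xs" by simp
    thus ?thesis using True by simp
  qed
  thus ?thesis using c card_pairs_le[of m "switch k q xs"] unfolding defect_def by linarith
qed

text \<open>This limits the reverse switchings. Position \<open>q\<close> now holds the old
  \<open>xs ! (2 * k + 1)\<close>, which equals \<open>xs ! (2 * k)\<close> if the bad pair was a
  loop and otherwise is still joined to it by the earlier copy. So given the result and
  \<open>k\<close> there are at most \<open>D + D * D\<close> choices of \<open>q\<close>.\<close>

lemma in_near_switch: "q \<in> near m (switch k q xs) (switch k q xs ! (2 * k))"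
proof -
  have s: "switch k q xs ! (2 * k) = xs ! (2 * k)" "switch k q xs ! q = xs ! (2 * k + 1)"
    using q_neq q_facts by (subst switch_nth; auto)+
  show ?thesis
  proof (cases "xs ! (2 * k) = xs ! (2 * k + 1)")
    case True
    thus ?thesis using s q_facts(1) by (auto simp: near_def)
  next
    case False
    then obtain j where j: "j < k" "pair xs j = pair xs k" using k by (auto simp: bad_def)
    have "j \<noteq> q div 2" using pair_k_neq j by auto
    hence "pair (switch k q xs) j = {xs ! (2 * k), xs ! (2 * k + 1)}"
      using pair_switch(1)[of j] j q_facts(2) by (simp add: pair_def)
    from pair_in_near[OF _ this q_facts(1) s(2)] show ?thesis using j q_facts(2) s by simp
  qed
qed

lemma mset_switch: "mset (switch k q xs) = mset xs"
proof -
  have "Transposition.transpose (2 * k + 1) q permutes {..<length xs}"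
    using q_facts(1,2) len by (intro permutes_swap_id) auto
  thus ?thesis by (simp add: switch_def)
qed

lemma switch_switch: "switch k q (switch k q xs) = xs"
proof -
  have p: "Transposition.transpose (2 * k + 1) q permutes {..<length xs}"
    using q_facts(1,2) len by (intro permutes_swap_id) auto
  have "permute_list (Transposition.transpose (2 * k + 1) q) (permute_list (Transposition.transpose (2 * k + 1) q) xs)
    = permute_list (Transposition.transpose (2 * k + 1) q \<circ> Transposition.transpose (2 * k + 1) q) xs"
    by (rule permute_list_compose[OF p, symmetric])
  thus ?thesis by (simp add: switch_def)
qed

end

lemma card_positions:
  assumes "mset xs = M" "length xs = N"
  shows "card {i. i < N \<and> xs ! i = v} = count M v"
proof -
  have "count (mset xs) v = length (filter (\<lambda>x. x = v) xs)" by (induction xs) auto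
  thus ?thesis using assms by (simp add: length_filter_conv_card conj_commute)
qed

lemma card_near_le:
  assumes xs: "mset xs = M" "length xs = 2 * m" and D: "\<And>v. count M v \<le> D"
  shows "card (near m xs a) \<le> D + D * D"
proof -
  let ?pos = "\<lambda>v. {i. i < 2 * m \<and> xs ! i = v}"
  have c: "card (?pos v) \<le> D" for v using card_positions[OF xs] D by simp
  have "near m xs a \<subseteq> ?pos a \<union> (\<Union>r\<in>?pos a. ?pos (xs ! partner r))" by (auto simp: near_def)
  hence "card (near m xs a) \<le> card (?pos a \<union> (\<Union>r\<in>?pos a. ?pos (xs ! partner r)))"
    by (rule card_mono[rotated]) auto
  also have "\<dots> \<le> card (?pos a) + card (\<Union>r\<in>?pos a. ?pos (xs ! partner r))" by (rule card_Un_le)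
  also have "card (\<Union>r\<in>?pos a. ?pos (xs ! partner r)) \<le> (\<Sum>r\<in>?pos a. card (?pos (xs ! partner r)))"
    by (rule card_UN_le) simp
  also have "\<dots> \<le> card (?pos a) * D" using sum_bounded_above[of "?pos a" "\<lambda>r. card (?pos (xs ! partner r))" D] c by simp
  also have "\<dots> \<le> D * D" using c by (intro mult_right_mono) auto
  finally show ?thesis using c[of a] by linarith
qed

lemma card_valid_ge:
  assumes xs: "mset xs = M" "length xs = 2 * m" and D: "\<And>v. count M v \<le> D" and m: "2 * (D + D * D) \<le> m"
  shows "m \<le> card (valid m xs k)"
proof -
  let ?A = "near m xs (xs ! (2 * k))" and ?B = "near m xs (xs ! (2 * k + 1))"
  have "{..<2 * m} - ?A - partner ` ?B \<subseteq> valid m xs k"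
    by (auto simp: valid_def image_iff) (metis partner_partner)
  hence "card ({..<2 * m} - ?A - partner ` ?B) \<le> card (valid m xs k)" by (intro card_mono) auto
  moreover have "card {..<2 * m} - card ?A - card (partner ` ?B) \<le> card ({..<2 * m} - ?A - partner ` ?B)"
    by (rule order_trans[OF diff_le_mono[OF diff_card_le_card_Diff] diff_card_le_card_Diff]) auto
  moreover have "card (partner ` ?B) \<le> card ?B" by (rule card_image_le) simp
  ultimately show ?thesis
    using card_near_le[OF xs D, of "xs ! (2 * k)"] card_near_le[OF xs D, of "xs ! (2 * k + 1)"] m
    by simp
qed

text \<open>Summing over all switchings shows that the generating function \<open>F z = (\<Sum>xs. z ^ defect xs)\<close>
  satisfies \<open>F' \<le> (D + D * D) * F\<close> on \<open>[0, 1]\<close>, up to the factor \<open>m\<close> on both sides.\<close>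

lemma defect_derivative_le:
  fixes z :: real
  assumes M: "size M = 2 * m" and D: "\<And>v. count M v \<le> D" and m: "2 * (D + D * D) \<le> m" and z: "0 \<le> z" "z \<le> 1"
  shows "real m * (\<Sum>xs\<in>permutations_of_multiset M. real (defect m xs) * z ^ (defect m xs - 1))
    \<le> real m * (real (D + D * D) * (\<Sum>xs\<in>permutations_of_multiset M. z ^ defect m xs))"
proof -
  let ?W = "permutations_of_multiset M"
  have W: "mset xs = M" "length xs = 2 * m" if "xs \<in> ?W" for xs
    using that M by (auto simp: permutations_of_multiset_def)
  \<comment> \<open>Double counting of switchings. Forwards a word has at least
    \<open>defect\<close> bad pairs with at least \<open>m\<close> valid positions each; backwards
    there are \<open>m\<close> indices with at most \<open>D + D * D\<close> positions each. For
    fixed \<open>k\<close> and \<open>q\<close> a switching undoes itself, so \<open>sw\<close> is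
    injective.\<close>
  define T where "T = (SIGMA xs:?W. SIGMA k:bad m xs. valid m xs k)"
  define R where "R = (SIGMA ys:?W. SIGMA k:{..<m}. near m ys (ys ! (2 * k)))"
  have finT: "finite T" "finite R" by (auto simp: T_def R_def)
  define sw where "sw = (\<lambda>(xs, k, q). (switch k q xs, k, q))"
  have swT: "sw ` T \<subseteq> R"
  proof
    fix t assume "t \<in> sw ` T"
    then obtain xs k q where t: "t = (switch k q xs, k, q)" "xs \<in> ?W" "k \<in> bad m xs" "q \<in> valid m xs k"
      by (auto simp: sw_def T_def)
    note len = W(2)[OF t(2)]
    have "switch k q xs \<in> ?W" using mset_switch[OF len t(3,4)] W(1)[OF t(2)] by (simp add: permutations_of_multiset_def)
    moreover have "k < m" using t(3) by (simp add: bad_def)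
    ultimately show "t \<in> R" using in_near_switch[OF len t(3,4)] t(1) by (simp add: R_def)
  qed
  have inj: "inj_on sw T"
  proof (rule inj_onI)
    fix s t assume st: "s \<in> T" "t \<in> T" "sw s = sw t"
    obtain xs k q where s: "s = (xs, k, q)" by (cases s)
    obtain ys k' q' where t: "t = (ys, k', q')" by (cases t)
    have e: "s = (xs, k, q)" "t = (ys, k, q)" "switch k q xs = switch k q ys" using st(3) s t by (auto simp: sw_def)
    have h: "xs \<in> ?W" "k \<in> bad m xs" "q \<in> valid m xs k" "ys \<in> ?W" "k \<in> bad m ys" "q \<in> valid m ys k"
      using st e by (auto simp: T_def)
    have "xs = switch k q (switch k q xs)" by (rule switch_switch[OF W(2)[OF h(1)] h(2,3), symmetric])
    also have "\<dots> = switch k q (switch k q ys)" by (simp only: e(3))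
    also have "\<dots> = ys" by (rule switch_switch[OF W(2)[OF h(4)] h(5,6)])
    finally show "s = t" using e by simp
  qed
  have "real m * (\<Sum>xs\<in>?W. real (defect m xs) * z ^ (defect m xs - 1))
     \<le> (\<Sum>xs\<in>?W. \<Sum>k\<in>bad m xs. \<Sum>q\<in>valid m xs k. z ^ (defect m xs - 1))"
    unfolding sum_distrib_left
  proof (rule sum_mono)
    fix xs assume xs: "xs \<in> ?W"
    have "real m * (real (defect m xs) * z ^ (defect m xs - 1)) = real (defect m xs) * (real m * z ^ (defect m xs - 1))" by simp
    also have "\<dots> \<le> real (card (bad m xs)) * (real m * z ^ (defect m xs - 1))"
      using defect_le_card_bad z by (intro mult_right_mono) auto
    also have "\<dots> = (\<Sum>k\<in>bad m xs. real m * z ^ (defect m xs - 1))" by simp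
    also have "\<dots> \<le> (\<Sum>k\<in>bad m xs. real (card (valid m xs k)) * z ^ (defect m xs - 1))"
      using card_valid_ge[OF W[OF xs] D m] z by (intro sum_mono mult_right_mono) auto
    finally show "real m * (real (defect m xs) * z ^ (defect m xs - 1))
      \<le> (\<Sum>k\<in>bad m xs. \<Sum>q\<in>valid m xs k. z ^ (defect m xs - 1))" by simp
  qed
  also have "\<dots> = (\<Sum>xs\<in>?W. \<Sum>(k, q)\<in>(SIGMA k:bad m xs. valid m xs k). z ^ (defect m xs - 1))"
    by (intro sum.cong refl sum.Sigma) auto
  also have "\<dots> = (\<Sum>(xs, k, q)\<in>T. z ^ (defect m xs - 1))"
    unfolding T_def by (rule sum.Sigma) auto
  also have "\<dots> \<le> (\<Sum>t\<in>T. z ^ defect m (fst (sw t)))"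
  proof (rule sum_mono)
    fix t assume "t \<in> T"
    then obtain xs k q where t: "t = (xs, k, q)" "xs \<in> ?W" "k \<in> bad m xs" "q \<in> valid m xs k"
      by (auto simp: T_def)
    have "defect m (switch k q xs) \<le> defect m xs - 1"
      using defect_switch[OF W(2)[OF t(2)] t(3,4)] by simp
    hence "z ^ (defect m xs - 1) \<le> z ^ defect m (switch k q xs)" using z by (rule power_decreasing)
    thus "(case t of (xs, k, q) \<Rightarrow> z ^ (defect m xs - 1)) \<le> z ^ defect m (fst (sw t))"
      by (simp add: t sw_def)
  qed
  also have "\<dots> = (\<Sum>r\<in>sw ` T. z ^ defect m (fst r))" by (simp add: sum.reindex[OF inj])
  also have "\<dots> \<le> (\<Sum>r\<in>R. z ^ defect m (fst r))" using z by (intro sum_mono2 finT swT) auto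
  also have "\<dots> = (\<Sum>ys\<in>?W. \<Sum>k<m. real (card (near m ys (ys ! (2 * k)))) * z ^ defect m ys)"
  proof -
    have "(\<Sum>ys\<in>?W. \<Sum>k<m. real (card (near m ys (ys ! (2 * k)))) * z ^ defect m ys)
       = (\<Sum>ys\<in>?W. \<Sum>k<m. \<Sum>q\<in>near m ys (ys ! (2 * k)). z ^ defect m ys)" by simp
    also have "\<dots> = (\<Sum>ys\<in>?W. \<Sum>(k, q)\<in>(SIGMA k:{..<m}. near m ys (ys ! (2 * k))). z ^ defect m ys)"
      by (intro sum.cong refl sum.Sigma) auto
    also have "\<dots> = (\<Sum>(ys, k, q)\<in>R. z ^ defect m ys)"
      unfolding R_def by (rule sum.Sigma) auto
    also have "\<dots> = (\<Sum>r\<in>R. z ^ defect m (fst r))" by (intro sum.cong) auto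
    finally show ?thesis by simp
  qed
  also have "\<dots> \<le> (\<Sum>ys\<in>?W. \<Sum>k<m. real (D + D * D) * z ^ defect m ys)"
    using card_near_le[OF W D] z by (intro sum_mono mult_right_mono) (auto simp del: of_nat_add of_nat_mult)
  also have "\<dots> = real m * (real (D + D * D) * (\<Sum>ys\<in>?W. z ^ defect m ys))"
    by (simp add: sum_distrib_left)
  finally show ?thesis .
qed

text \<open>Gronwall's argument: \<open>F z * exp (- c z)\<close> is nonincreasing on [0, 1]. Its
  ends are what is compared, since \<open>F 1\<close> counts all words and \<open>F 0\<close>,
  because of \<open>0 ^ 0 = 1\<close>, those of defect 0.\<close>

lemma card_words_le:
  assumes M: "size M = 2 * m" and D: "\<And>v. count M v \<le> D" and m: "2 * (D + D * D) \<le> m" "m > 0"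
  shows "real (card (permutations_of_multiset M))
    \<le> exp (real (D + D * D)) * real (card {xs \<in> permutations_of_multiset M. defect m xs = 0})"
proof -
  let ?W = "permutations_of_multiset M" and ?c = "real (D + D * D)"
  define F where "F = (\<lambda>z::real. \<Sum>xs\<in>?W. z ^ defect m xs)"
  define F' where "F' = (\<lambda>z::real. \<Sum>xs\<in>?W. real (defect m xs) * z ^ (defect m xs - 1))"
  have dF: "(F has_real_derivative F' z) (at z)" for z
    unfolding F_def F'_def by (auto intro!: derivative_eq_intros sum.cong)
  have le: "F' z \<le> ?c * F z" if "0 \<le> z" "z \<le> 1" for z
    using defect_derivative_le[OF M D m(1) that] m(2) unfolding F_def F'_def by (simp only: mult_le_cancel_left_pos of_nat_0_less_iff)
  have "F 1 * exp (- ?c * 1) \<le> F 0 * exp (- ?c * 0)"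
  proof (rule DERIV_nonpos_imp_nonincreasing[of 0 1])
    fix z :: real assume z: "0 \<le> z" "z \<le> 1"
    have "((\<lambda>z. F z * exp (- ?c * z)) has_real_derivative (F' z * exp (- ?c * z) + F z * (exp (- ?c * z) * (- ?c)))) (at z)"
      by (rule derivative_eq_intros dF | simp)+
    moreover have "F' z * exp (- ?c * z) + F z * (exp (- ?c * z) * (- ?c)) = (F' z - ?c * F z) * exp (- ?c * z)"
      by (simp only: left_diff_distrib) (simp add: algebra_simps)
    moreover have "\<dots> \<le> 0" using le[OF z] by (intro mult_nonpos_nonneg) auto
    ultimately show "\<exists>y. ((\<lambda>z. F z * exp (- ?c * z)) has_real_derivative y) (at z) \<and> y \<le> 0" by metis
  qed simp
  hence "F 1 * exp (- ?c) \<le> F 0" by simp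
  hence "exp ?c * (F 1 * exp (- ?c)) \<le> exp ?c * F 0" by (intro mult_left_mono) auto
  hence "F 1 \<le> exp ?c * F 0" by (simp add: mult.left_commute exp_add[symmetric] del: of_nat_add of_nat_mult)
  moreover have "F 0 = real (card {xs \<in> ?W. defect m xs = 0})"
    by (simp add: F_def power_0_left sum.If_cases Int_def)
  moreover have "F 1 = real (card ?W)" by (simp add: F_def)
  ultimately show ?thesis by simp
qed

section \<open>From words to graphs and to Eulerian orientations\<close>

definition degree_mset :: "nat \<Rightarrow> (nat \<Rightarrow> nat) \<Rightarrow> nat multiset" where
  "degree_mset n d = (\<Sum>i\<in>{1..n}. replicate_mset (d i) i)"

lemma count_degree_mset: "count (degree_mset n d) v = (if v \<in> {1..n} then d v else 0)"
  by (simp add: degree_mset_def count_sum sum.delta)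

lemma size_degree_mset: "size (degree_mset n d) = (\<Sum>i\<in>{1..n}. d i)"
  by (simp add: degree_mset_def size_multiset_sum)

lemma card_words:
  "card (permutations_of_multiset (degree_mset n d)) * (\<Prod>i\<in>{1..n}. fact (d i)) = fact (\<Sum>i\<in>{1..n}. d i)"
proof -
  have "(\<Prod>i\<in>{1..n}. fact (d i) :: nat) = (\<Prod>i\<in>{1..n}. fact (count (degree_mset n d) i))"
    by (intro prod.cong) (auto simp: count_degree_mset)
  also have "\<dots> = (\<Prod>i\<in>set_mset (degree_mset n d). fact (count (degree_mset n d) i))"
    by (rule prod.mono_neutral_right) (auto simp: set_mset_def count_degree_mset split: if_splits intro!: gr0I)
  finally show ?thesis using card_permutations_of_multiset_aux[of "degree_mset n d"] by (simp add: size_degree_mset)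
qed

lemma defect_0D:
  assumes "defect m xs = 0"
  shows "\<And>k. k < m \<Longrightarrow> xs ! (2 * k) \<noteq> xs ! (2 * k + 1)" "inj_on (pair xs) {..<m}"
    "pairs m xs = pair xs ` {..<m}" "card (pairs m xs) = m"
proof -
  let ?N = "{k. k < m \<and> xs ! (2 * k) \<noteq> xs ! (2 * k + 1)}"
  show c: "card (pairs m xs) = m" using assms card_pairs_le[of m xs] by (simp add: defect_def)
  have "m \<le> card ?N" using c card_image_le[of ?N "pair xs"] by (simp add: pairs_def)
  hence N: "?N = {..<m}" by (intro card_seteq) auto
  thus "\<And>k. k < m \<Longrightarrow> xs ! (2 * k) \<noteq> xs ! (2 * k + 1)" by blast
  show p: "pairs m xs = pair xs ` {..<m}" unfolding pairs_def N ..
  show "inj_on (pair xs) {..<m}" using c unfolding p by (intro eq_card_imp_inj_on) auto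
qed

lemma pairs_in_graphs_with_degrees:
  assumes xs: "xs \<in> permutations_of_multiset (degree_mset n d)" and m: "(\<Sum>i\<in>{1..n}. d i) = 2 * m"
    and "defect m xs = 0"
  shows "pairs m xs \<in> graphs_with_degrees n d"
proof -
  note D = defect_0D[OF assms(3)]
  have ms: "mset xs = degree_mset n d" and len: "length xs = 2 * m"
    using xs m by (auto simp: permutations_of_multiset_def size_degree_mset simp flip: size_mset)
  have set: "set xs \<subseteq> {1..n}"
  proof
    fix v assume "v \<in> set xs"
    hence "count (mset xs) v \<noteq> 0" by simp
    thus "v \<in> {1..n}" unfolding ms by (simp add: count_degree_mset split: if_splits)
  qed
  have "pair xs k \<in> nsets {1..n} 2" if k: "k < m" for k
  proof -
    have "xs ! (2 * k) \<in> set xs" "xs ! (2 * k + 1) \<in> set xs" using k len by auto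
    thus ?thesis using D(1)[OF k] set by (auto simp: nsets_def pair_def)
  qed
  moreover have "deg (pairs m xs) v = d v" if v: "v \<in> {1..n}" for v
  proof -
    have "deg (pairs m xs) v = card (pair xs ` {k. k < m \<and> v \<in> pair xs k})"
      unfolding deg_def D(3) by (rule arg_cong[of _ _ card]) auto
    also have "\<dots> = card {k. k < m \<and> v \<in> pair xs k}"
      by (rule card_image) (rule inj_on_subset[OF D(2)], auto)
    also have "{k. k < m \<and> v \<in> pair xs k} = (\<lambda>i. i div 2) ` {i. i < 2 * m \<and> xs ! i = v}"
    proof (intro equalityI subsetI)
      fix k assume "k \<in> {k. k < m \<and> v \<in> pair xs k}"
      hence "k < m" "v = xs ! (2 * k) \<or> v = xs ! (2 * k + 1)" by (auto simp: pair_def)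
      thus "k \<in> (\<lambda>i. i div 2) ` {i. i < 2 * m \<and> xs ! i = v}"
        by (auto intro: image_eqI[of _ _ "2 * k"] image_eqI[of _ _ "2 * k + 1"])
    next
      fix k assume "k \<in> (\<lambda>i. i div 2) ` {i. i < 2 * m \<and> xs ! i = v}"
      thus "k \<in> {k. k < m \<and> v \<in> pair xs k}" by (auto simp: pair_div_2)
    qed
    also have "card \<dots> = card {i. i < 2 * m \<and> xs ! i = v}"
    proof (rule card_image, rule inj_onI)
      fix i j assume ij: "i \<in> {i. i < 2 * m \<and> xs ! i = v}" "j \<in> {i. i < 2 * m \<and> xs ! i = v}" "i div 2 = j div 2"
      have "i = j \<or> i = partner j" using ij(3) by (auto simp: partner_def) presburger+
      moreover have "i \<noteq> partner j"
      proof
        assume "i = partner j"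
        hence "pair xs (j div 2) = {v}" using ij(1,2) by (simp add: pair_div_2)
        moreover have "xs ! (2 * (j div 2)) \<noteq> xs ! (2 * (j div 2) + 1)" using ij(2) by (intro D(1)) auto
        ultimately show False by (auto simp: pair_def doubleton_eq_iff)
      qed
      ultimately show "i = j" by blast
    qed
    also have "\<dots> = d v" using card_positions[OF ms len] v by (simp add: count_degree_mset)
    finally show ?thesis .
  qed
  ultimately show ?thesis by (auto simp: graphs_with_degrees_def D(3))
qed

lemma finite_graphs_with_degrees [simp]: "finite (graphs_with_degrees n d)"
  by (rule finite_subset[of _ "Pow (nsets {1..n} 2)"]) (auto simp: graphs_with_degrees_def finite_imp_finite_nsets)

lemma finite_graph: "E \<in> graphs_with_degrees n d \<Longrightarrow> finite E"
  by (metis (no_types, lifting) finite_atLeastAtMost finite_imp_finite_nsets finite_subset graphs_with_degrees_def mem_Collect_eq)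

lemma card_graph:
  assumes "E \<in> graphs_with_degrees n d" "(\<Sum>i\<in>{1..n}. d i) = 2 * m"
  shows "card E = m"
proof -
  have "E \<subseteq> nsets {1..n} 2" "\<And>i. i \<in> {1..n} \<Longrightarrow> deg E i = d i"
    using assms(1) by (auto simp: graphs_with_degrees_def)
  thus ?thesis using sum_card_edges_at[of "{1..n}" E] assms(2) by (simp add: deg_def edges_at_def)
qed

text \<open>A word of defect 0 is recovered from its graph, the order in which the edges are listed,
  and one bit per edge telling whether the smaller end is written first.\<close>

lemma card_simple_words_le:
  assumes m: "(\<Sum>i\<in>{1..n}. d i) = 2 * m"
  shows "card {xs \<in> permutations_of_multiset (degree_mset n d). defect m xs = 0}
    \<le> card (graphs_with_degrees n d) * (fact m * 2 ^ m)"
proof -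
  let ?W = "{xs \<in> permutations_of_multiset (degree_mset n d). defect m xs = 0}"
  define B where "B = {bs :: bool list. set bs \<subseteq> UNIV \<and> length bs = m}"
  define T where "T = (SIGMA E:graphs_with_degrees n d. permutations_of_set E \<times> B)"
  define f where "f = (\<lambda>xs. (pairs m xs, map (pair xs) [0..<m], map (\<lambda>k. xs ! (2 * k) < xs ! (2 * k + 1)) [0..<m]))"
  have finB: "finite B" "card B = 2 ^ m"
    unfolding B_def by (rule finite_lists_length_eq; simp) (subst card_lists_length_eq; simp)
  have "f ` ?W \<subseteq> T"
  proof
    fix t assume "t \<in> f ` ?W"
    then obtain xs where xs: "xs \<in> permutations_of_multiset (degree_mset n d)" "defect m xs = 0" "t = f xs" by auto
    note D = defect_0D[OF xs(2)]
    have "map (pair xs) [0..<m] \<in> permutations_of_set (pairs m xs)"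
      using D(2,3) by (intro permutations_of_setI) (auto simp: distinct_map atLeast0LessThan)
    thus "t \<in> T" using pairs_in_graphs_with_degrees[OF xs(1) m xs(2)] xs(3) by (simp add: T_def f_def B_def)
  qed
  moreover have "inj_on f ?W"
  proof (rule inj_onI)
    fix xs ys assume h: "xs \<in> ?W" "ys \<in> ?W" "f xs = f ys"
    have len: "length xs = 2 * m" "length ys = 2 * m"
      using h(1,2) m by (auto simp: permutations_of_multiset_def size_degree_mset simp flip: size_mset)
    have eq: "xs ! (2 * k) = ys ! (2 * k) \<and> xs ! (2 * k + 1) = ys ! (2 * k + 1)" if k: "k < m" for k
    proof -
      have "map (pair xs) [0..<m] ! k = map (pair ys) [0..<m] ! k"
         "map (\<lambda>k. xs ! (2 * k) < xs ! (2 * k + 1)) [0..<m] ! k = map (\<lambda>k. ys ! (2 * k) < ys ! (2 * k + 1)) [0..<m] ! k"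
        using h(3) by (simp_all only: f_def prod.inject)
      hence "pair xs k = pair ys k" "(xs ! (2 * k) < xs ! (2 * k + 1)) = (ys ! (2 * k) < ys ! (2 * k + 1))"
        using k by auto
      moreover have "xs ! (2 * k) \<noteq> xs ! (2 * k + 1)" "ys ! (2 * k) \<noteq> ys ! (2 * k + 1)"
        using h(1,2) defect_0D(1) k by blast+
      ultimately show ?thesis by (auto simp: pair_def doubleton_eq_iff)
    qed
    show "xs = ys"
    proof (rule nth_equalityI)
      fix i assume i: "i < length xs"
      show "xs ! i = ys ! i"
      proof (cases "even i")
        case True
        then obtain k where "i = 2 * k" by (elim evenE)
        thus ?thesis using eq[of k] i len by simp
      next
        case False
        then obtain k where "i = 2 * k + 1" by (elim oddE)
        thus ?thesis using eq[of k] i len by simp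
      qed
    qed (simp add: len)
  qed
  moreover have "finite T" using finB by (auto simp: T_def)
  ultimately have "card ?W \<le> card T" by (intro card_inj_on_le[of f])
  also have "card T = (\<Sum>E\<in>graphs_with_degrees n d. card (permutations_of_set E \<times> B))"
    unfolding T_def by (rule card_SigmaI) (use finB in auto)
  also have "\<dots> = (\<Sum>E\<in>graphs_with_degrees n d. fact m * 2 ^ m)"
    by (intro sum.cong refl) (simp add: card_cartesian_product finB finite_graph card_graph[OF _ m])
  finally show ?thesis by simp
qed

lemma eulerian_orientation_degrees:
  assumes E: "E \<subseteq> nsets {1..n} 2" and A: "A \<in> eulerian_orientations n E" and v: "v \<in> {1..n}"
  shows "card {z\<in>A. fst z = v} = deg E v div 2" "card {z\<in>A. snd z = v} = deg E v div 2"
proof -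
  have bij: "bij_betw (\<lambda>(u, v). {u, v}) A E" and bal: "card {u. (u, v) \<in> A} = card {w. (v, w) \<in> A}"
    using A v by (auto simp: eulerian_orientations_def orientations_def)
  have finE: "finite E" using E finite_imp_finite_nsets finite_subset by blast
  have finA: "finite A" using bij finE bij_betw_finite by blast
  have ne: "fst z \<noteq> snd z" if "z \<in> A" for z
  proof -
    have "{fst z, snd z} \<in> E" using bij_betwE[OF bij] that by (auto simp: split_beta)
    hence "card {fst z, snd z} = 2" using E by (auto simp: nsets_def)
    thus ?thesis by (auto simp: card_insert_if split: if_splits)
  qed
  have o: "card {z\<in>A. fst z = v} = card {w. (v, w) \<in> A}"
    by (rule bij_betw_same_card[of snd]) (auto simp: bij_betw_def inj_on_def image_iff)
  have i: "card {z\<in>A. snd z = v} = card {u. (u, v) \<in> A}"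
    by (rule bij_betw_same_card[of fst]) (auto simp: bij_betw_def inj_on_def image_iff)
  have im: "(\<lambda>(u, v). {u, v}) ` {z\<in>A. fst z = v \<or> snd z = v} = {e \<in> E. v \<in> e}"
    using bij by (auto simp: bij_betw_def)
  have "inj_on (\<lambda>(u, v). {u, v}) {z\<in>A. fst z = v \<or> snd z = v}"
    using bij by (auto simp: bij_betw_def intro: inj_on_subset)
  from card_image[OF this] have "deg E v = card {z\<in>A. fst z = v \<or> snd z = v}" unfolding im by (simp add: deg_def)
  also have "{z\<in>A. fst z = v \<or> snd z = v} = {z\<in>A. fst z = v} \<union> {z\<in>A. snd z = v}" by auto
  also have "card \<dots> = card {z\<in>A. fst z = v} + card {z\<in>A. snd z = v}"
    by (rule card_Un_disjoint) (use finA ne[of "(v, v)"] in auto)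
  finally show "card {z\<in>A. fst z = v} = deg E v div 2" "card {z\<in>A. snd z = v} = deg E v div 2"
    using o i bal by auto
qed

text \<open>An Eulerian orientation with its arcs listed in some order is determined by the list of
  tails and the list of heads. Each is a word containing \<open>i\<close> exactly
  \<open>d i div 2\<close> times, and \<open>fact m\<close> counts the orders.\<close>

lemma sum_EO_le:
  assumes m: "(\<Sum>i\<in>{1..n}. d i) = 2 * m" and ev: "\<And>i. i \<in> {1..n} \<Longrightarrow> even (d i)"
  shows "(\<Sum>E\<in>graphs_with_degrees n d. EO n E) * fact m \<le> (card (permutations_of_multiset (degree_mset n (\<lambda>i. d i div 2))))\<^sup>2"
proof -
  let ?P = "permutations_of_multiset (degree_mset n (\<lambda>i. d i div 2))"
  define S where "S = (SIGMA E:graphs_with_degrees n d. SIGMA A:eulerian_orientations n E. permutations_of_set A)"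
  define f where "f = (\<lambda>(E :: nat set set, A :: (nat \<times> nat) set, zs :: (nat \<times> nat) list). (map fst zs, map snd zs))"
  have bijA: "bij_betw (\<lambda>(u, v). {u, v}) A E" if "A \<in> eulerian_orientations n E" for A E
    using that by (simp add: eulerian_orientations_def orientations_def)
  have finA: "finite A" "card A = m" if "E \<in> graphs_with_degrees n d" "A \<in> eulerian_orientations n E" for A E
    using bijA[OF that(2)] finite_graph[OF that(1)] card_graph[OF that(1) m]
    by (auto simp: bij_betw_finite dest: bij_betw_same_card)
  have finEO: "finite (eulerian_orientations n E)" if E: "E \<in> graphs_with_degrees n d" for E
  proof (rule finite_subset)
    show "eulerian_orientations n E \<subseteq> Pow (\<Union>E \<times> \<Union>E)"
      using bijA by (fastforce simp: bij_betw_def)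
    have "finite (\<Union>E)"
      using E by (intro finite_subset[of "\<Union>E" "{1..n}"]) (auto simp: graphs_with_degrees_def nsets_def)
    thus "finite (Pow (\<Union>E \<times> \<Union>E))" by simp
  qed
  have "f ` S \<subseteq> ?P \<times> ?P"
  proof
    fix t assume "t \<in> f ` S"
    then obtain E A zs where h: "E \<in> graphs_with_degrees n d" "A \<in> eulerian_orientations n E"
      "zs \<in> permutations_of_set A" "t = (map fst zs, map snd zs)" by (auto simp: f_def S_def)
    have E: "E \<subseteq> nsets {1..n} 2" "\<And>i. i \<in> {1..n} \<Longrightarrow> deg E i = d i"
      using h(1) by (auto simp: graphs_with_degrees_def)
    have zs: "set zs = A" "distinct zs" using permutations_of_setD[OF h(3)] by auto
    have out: "card {z\<in>A. fst z = v} = (if v \<in> {1..n} then d v div 2 else 0)"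
      "card {z\<in>A. snd z = v} = (if v \<in> {1..n} then d v div 2 else 0)" for v
    proof -
      have "{z\<in>A. fst z = v} = {}" "{z\<in>A. snd z = v} = {}" if "v \<notin> {1..n}"
      proof -
        have "fst z \<in> {1..n}" "snd z \<in> {1..n}" if "z \<in> A" for z
        proof -
          have "{fst z, snd z} \<in> E" using bij_betwE[OF bijA[OF h(2)]] that by (auto simp: split_beta)
          thus "fst z \<in> {1..n}" "snd z \<in> {1..n}" using E(1) by (auto simp: nsets_def)
        qed
        thus "{z\<in>A. fst z = v} = {}" "{z\<in>A. snd z = v} = {}" using that by auto
      qed
      thus "card {z\<in>A. fst z = v} = (if v \<in> {1..n} then d v div 2 else 0)"
        "card {z\<in>A. snd z = v} = (if v \<in> {1..n} then d v div 2 else 0)"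
        using eulerian_orientation_degrees[OF E(1) h(2), of v] E(2)[of v]
        by (cases "v \<in> {1..n}"; simp only: if_True if_False card.empty)+
    qed
    have cnt: "count (mset (map g zs)) v = card {z\<in>A. g z = v}" for g :: "nat \<times> nat \<Rightarrow> nat" and v
    proof -
      have "count (mset (map g zs)) v = length (filter (\<lambda>z. g z = v) zs)" by (induction zs) auto
      also have "\<dots> = card {z\<in>A. g z = v}" using zs by (simp add: distinct_length_filter Int_def conj_commute)
      finally show ?thesis .
    qed
    have "mset (map fst zs) = degree_mset n (\<lambda>i. d i div 2)" "mset (map snd zs) = degree_mset n (\<lambda>i. d i div 2)"
      by (rule multiset_eqI; simp only: cnt out count_degree_mset)+
    thus "t \<in> ?P \<times> ?P" using h(4) by (simp add: permutations_of_multiset_def)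
  qed
  moreover have "inj_on f S"
  proof (rule inj_onI)
    fix s t assume st: "s \<in> S" "t \<in> S" "f s = f t"
    obtain E A zs where s: "s = (E, A, zs)" by (cases s)
    obtain E' A' zs' where t: "t = (E', A', zs')" by (cases t)
    have "map fst zs = map fst zs'" "map snd zs = map snd zs'" using st(3) by (auto simp: f_def s t)
    hence z: "zs = zs'" by (metis zip_map_fst_snd)
    have h: "A \<in> eulerian_orientations n E" "zs \<in> permutations_of_set A" "A' \<in> eulerian_orientations n E'"
      "zs' \<in> permutations_of_set A'" using st(1,2) by (auto simp: S_def s t)
    hence "A = A'" using z permutations_of_setD(1) by metis
    moreover from this have "E = E'" using bijA[OF h(1)] bijA[OF h(3)] by (simp add: bij_betw_def)
    ultimately show "s = t" using s t z by simp
  qed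
  ultimately have "card S \<le> card (?P \<times> ?P)" by (intro card_inj_on_le[of f]) auto
  moreover have "card S = (\<Sum>E\<in>graphs_with_degrees n d. card (SIGMA A:eulerian_orientations n E. permutations_of_set A))"
    unfolding S_def using finEO by (intro card_SigmaI) auto
  moreover have "\<dots> = (\<Sum>E\<in>graphs_with_degrees n d. EO n E * fact m)"
  proof (intro sum.cong refl)
    fix E assume E: "E \<in> graphs_with_degrees n d"
    have "card (SIGMA A:eulerian_orientations n E. permutations_of_set A) = (\<Sum>A\<in>eulerian_orientations n E. card (permutations_of_set A))"
      using finEO[OF E] by (intro card_SigmaI) auto
    also have "\<dots> = (\<Sum>A\<in>eulerian_orientations n E. fact m)"
      using finA[OF E] by (intro sum.cong) auto
    finally show "card (SIGMA A:eulerian_orientations n E. permutations_of_set A) = EO n E * fact m" by (simp add: EO_def)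
  qed
  ultimately show ?thesis by (simp add: card_cartesian_product power2_eq_square sum_distrib_right)
qed

section \<open>The tail bound\<close>

lemma ln_central_binomial_ge:
  assumes "even k"
  shows "real k / 2 * ln 2 \<le> ln (real (k choose (k div 2)))"
proof (cases "k = 0")
  case False
  have "(2::real) ^ (k div 2) = (real k / real (k div 2)) ^ (k div 2)"
    using assms False by (auto elim!: evenE)
  also have "\<dots> \<le> real (k choose (k div 2))" using assms by (intro binomial_ge_n_over_k_pow_k) auto
  finally have "ln (2 ^ (k div 2)) \<le> ln (real (k choose (k div 2)))" by (subst ln_le_cancel_iff) auto
  thus ?thesis using assms by (auto simp: ln_realpow elim!: evenE)
qed simp

text \<open>This settles the value \<open>EO = 0\<close>: there \<open>ln 0 = 0\<close> makes
  \<open>rho\<close> equal to 0, which must not count as exceeding the estimate.\<close>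

lemma rho_hat_nonneg:
  assumes "\<And>i. i \<in> {1..n} \<Longrightarrow> even (deg E i)"
  shows "rho_hat n E \<ge> 0"
  unfolding rho_hat_def
  by (intro mult_nonneg_nonneg sum_nonneg) (use ln_central_binomial_ge[OF assms] in auto)

lemma prob_random_graph:
  assumes "graphical n d"
  shows "measure_pmf.prob (random_graph n d) S = real (card (graphs_with_degrees n d \<inter> S)) / real (card (graphs_with_degrees n d))"
  using assms by (simp add: random_graph_def graphical_def measure_pmf_of_set)

text \<open>Markov's inequality in counting form; \<open>K = n * rho_hat\<close> is the same for all
  graphs with these degrees. After the factorials of the degrees cancel, what remains besides the
  exponentials is \<open>4^m * (m!)^2 / (2 * m)!\<close>, at most \<open>2 * m\<close> by the lower
  bound for the central binomial coefficient.\<close>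

lemma prob_rho_le_counting:
  assumes gr: "graphical n d" and n: "n > 0"
    and ev: "\<And>i. i \<in> {1..n} \<Longrightarrow> even (d i)" and D: "\<And>i. i \<in> {1..n} \<Longrightarrow> d i \<le> D"
    and m: "(\<Sum>i\<in>{1..n}. d i) = 2 * m" "2 * (D + D * D) \<le> m" "m > 0" and eps: "\<epsilon> > 0"
  shows "measure_pmf.prob (random_graph n d) {G. rho n G > rho_hat n G + \<epsilon>}
    \<le> 2 * real m * exp (real (D + D * D) - real n * \<epsilon>)"
proof -
  let ?G = "graphs_with_degrees n d"
  define Bad where "Bad = ?G \<inter> {G. rho n G > rho_hat n G + \<epsilon>}"
  define K where "K = (\<Sum>i\<in>{1..n}. ln (real (d i choose (d i div 2)))) - real m * ln 2"
  define Q :: real where "Q = (\<Prod>i\<in>{1..n}. fact (d i div 2))"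
  define R :: real where "R = (\<Prod>i\<in>{1..n}. fact (d i))"
  define c where "c = real (D + D * D)"
  have pos: "Q > 0" "R > 0" by (auto simp: Q_def R_def intro: prod_pos)
  have deg: "deg E i = d i" if "E \<in> ?G" "i \<in> {1..n}" for E i using that by (auto simp: graphs_with_degrees_def)
  have half: "(\<Sum>i\<in>{1..n}. real (d i) / 2 * ln 2) = real m * ln 2"
  proof -
    have "(\<Sum>i\<in>{1..n}. real (d i)) = 2 * real m" using m(1) by (simp flip: of_nat_sum)
    thus ?thesis by (simp add: sum_distrib_right[symmetric] sum_divide_distrib[symmetric])
  qed
  have rh: "real n * rho_hat n E = K" if "E \<in> ?G" for E
    using n deg[OF that] half by (simp add: rho_hat_def K_def sum_subtractf)
  have expK: "exp K = R / (Q * Q) / 2 ^ m"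
  proof -
    have "real (d i choose (d i div 2)) = fact (d i) / (fact (d i div 2) * fact (d i div 2))" if "i \<in> {1..n}" for i
    proof -
      have "d i - d i div 2 = d i div 2" using ev[OF that] by presburger
      thus ?thesis using binomial_fact[of "d i div 2" "d i", where 'a = real] by simp
    qed
    hence "exp (\<Sum>i\<in>{1..n}. ln (real (d i choose (d i div 2)))) = (\<Prod>i\<in>{1..n}. fact (d i) / (fact (d i div 2) * fact (d i div 2)))"
      by (subst exp_sum) (auto intro!: prod.cong)
    thus ?thesis by (simp add: K_def exp_diff Q_def R_def prod_dividef prod.distrib exp_of_nat_mult)
  qed
  have EO: "exp (K + real n * \<epsilon>) \<le> real (EO n E)" if E: "E \<in> Bad" for E
  proof -
    have EG: "E \<in> ?G" using E by (simp add: Bad_def)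
    have r0: "rho_hat n E \<ge> 0" using ev deg[OF EG] by (intro rho_hat_nonneg) auto
    have "rho n E > rho_hat n E + \<epsilon>" using E by (simp add: Bad_def)
    hence "real n * (rho_hat n E + \<epsilon>) < real n * rho n E" using n by (intro mult_strict_left_mono) auto
    hence l: "K + real n * \<epsilon> < ln (real (EO n E))" using n rh[OF EG] by (simp add: rho_def distrib_left)
    have "0 \<le> K + real n * \<epsilon>" using rh[OF EG] r0 eps by (metis add_nonneg_nonneg less_imp_le mult_nonneg_nonneg of_nat_0_le_iff)
    hence "real (EO n E) > 0" using l by (cases "EO n E = 0") auto
    thus ?thesis using l by (metis exp_le_cancel_iff exp_ln less_imp_le)
  qed
  define S where "S = real (\<Sum>E\<in>?G. EO n E)"
  have 1: "real (card Bad) * exp (K + real n * \<epsilon>) \<le> S"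
  proof -
    have "real (card Bad) * exp (K + real n * \<epsilon>) = (\<Sum>E\<in>Bad. exp (K + real n * \<epsilon>))" by simp
    also have "\<dots> \<le> (\<Sum>E\<in>Bad. real (EO n E))" by (rule sum_mono[OF EO])
    also have "\<dots> \<le> (\<Sum>E\<in>?G. real (EO n E))" by (rule sum_mono2) (auto simp: Bad_def)
    finally show ?thesis by (simp add: S_def)
  qed
  have 2: "S \<le> fact m / (Q * Q)"
  proof -
    let ?P = "real (card (permutations_of_multiset (degree_mset n (\<lambda>i. d i div 2))))"
    have "(\<Sum>i\<in>{1..n}. d i div 2) = m"
    proof -
      have "2 * (\<Sum>i\<in>{1..n}. d i div 2) = (\<Sum>i\<in>{1..n}. d i)"
        unfolding sum_distrib_left using ev by (intro sum.cong) auto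
      thus ?thesis using m(1) by simp
    qed
    hence "real (card (permutations_of_multiset (degree_mset n (\<lambda>i. d i div 2))) * (\<Prod>i\<in>{1..n}. fact (d i div 2))) = real (fact m)"
      using card_words[of n "\<lambda>i. d i div 2"] by simp
    hence "?P * Q = fact m" by (simp add: Q_def)
    hence P: "?P = fact m / Q" using pos by (simp add: field_simps)
    have "real ((\<Sum>E\<in>?G. EO n E) * fact m) \<le> real ((card (permutations_of_multiset (degree_mset n (\<lambda>i. d i div 2))))\<^sup>2)"
      using sum_EO_le[OF m(1) ev] by (simp only: of_nat_le_iff)
    hence "S * fact m \<le> ?P\<^sup>2" by (simp add: S_def)
    also have "\<dots> = fact m / (Q * Q) * fact m" by (simp add: P power2_eq_square)
    finally show ?thesis by (simp only: mult_le_cancel_right_pos fact_gt_zero)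
  qed
  have 3: "fact (2 * m) \<le> exp c * (real (card ?G) * (fact m * 2 ^ m)) * R"
  proof -
    have "real (card (permutations_of_multiset (degree_mset n d)) * (\<Prod>i\<in>{1..n}. fact (d i))) = real (fact (2 * m))"
      using card_words[of n d] m(1) by simp
    hence "fact (2 * m) = real (card (permutations_of_multiset (degree_mset n d))) * R" by (simp add: R_def)
    also have "\<dots> \<le> exp c * real (card {xs \<in> permutations_of_multiset (degree_mset n d). defect m xs = 0}) * R"
      unfolding c_def using pos m D
      by (intro mult_right_mono card_words_le) (auto simp: size_degree_mset count_degree_mset)
    also have "\<dots> \<le> exp c * real (card ?G * (fact m * 2 ^ m)) * R"
      using card_simple_words_le[OF m(1)] pos by (intro mult_right_mono mult_left_mono of_nat_mono) auto
    finally show ?thesis by simp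
  qed
  have 4: "4 ^ m * (fact m * fact m) \<le> 2 * real m * fact (2 * m)"
  proof -
    have "4 ^ m / (2 * real m) \<le> fact (2 * m) / (fact m * fact m)"
      using central_binomial_lower_bound[OF m(3)] binomial_fact[of m "2 * m", where 'a = real] by simp
    thus ?thesis using m(3) by (simp add: field_simps)
  qed
  have "real (card Bad) * exp K * exp (real n * \<epsilon>) \<le> fact m / (Q * Q)"
    using 1 2 by (simp add: exp_add mult.assoc)
  hence "real (card Bad) * (R / (Q * Q) / 2 ^ m) * exp (real n * \<epsilon>) * (Q * Q * 2 ^ m) \<le> fact m / (Q * Q) * (Q * Q * 2 ^ m)"
    unfolding expK using pos by (intro mult_right_mono) auto
  hence 5: "real (card Bad) * exp (real n * \<epsilon>) * R \<le> fact m * 2 ^ m" using pos by (simp add: field_simps)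
  have "real (card Bad) * exp (real n * \<epsilon>) * R * fact (2 * m) \<le> fact m * 2 ^ m * (exp c * (real (card ?G) * (fact m * 2 ^ m)) * R)"
    by (rule mult_mono[OF 5 3]) auto
  also have "\<dots> = (4 ^ m * (fact m * fact m)) * (exp c * real (card ?G) * R)"
    by (simp add: power_mult_distrib[symmetric] mult_ac)
  also have "\<dots> \<le> (2 * real m * fact (2 * m)) * (exp c * real (card ?G) * R)"
    using 4 pos by (intro mult_right_mono) auto
  finally have "real (card Bad) * exp (real n * \<epsilon>) * (R * fact (2 * m)) \<le> 2 * real m * exp c * real (card ?G) * (R * fact (2 * m))"
    by (simp add: mult_ac)
  hence "real (card Bad) * exp (real n * \<epsilon>) \<le> 2 * real m * exp c * real (card ?G)"
    using pos by (simp only: mult_le_cancel_right_pos mult_pos_pos fact_gt_zero)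
  hence "real (card Bad) * exp (real n * \<epsilon>) * exp (- (real n * \<epsilon>)) \<le> 2 * real m * exp c * real (card ?G) * exp (- (real n * \<epsilon>))"
    by (rule mult_right_mono) simp
  hence "real (card Bad) \<le> 2 * real m * exp (c - real n * \<epsilon>) * real (card ?G)"
    by (simp add: mult.assoc exp_add[symmetric]) (simp add: exp_diff exp_minus field_simps)
  moreover have "card ?G > 0" using gr by (auto simp: card_gt_0_iff graphical_def)
  ultimately show ?thesis
    by (simp add: prob_random_graph[OF gr] Bad_def c_def pos_divide_le_eq)
qed

lemma rho_le_deterministic:
  assumes E: "E \<in> graphs_with_degrees n d" and n: "n > 0"
    and ev: "\<And>i. i \<in> {1..n} \<Longrightarrow> d i > 0 \<and> even (d i)"
    and D: "\<And>i. i \<in> {1..n} \<Longrightarrow> \<gamma> * real D \<le> real (d i) \<and> d i \<le> D" "D > 0" and \<gamma>: "\<gamma> > 0"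
    and a: "0 < a" "a \<le> 1"
  shows "rho n E \<le> rho_hat n E + 4 * a + (2 / (a\<^sup>2 * \<gamma>) + 4) * real D powr (-1/4)"
proof -
  define loss where "loss = 4 * a + (2 / (a\<^sup>2 * \<gamma>) + 4) * real D powr (-1/4)"
  \<comment> \<open>The loss contains multiples of \<open>1 / (D * \<theta>)\<close> and of
    \<open>D^2 * \<theta>^3\<close>. Both vanish for any exponent strictly between -1 and -2/3; the
    choice -3/4 gives both the order \<open>D^(-1/4)\<close>.\<close>
  define \<theta> where "\<theta> = real D powr (-3/4)"
  have deg: "deg E i = d i" if "i \<in> {1..n}" for i using that E by (auto simp: graphs_with_degrees_def)
  have th: "0 < \<theta>" "\<theta> \<le> 1" using D(2) powr_mono[of "-3/4" 0 "real D"] by (auto simp: \<theta>_def)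
  have e1: "real D * \<theta> = real D powr (1/4)"
    using D(2) powr_add[of "real D" 1 "-3/4"] by (simp add: \<theta>_def)
  have e2: "(real D)\<^sup>2 * \<theta> ^ 3 = real D powr (-1/4)"
  proof -
    have "\<theta> ^ 3 = real D powr (-9/4)" using D(2) by (simp add: \<theta>_def powr_power)
    moreover have "(real D)\<^sup>2 * real D powr (-9/4) = real D powr (2 + (-9/4))"
      unfolding powr_add using D(2) by simp
    ultimately show ?thesis by simp
  qed
  \<comment> \<open>The rate \<open>\<eta>\<close> of \<open>U\<close> is set equal to the weight
    \<open>a\<close>, so that \<open>2 * \<eta> + 2 * a\<close> becomes
    \<open>4 * a\<close>.\<close>
  have "real (EO n E) \<le> exp (real n * (rho_hat n E + 2 / (a * (\<gamma> * real D) * \<theta> * a) + 2 * a + 2 * a + 4 * (real D)\<^sup>2 * \<theta> ^ 3))"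
  proof (rule EO_le_exp_rho_hat[OF _ n _ th a a])
    show "E \<subseteq> nsets {1..n} 2" using E by (simp add: graphs_with_degrees_def)
    show "2 \<le> deg E v \<and> \<gamma> * real D \<le> real (deg E v) \<and> deg E v \<le> D" if "v \<in> {1..n}" for v
      using ev[OF that] D(1)[OF that] deg[OF that] by (auto elim!: evenE)
  qed (use \<gamma> D(2) in auto)
  also have "2 / (a * (\<gamma> * real D) * \<theta> * a) = 2 / (a\<^sup>2 * \<gamma>) * real D powr (-1/4)"
  proof -
    have "a * (\<gamma> * real D) * \<theta> * a = a\<^sup>2 * \<gamma> * (real D * \<theta>)" by (simp add: power2_eq_square)
    thus ?thesis unfolding e1 using D(2) by (simp add: powr_minus field_simps)
  qed
  also have "rho_hat n E + 2 / (a\<^sup>2 * \<gamma>) * real D powr (-1/4) + 2 * a + 2 * a + 4 * (real D)\<^sup>2 * \<theta> ^ 3 = rho_hat n E + loss"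
    unfolding mult.assoc e2 loss_def by (simp add: algebra_simps)
  finally have le: "real (EO n E) \<le> exp (real n * (rho_hat n E + loss))" .
  have l0: "loss \<ge> 0" using a \<gamma> by (simp add: loss_def)
  have r0: "rho_hat n E \<ge> 0" using ev deg by (intro rho_hat_nonneg) auto
  have "ln (real (EO n E)) \<le> real n * (rho_hat n E + loss)"
  proof (cases "EO n E = 0")
    case True
    thus ?thesis using l0 r0 by simp
  next
    case False
    thus ?thesis using le by (metis exp_gt_zero ln_exp ln_le_cancel_iff of_nat_0_less_iff neq0_conv)
  qed
  thus ?thesis using n by (simp add: rho_def loss_def field_simps)
qed

theorem theorem2p8:
  fixes d :: "nat \<Rightarrow> nat \<Rightarrow> nat" and \<epsilon> :: real
  assumes graphical: "\<forall>\<^sub>F n in sequentially. graphical n (d n)"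
    and pos_even: "\<forall>\<^sub>F n in sequentially. \<forall>i\<in>{1..n}. d n i > 0 \<and> even (d n i)"
    and regime:
      "(\<lambda>n. (real (d_max n (d n)))\<^sup>2) \<in> o(\<lambda>n. real n) \<or>
       ((\<lambda>n. (ln (real n)) ^ 8) \<in> o(\<lambda>n. real (d_max n (d n))) \<and>
        (\<exists>\<gamma>>0. \<forall>\<^sub>F n in sequentially.
           real (d_min n (d n)) \<ge> \<gamma> * real (d_max n (d n))))"
    and eps: "\<epsilon> > 0"
  shows "\<exists>c>0. \<forall>\<^sub>F n in sequentially.
           measure_pmf.prob (random_graph n (d n)) {G. rho n G > rho_hat n G + \<epsilon>}
             \<le> exp (- c * ((real (d_max n (d n)))\<^sup>2 + real n))"
proof -
  let ?D = "\<lambda>n. d_max n (d n)"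
  let ?p = "\<lambda>n. measure_pmf.prob (random_graph n (d n)) {G. rho n G > rho_hat n G + \<epsilon>}"
  \<comment> \<open>The bound 1/4 gives \<open>2 * (D + D^2) \<le> 4 * D^2 \<le> n \<le> m\<close>,
    as the switchings require; the bound \<open>\<epsilon> / 16\<close> keeps the loss
    \<open>D + D^2 \<le> 2 * \<delta> * n\<close> below \<open>\<epsilon> * n / 8\<close>.\<close>
  define \<delta> where "\<delta> = min (1/4) (\<epsilon> / 16)"
  have \<delta>: "\<delta> > 0" "\<delta> \<le> 1/4" "\<delta> \<le> \<epsilon> / 16" using eps by (auto simp: \<delta>_def)
  have dD: "d n i \<le> ?D n" if "i \<in> {1..n}" for n i using that by (auto simp: d_max_def)
  have dm: "d_min n (d n) \<le> d n i" if "i \<in> {1..n}" for n i using that by (auto simp: d_min_def)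
  have "\<forall>\<^sub>F n::nat in sequentially. (real n)\<^sup>2 \<le> exp (\<epsilon> / 4 * real n)" using eps by real_asymp
  \<comment> \<open>The split is made for each \<open>n\<close> separately, since in the second
    regime \<open>D^2\<close> may lie on either side of \<open>\<delta> * n\<close>. The polynomial
    factor \<open>2 * m \<le> n * D \<le> n^2\<close> is absorbed by
    \<open>exp (\<epsilon> / 4 * n)\<close>.\<close>
  hence sparse: "\<forall>\<^sub>F n in sequentially. (real (?D n))\<^sup>2 \<le> \<delta> * real n \<longrightarrow> ?p n \<le> exp (- (\<epsilon> / 4) * ((real (?D n))\<^sup>2 + real n))"
    using graphical pos_even eventually_gt_at_top[of 0]
  proof eventually_elim
    case (elim n)
    show ?case
    proof
      assume Dn: "(real (?D n))\<^sup>2 \<le> \<delta> * real n"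
      have ev: "d n i \<ge> 2" "even (d n i)" if "i \<in> {1..n}" for i using elim(3) that by (fastforce elim!: evenE)+
      define m where "m = (\<Sum>i\<in>{1..n}. d n i) div 2"
      have m: "(\<Sum>i\<in>{1..n}. d n i) = 2 * m" 
      proof -
        have "even (\<Sum>i\<in>{1..n}. d n i)" by (intro dvd_sum ev(2))
        thus ?thesis unfolding m_def by (rule dvd_mult_div_cancel[symmetric])
      qed
      have "n * 2 \<le> (\<Sum>i\<in>{1..n}. d n i)" using sum_bounded_below[of "{1..n}" 2 "d n"] ev(1) by simp
      hence mn: "n \<le> m" using m by simp
      have D2: "(real (?D n))\<^sup>2 \<le> real n / 4" using Dn mult_right_mono[OF \<delta>(2), of "real n"] by simp
      have DD: "real (?D n) \<le> (real (?D n))\<^sup>2"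
        unfolding power2_eq_square by (cases "?D n") (auto intro: mult_right_mono)
      have "real (2 * (?D n + ?D n * ?D n)) \<le> real m"
      proof -
        have "real (2 * (?D n + ?D n * ?D n)) = 2 * (real (?D n) + (real (?D n))\<^sup>2)" by (simp add: power2_eq_square)
        also have "\<dots> \<le> 4 * (real (?D n))\<^sup>2" using DD by simp
        also have "\<dots> \<le> real n" using D2 by simp
        finally show ?thesis using mn by simp
      qed
      hence m2: "2 * (?D n + ?D n * ?D n) \<le> m" by (simp only: of_nat_le_iff)
      have "?p n \<le> 2 * real m * exp (real (?D n + ?D n * ?D n) - real n * \<epsilon>)"
        using mn elim(4) by (intro prob_rho_le_counting elim(2,4) ev dD m m2 eps) auto
      also have "\<dots> \<le> exp (\<epsilon> / 4 * real n) * exp (\<epsilon> / 8 * real n - real n * \<epsilon>)"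
      proof (rule mult_mono)
        have "2 * m \<le> n * ?D n" unfolding m[symmetric] using sum_bounded_above[of "{1..n}" "d n" "?D n"] dD by simp
        hence "2 * real m \<le> real n * real (?D n)" by (metis of_nat_le_iff of_nat_mult of_nat_numeral)
        also have "\<dots> \<le> real n * real n"
        proof (rule mult_left_mono)
          show "real (?D n) \<le> real n" using order_trans[OF DD D2] by (rule order_trans) simp
        qed simp
        also have "\<dots> \<le> exp (\<epsilon> / 4 * real n)" using elim(1) by (simp add: power2_eq_square)
        finally show "2 * real m \<le> exp (\<epsilon> / 4 * real n)" .
        have "real (?D n + ?D n * ?D n) \<le> 2 * (\<delta> * real n)" using DD Dn by (simp add: power2_eq_square)
        also have "\<dots> \<le> 2 * (\<epsilon> / 16 * real n)" using \<delta>(3) by (intro mult_left_mono mult_right_mono) auto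
        also have "\<dots> = \<epsilon> / 8 * real n" by simp
        finally have "real (?D n + ?D n * ?D n) \<le> \<epsilon> / 8 * real n" .
        thus "exp (real (?D n + ?D n * ?D n) - real n * \<epsilon>) \<le> exp (\<epsilon> / 8 * real n - real n * \<epsilon>)"
          unfolding exp_le_cancel_iff by (rule diff_right_mono)
      qed auto
      \<comment> \<open>Here 5/8 is what remains of 1 after losing 1/4 and 1/8. The target exponent
        needs only 5/16, because \<open>D^2 \<le> n / 4\<close>.\<close>
      also have "\<dots> = exp (- (5 / 8 * (\<epsilon> * real n)))" by (simp add: exp_add[symmetric] field_simps)
      also have "\<dots> \<le> exp (- (\<epsilon> / 4) * ((real (?D n))\<^sup>2 + real n))"
      proof -
        have "\<epsilon> * (real (?D n))\<^sup>2 \<le> \<epsilon> * (real n / 4)" using D2 eps by (intro mult_left_mono) auto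
        moreover have "0 \<le> \<epsilon> * real n" using eps by simp
        ultimately show ?thesis by (simp add: distrib_left)
      qed
      finally show "?p n \<le> exp (- (\<epsilon> / 4) * ((real (?D n))\<^sup>2 + real n))" .
    qed
  qed
  \<comment> \<open>In the first regime the premise eventually fails; only the second one calls for
    the bound that holds for every graph.\<close>
  have dense: "\<forall>\<^sub>F n in sequentially. (real (?D n))\<^sup>2 > \<delta> * real n \<longrightarrow> ?p n = 0"
    using regime
  proof
    assume "(\<lambda>n. (real (?D n))\<^sup>2) \<in> o(\<lambda>n. real n)"
    from landau_o.smallD[OF this \<delta>(1)] show ?thesis by eventually_elim auto
  next
    assume "(\<lambda>n. (ln (real n)) ^ 8) \<in> o(\<lambda>n. real (?D n)) \<and>
        (\<exists>\<gamma>>0. \<forall>\<^sub>F n in sequentially. real (d_min n (d n)) \<ge> \<gamma> * real (?D n))"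
    then obtain \<gamma> where \<gamma>: "\<gamma> > 0" "\<forall>\<^sub>F n in sequentially. real (d_min n (d n)) \<ge> \<gamma> * real (?D n)" by blast
    \<comment> \<open>This makes \<open>4 * a\<close> at most \<open>\<epsilon> / 4\<close>; the
      term with \<open>D^(-1/4)\<close> gets \<open>\<epsilon> / 2\<close>.\<close>
    define a where "a = min 1 (\<epsilon> / 16)"
    have a: "0 < a" "a \<le> 1" "a \<le> \<epsilon> / 16" using eps by (auto simp: a_def)
    define C where "C = 2 / (a\<^sup>2 * \<gamma>) + 4"
    have "\<forall>\<^sub>F x::real in at_top. C * x powr (-1/4) \<le> \<epsilon> / 2" using eps by real_asymp
    then obtain X where X: "\<And>x. x \<ge> X \<Longrightarrow> C * x powr (-1/4) \<le> \<epsilon> / 2" by (auto simp: eventually_at_top_linorder)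
    \<comment> \<open>Under the premise \<open>D^2 > \<delta> * n\<close> this pushes
      \<open>D\<close> beyond the threshold \<open>X\<close>.\<close>
    have "\<forall>\<^sub>F n::nat in sequentially. (max X 1)\<^sup>2 \<le> \<delta> * real n" using \<delta>(1) by real_asymp
    thus ?thesis using \<gamma>(2) graphical pos_even eventually_gt_at_top[of 0]
    proof eventually_elim
      case (elim n)
      show ?case
      proof
        assume Dn: "(real (?D n))\<^sup>2 > \<delta> * real n"
        hence "(max X 1)\<^sup>2 < (real (?D n))\<^sup>2" using elim(1) by simp
        hence DX: "max X 1 < real (?D n)" by (rule power2_less_imp_less) simp
        have "rho n E \<le> rho_hat n E + \<epsilon>" if E: "E \<in> graphs_with_degrees n (d n)" for E
        proof -
          have "rho n E \<le> rho_hat n E + 4 * a + (2 / (a\<^sup>2 * \<gamma>) + 4) * real (?D n) powr (-1/4)"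
          proof (rule rho_le_deterministic[OF E elim(5) _ _ _ \<gamma>(1) a(1,2)])
            show "0 < d n i \<and> even (d n i)" if "i \<in> {1..n}" for i using elim(4) that by blast
            show "\<gamma> * real (?D n) \<le> real (d n i) \<and> d n i \<le> ?D n" if "i \<in> {1..n}" for i
              using elim(2) dm[OF that] dD[OF that] by (auto intro: order_trans)
            show "?D n > 0" using DX by simp
          qed
          also have "\<dots> \<le> rho_hat n E + \<epsilon>" using X[of "real (?D n)"] DX a(3) eps unfolding C_def by simp
          finally show ?thesis .
        qed
        hence "graphs_with_degrees n (d n) \<inter> {G. rho n G > rho_hat n G + \<epsilon>} = {}" by force
        thus "?p n = 0" by (simp add: prob_random_graph[OF elim(3)])
      qed
    qed
  qed
  have "\<forall>\<^sub>F n in sequentially. ?p n \<le> exp (- (\<epsilon> / 4) * ((real (?D n))\<^sup>2 + real n))"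
    using sparse dense
  proof eventually_elim
    case (elim n)
    show ?case
    proof (cases "(real (?D n))\<^sup>2 \<le> \<delta> * real n")
      case False
      hence "?p n = 0" using elim(2) by simp
      thus ?thesis by (simp only: exp_ge_zero)
    qed (use elim(1) in blast)
  qed
  thus ?thesis using eps by (intro exI[of _ "\<epsilon> / 4"]) auto
qed

end
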